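(* Let $H$ be a simple graph on vertex set $[h]=\{1,\dots,h\}$, where $h\ge2$, and let $F$ be obtained from $H$ by replacing each edge $ij\in E(H)$ with a (fresh copy of a) rooted theta pattern, which may depend on $ij$, identifying its roots with $i$ and $j$. For $ij\in E(H)$, let $h_{ij}(r)$ be the number of root-to-root paths of length $r$ used in the replacement of $ij$; for $ij\notin E(H)$, put $h_{ij}(r)=0$. Define $$C=\binom h2,\qquad N_r=\sum_{ij\in\binom{[h]}{2}}h_{ij}(r),\qquad \alpha_r=\frac{N_r}{C}.$$ Suppose that $e(F)>0$ and that one of the following two conditions holds: (1) $N_r$ is divisible by $\binom h2$ for every $r\ge1$; (2) $N_r=0$ for all but one value of $r$, and for the exceptional value one has $N_r\ge\binom h2$. Then $F$ is Sidorenko-good. Moreover, in case (1), let $\Theta_{\mathrm{av}}$ be the rooted theta pattern with exactly $\alpha_r$ branches of length $r$ for each $r$. If $\Theta_{\mathrm{av}}$ has at least two root-to-root branches, then for a bounded doubly nonnegative kernel $K$ with $\|K\|_1>0$, equality $$t(F,K)=\|K\|_1^{e(F)}$$ holds if and only if $K=\|K\|_1$ almost everywhere. In case (2), where the only exceptional length is $r$, the same conclusion holds (for bounded doubly nonnegative $K$ with $\|K\|_1>0$, equality $t(F,K)=\|K\|_1^{e(F)}$ holds if and only if $K=\|K\|_1$ a.e.) provided that the uniform graph $K_h[P_r]$ is Sidorenko-good-forcing.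
   Context: Graphs are finite and loopless; parallel edges are allowed unless a graph is called simple, and $e(F)$ counts edges with multiplicity. A kernel is a bounded symmetric measurable function $K:[0,1]^2\to\mathbb{R}$. For a graph $F$ and a nonnegative kernel $K$, $$t(F,K)=\int_{[0,1]^{V(F)}}\prod_{ij\in E(F)}K(x_i,x_j)\prod_{i\in V(F)}dx_i,$$ with the product over edges taken with multiplicity, and $\|K\|_1=\int_{[0,1]^2}K\,dx\,dy$. A rooted theta pattern $P(r_1,\ldots,r_s)$ ($s\ge1$, integers $r_i\ge1$) consists of two distinct root vertices joined by $s$ internally disjoint root-to-root paths (branches) of lengths $r_1,\ldots,r_s$ (length = number of edges); several $r_i$ may equal $1$, giving parallel edges between the roots. $\binom{[h]}{2}$ is the set of unordered pairs of distinct elements of $[h]$. $K_h[P_r]$ is the graph obtained from the complete graph $K_h$ by replacing every edge with a path of length $r$. A kernel $K$ is doubly nonnegative if $K\ge0$ a.e. and $\int_{[0,1]^2}f(x)K(x,y)f(y)\,dx\,dy\ge0$ for every bounded measurable $f:[0,1]\to\mathbb{R}$. A graph $G$ is Sidorenko-good if $t(G,K)\ge\|K\|_1^{e(G)}$ for every (bounded) doubly nonnegative kernel $K$. A Sidorenko-good graph $G$ is Sidorenko-good-forcing if equality for a doubly nonnegative kernel $K$ with $\|K\|_1\in(0,\infty)$ implies $K=\|K\|_1$ a.e. *)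

theory Defs
  imports "HOL-Analysis.Analysis" "HOL-Library.Multiset" "HOL-Library.Ramsey"
begin

section \<open>Finite loopless multigraphs\<close>

text \<open>Every edge has its own name, so parallel edges are distinct edges with the same ends.
  The two ends of an edge are listed in an arbitrary order; only symmetric kernels
  are ever evaluated at them.\<close>

record ('v, 'e) mgraph =
  vertices :: "'v set"
  edges :: "'e set"
  ends :: "'e \<Rightarrow> 'v \<times> 'v"

definition multigraph :: "('v, 'e) mgraph \<Rightarrow> bool" where
  "multigraph G \<longleftrightarrow> finite (vertices G) \<and> finite (edges G) \<and>
     (\<forall>e\<in>edges G. fst (ends G e) \<in> vertices G \<and> snd (ends G e) \<in> vertices G \<and>
        fst (ends G e) \<noteq> snd (ends G e))"

definition num_edges :: "('v, 'e) mgraph \<Rightarrow> nat" where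
  "num_edges G = card (edges G)"

section \<open>Kernels and homomorphism densities\<close>

abbreviation unit_square :: "(real \<times> real) measure" where
  "unit_square \<equiv> lebesgue_on ({0..1} \<times> {0..1})"

definition kernel :: "(real \<times> real \<Rightarrow> real) \<Rightarrow> bool" where
  "kernel K \<longleftrightarrow> K \<in> borel_measurable unit_square \<and>
     (\<exists>B. \<forall>x\<in>{0..1}. \<forall>y\<in>{0..1}. \<bar>K (x, y)\<bar> \<le> B) \<and>
     (\<forall>x\<in>{0..1}. \<forall>y\<in>{0..1}. K (x, y) = K (y, x))"

text \<open>This is the $L^1$ norm for the (almost everywhere) nonnegative kernels it is applied to.\<close>

definition kernel_norm1 :: "(real \<times> real \<Rightarrow> real) \<Rightarrow> real" where
  "kernel_norm1 K = (LINT p|unit_square. K p)"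

text \<open>The completion turns the finite product measure into Lebesgue measure on the cube; without
  it the integrand need not be measurable when \<open>K\<close> is Lebesgue but not Borel measurable.\<close>

definition hom_density :: "('v, 'e) mgraph \<Rightarrow> (real \<times> real \<Rightarrow> real) \<Rightarrow> real" where
  "hom_density G K =
     (LINT x|completion (\<Pi>\<^sub>M v\<in>vertices G. lebesgue_on {0..1}).
        (\<Prod>e\<in>edges G. K (x (fst (ends G e)), x (snd (ends G e)))))"

definition doubly_nonnegative :: "(real \<times> real \<Rightarrow> real) \<Rightarrow> bool" where
  "doubly_nonnegative K \<longleftrightarrow> kernel K \<and> (AE p in unit_square. 0 \<le> K p) \<and>
     (\<forall>f \<in> borel_measurable (lebesgue_on {0..1}). (\<exists>B. \<forall>x\<in>{0..1}. \<bar>f x\<bar> \<le> B) \<longrightarrow>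
        0 \<le> (LINT p|unit_square. f (fst p) * K p * f (snd p)))"

definition Sidorenko_good :: "('v, 'e) mgraph \<Rightarrow> bool" where
  "Sidorenko_good G \<longleftrightarrow>
     (\<forall>K. doubly_nonnegative K \<longrightarrow> hom_density G K \<ge> kernel_norm1 K ^ num_edges G)"

definition Sidorenko_good_forcing :: "('v, 'e) mgraph \<Rightarrow> bool" where
  "Sidorenko_good_forcing G \<longleftrightarrow> Sidorenko_good G \<and>
     (\<forall>K. doubly_nonnegative K \<longrightarrow> kernel_norm1 K > 0 \<longrightarrow>
        hom_density G K = kernel_norm1 K ^ num_edges G \<longrightarrow>
        (AE p in unit_square. K p = kernel_norm1 K))"

section \<open>Replacing edges by theta patterns\<close>

text \<open>A rooted theta pattern is determined by the multiset of its branch lengths.\<close>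

definition theta_pattern :: "nat multiset \<Rightarrow> bool" where
  "theta_pattern \<Theta> \<longleftrightarrow> \<Theta> \<noteq> {#} \<and> (\<forall>r\<in>#\<Theta>. r \<ge> 1)"

text \<open>The branches of length \<open>r\<close> replacing the edge \<open>e\<close> are numbered by \<open>k < count (P e) r\<close>.
  \<open>Internal e r k p\<close> is the vertex at distance \<open>p\<close> from the root \<open>Min e\<close> on such a branch,
  \<open>0 < p < r\<close>, and the edge \<open>(e, r, k, p)\<close> joins positions \<open>p\<close> and \<open>p + 1\<close>. Exchanging the two
  roots of a theta pattern is an automorphism, so running all branches from \<open>Min e\<close> to
  \<open>Max e\<close> is no restriction.\<close>

datatype vertex = Root nat | Internal "nat set" nat nat nat

definition branch_vertex :: "nat set \<Rightarrow> nat \<Rightarrow> nat \<Rightarrow> nat \<Rightarrow> vertex" where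
  "branch_vertex e r k p =
     (if p = 0 then Root (Min e) else if p = r then Root (Max e) else Internal e r k p)"

definition replace_edges ::
  "nat \<Rightarrow> nat set set \<Rightarrow> (nat set \<Rightarrow> nat multiset) \<Rightarrow>
     (vertex, nat set \<times> nat \<times> nat \<times> nat) mgraph" where
  "replace_edges h E P =
     \<lparr> vertices = Root ` {1..h} \<union>
         {Internal e r k p |e r k p. e \<in> E \<and> k < count (P e) r \<and> 0 < p \<and> p < r},
       edges = {(e, r, k, p). e \<in> E \<and> k < count (P e) r \<and> p < r},
       ends = (\<lambda>(e, r, k, p). (branch_vertex e r k p, branch_vertex e r k (p + 1))) \<rparr>"

text \<open>The graph $K_h[P_r]$: a path of length \<open>r\<close> is a theta pattern with one branch.\<close>

definition uniform_subdivision ::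
  "nat \<Rightarrow> nat \<Rightarrow> (vertex, nat set \<times> nat \<times> nat \<times> nat) mgraph" where
  "uniform_subdivision h r = replace_edges h (nsets {1..h} 2) (\<lambda>_. {#r#})"

definition branch_count ::
  "nat set set \<Rightarrow> (nat set \<Rightarrow> nat multiset) \<Rightarrow> nat set \<Rightarrow> nat \<Rightarrow> nat" where
  "branch_count E P e r = (if e \<in> E then count (P e) r else 0)"

definition total_branches ::
  "nat \<Rightarrow> nat set set \<Rightarrow> (nat set \<Rightarrow> nat multiset) \<Rightarrow> nat \<Rightarrow> nat" where
  "total_branches h E P r = (\<Sum>e\<in>nsets {1..h} 2. branch_count E P e r)"

definition average_branches ::
  "nat \<Rightarrow> nat set set \<Rightarrow> (nat set \<Rightarrow> nat multiset) \<Rightarrow> nat \<Rightarrow> real" where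
  "average_branches h E P r = real (total_branches h E P r) / real (h choose 2)"

definition average_pattern ::
  "nat \<Rightarrow> nat set set \<Rightarrow> (nat set \<Rightarrow> nat multiset) \<Rightarrow> nat multiset" where
  "average_pattern h E P = (THE \<Theta>. \<forall>r. real (count \<Theta> r) = average_branches h E P r)"

lemma finite_nsets_2: "finite (nsets {1..h::nat} 2)"
  by (rule finite_imp_finite_nsets) simp

lemma nsets_2_Min_Max:
  assumes "e \<in> nsets {1..h::nat} 2"
  shows "Min e \<in> {1..h}" "Max e \<in> {1..h}" "Min e \<noteq> Max e"
proof -
  have fin: "finite e" and sub: "e \<subseteq> {1..h}" and card: "card e = 2"
    using assms by (auto simp: nsets_def)
  have ne: "e \<noteq> {}" using card by auto
  show "Min e \<in> {1..h}" "Max e \<in> {1..h}"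
    using Min_in[OF fin ne] Max_in[OF fin ne] sub by auto
  obtain a b where "e = {a, b}" "a \<noteq> b" using card by (auto simp: card_2_iff)
  then show "Min e \<noteq> Max e" by (auto simp: min_def max_def)
qed

lemma multigraph_replace_edges:
  assumes E: "E \<subseteq> nsets {1..h} 2"
  shows "multigraph (replace_edges h E P)"
proof -
  have finE: "finite E" using E finite_nsets_2 finite_subset by blast
  have "finite (edges (replace_edges h E P))"
  proof -
    have "edges (replace_edges h E P) \<subseteq>
        (\<Union>e\<in>E. \<Union>r\<in>set_mset (P e). {e} \<times> {r} \<times> {..<count (P e) r} \<times> {..<r})"
    proof
      fix d assume "d \<in> edges (replace_edges h E P)"
      then obtain e r k p where d: "d = (e, r, k, p)" "e \<in> E" "k < count (P e) r" "p < r"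
        by (auto simp: replace_edges_def)
      then have "r \<in># P e" by (metis not_less_zero not_in_iff)
      with d show "d \<in> (\<Union>e\<in>E. \<Union>r\<in>set_mset (P e). {e} \<times> {r} \<times> {..<count (P e) r} \<times> {..<r})"
        by blast
    qed
    then show ?thesis by (rule finite_subset) (use finE in auto)
  qed
  moreover have "vertices (replace_edges h E P) \<subseteq>
      Root ` {1..h} \<union> (\<lambda>(e, r, k, p). Internal e r k p) ` edges (replace_edges h E P)"
  proof
    fix v assume "v \<in> vertices (replace_edges h E P)"
    then consider "v \<in> Root ` {1..h}"
      | e r k p where "v = Internal e r k p" "(e, r, k, p) \<in> edges (replace_edges h E P)"
      by (auto simp: replace_edges_def)
    then show "v \<in> Root ` {1..h} \<union>
        (\<lambda>(e, r, k, p). Internal e r k p) ` edges (replace_edges h E P)"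
      by cases (simp, force)
  qed
  then have "finite (vertices (replace_edges h E P))"
    by (rule finite_subset) (use calculation in auto)
  moreover have "fst (ends (replace_edges h E P) d) \<in> vertices (replace_edges h E P) \<and>
      snd (ends (replace_edges h E P) d) \<in> vertices (replace_edges h E P) \<and>
      fst (ends (replace_edges h E P) d) \<noteq> snd (ends (replace_edges h E P) d)"
    if "d \<in> edges (replace_edges h E P)" for d
  proof -
    obtain e r k p where d: "d = (e, r, k, p)" by (metis prod_cases4)
    with that have *: "e \<in> E" "k < count (P e) r" "p < r" by (auto simp: replace_edges_def)
    then have "e \<in> nsets {1..h} 2" using E by auto
    from nsets_2_Min_Max[OF this] * show ?thesis
      by (auto simp: d replace_edges_def branch_vertex_def)
  qed
  ultimately show ?thesis by (auto simp: multigraph_def)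
qed

lemma count_average_pattern:
  assumes h: "h \<ge> 2" and E: "E \<subseteq> nsets {1..h} 2" and P: "\<forall>e\<in>E. theta_pattern (P e)"
    and dvd: "\<forall>r\<ge>1. (h choose 2) dvd total_branches h E P r"
  shows "real (count (average_pattern h E P) r) = average_branches h E P r"
proof -
  have C: "h choose 2 > 0" using h by simp
  have finE: "finite E" using E finite_nsets_2 finite_subset by blast
  have zero: "total_branches h E P 0 = 0"
  proof -
    have "branch_count E P e 0 = 0" for e
    proof (cases "e \<in> E")
      case True
      then have "0 \<notin># P e" using P by (force simp: theta_pattern_def)
      then show ?thesis by (simp add: branch_count_def not_in_iff)
    qed (simp add: branch_count_def)
    then show ?thesis by (simp add: total_branches_def)
  qed
  have dvd': "(h choose 2) dvd total_branches h E P r" for r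
    using dvd zero by (cases "r = 0") auto
  have "{r. total_branches h E P r > 0} \<subseteq> (\<Union>e\<in>E. set_mset (P e))"
  proof
    fix r assume "r \<in> {r. total_branches h E P r > 0}"
    then have "total_branches h E P r \<noteq> 0" by simp
    then obtain e where "branch_count E P e r \<noteq> 0"
      unfolding total_branches_def by (meson sum.neutral)
    then have "e \<in> E" "r \<in># P e"
      by (auto simp: branch_count_def not_in_iff split: if_splits)
    then show "r \<in> (\<Union>e\<in>E. set_mset (P e))" by blast
  qed
  moreover have "{r. total_branches h E P r div (h choose 2) > 0}
      \<subseteq> {r. total_branches h E P r > 0}"
    using gr_zeroI by fastforce
  ultimately have fin: "finite {r. total_branches h E P r div (h choose 2) > 0}"
    using finE by (meson finite_UN finite_set_mset finite_subset)
  have ex: "\<exists>!\<Theta>. \<forall>r. real (count \<Theta> r) = average_branches h E P r"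
  proof (rule ex1I)
    show "\<forall>r. real (count (Abs_multiset (\<lambda>r. total_branches h E P r div (h choose 2))) r) =
        average_branches h E P r"
      using dvd' C by (simp add: fin average_branches_def real_of_nat_div)
  next
    fix \<Theta> assume *: "\<forall>r. real (count \<Theta> r) = average_branches h E P r"
    show "\<Theta> = Abs_multiset (\<lambda>r. total_branches h E P r div (h choose 2))"
    proof (rule multiset_eqI)
      fix r
      have "real (count \<Theta> r) =
          real (count (Abs_multiset (\<lambda>r. total_branches h E P r div (h choose 2))) r)"
        using * dvd' C by (simp add: fin average_branches_def real_of_nat_div)
      then show "count \<Theta> r =
          count (Abs_multiset (\<lambda>r. total_branches h E P r div (h choose 2))) r"
        by simp
    qed
  qed
  show ?thesis using theI'[OF ex] unfolding average_pattern_def by blast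
qed

end

theory Submission
  imports Defs "HOL-Probability.Probability" "HOL-Combinatorics.Permutations"
begin

text \<open>
  Let \<open>p\<close> be the integral of the kernel \<open>K\<close> and \<open>K\<^bsup>(r)\<^esup>\<close> its \<open>r\<close>-th power as an integral operator.
  Integrating out the inner vertices of the branches (\<open>branches_integral\<close>) turns the density of \<open>F\<close>
  into an integral over the \<open>h\<close> roots of the product of \<open>K\<^bsup>(r)\<^esup>(x\<^sub>i, x\<^sub>j)\<close> over all branches. Permuting the
  roots does not change this integral, so it is the integral of the mean of these products over all
  permutations. By the inequality of arithmetic and geometric means it can only decrease when the
  mean is replaced by the geometric mean, in which every pair carries \<open>\<alpha>\<^sub>r\<close> branches of length \<open>r\<close>.

  If all \<open>\<alpha>\<^sub>r\<close> are integers, the geometric mean is the product of \<open>W(x\<^sub>i, x\<^sub>j)\<close> over all pairs, where \<open>W\<close> is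
  the kernel of the averaged theta pattern (\<open>pattern_density_ge_average\<close>). As a Schur product of
  semidefinite kernels \<open>W\<close> is semidefinite (\<open>psd_mult\<close>), and two inequalities remain.

  For complete graphs, the density of \<open>W\<close> is at least \<open>(\<integral> W)\<^bsup>C\<^esup>\<close> (\<open>clique_density_ge\<close>). The proof is an
  induction on the number of vertices with a weight on the vertices: fixing one vertex \<open>z\<close> multiplies
  the weight by \<open>W(\<cdot>, z)\<close>, and Cauchy--Schwarz for the form of \<open>W\<close> followed by Jensen's inequality
  over \<open>z\<close> closes the induction.

  For theta patterns with branch lengths \<open>r\<^sub>1, \<dots>, r\<^sub>s\<close>, the integral of \<open>W\<close> is at least \<open>p\<close> to the power
  \<open>r\<^sub>1 + \<dots> + r\<^sub>s\<close> (\<open>theta_integral_ge_power\<close>). Each \<open>K\<^bsup>(r)\<^esup>\<close> dominates the rank one kernel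
  \<open>(K\<^bsup>r\<^esup> u) \<otimes> (K\<^bsup>r\<^esup> u) / \<langle>u, K\<^bsup>r\<^esup> u\<rangle>\<close> in the Loewner order, and Schur products respect this order. If \<open>u\<close> is a
  nonnegative top eigenfunction of norm one with eigenvalue \<open>l \<ge> p\<close>, the product of the rank one
  bounds gives \<open>l\<close> to the power \<open>r\<^sub>1 + \<dots> + r\<^sub>s\<close> times \<open>(\<integral> u\<^bsup>s\<^esup>)\<^sup>2\<close>, and the last factor is at least one
  for \<open>s \<ge> 2\<close>. The normalised functions \<open>K\<^bsup>n\<^esup> 1\<close> serve as approximate eigenfunctions. Equality forces \<open>l = p\<close>,
  hence constant row integrals; then all but two branches can be replaced by constants, and the
  semidefinite kernels \<open>K\<^bsup>(a)\<^esup> - p\<^bsup>a\<^esup>\<close> and \<open>K\<^bsup>(k)\<^esup> - p\<^bsup>k\<^esup>\<close> of these two have a Schur product of integral zero,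
  which is possible for \<open>K = p\<close> only (\<open>theta_integral_rigidity\<close>).

  If a single length \<open>r\<close> occurs and \<open>\<alpha>\<^sub>r \<ge> 1\<close>, the geometric mean is the \<open>\<alpha>\<^sub>r\<close>-th power of the integrand of
  the uniform subdivision, and Jensen's inequality bounds the density of \<open>F\<close> below by the \<open>\<alpha>\<^sub>r\<close>-th
  power of the density of that graph (\<open>pattern_density_ge_one_length\<close>). Equality for \<open>F\<close> therefore
  implies equality for the uniform subdivision, to which the forcing hypothesis applies.
\<close>

section \<open>Bounded measurable functions\<close>

definition bounded_measurable :: "'a measure \<Rightarrow> ('a \<Rightarrow> real) \<Rightarrow> bool" where
  "bounded_measurable N f \<longleftrightarrow> f \<in> borel_measurable N \<and> (\<exists>B. \<forall>x. \<bar>f x\<bar> \<le> B)"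

named_theorems bm_intros

lemma bounded_measurableI:
  "f \<in> borel_measurable N \<Longrightarrow> (\<And>x. \<bar>f x\<bar> \<le> B) \<Longrightarrow> bounded_measurable N f"
  by (auto simp: bounded_measurable_def)

lemma bounded_measurable_measurable [measurable_dest]:
  "bounded_measurable N f \<Longrightarrow> f \<in> borel_measurable N"
  by (simp add: bounded_measurable_def)

lemma bounded_measurable_bound:
  assumes "bounded_measurable N f"
  obtains B where "B \<ge> 1" "\<And>x. \<bar>f x\<bar> \<le> B"
proof -
  obtain B where "\<And>x. \<bar>f x\<bar> \<le> B" using assms by (auto simp: bounded_measurable_def)
  then have "max B 1 \<ge> 1" "\<And>x. \<bar>f x\<bar> \<le> max B 1" by (auto simp: max.coboundedI1)
  then show ?thesis by (rule that)
qed

lemma bounded_measurable_const [bm_intros]: "bounded_measurable N (\<lambda>_. c)"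
  by (rule bounded_measurableI[where B="\<bar>c\<bar>"]) auto

lemma bounded_measurable_add [bm_intros]:
  assumes "bounded_measurable N f" "bounded_measurable N g"
  shows "bounded_measurable N (\<lambda>x. f x + g x)"
proof -
  obtain B C where "\<And>x. \<bar>f x\<bar> \<le> B" "\<And>x. \<bar>g x\<bar> \<le> C"
    using assms by (auto simp: bounded_measurable_def)
  then have "\<bar>f x + g x\<bar> \<le> B + C" for x
    using abs_triangle_ineq[of "f x" "g x"] add_mono order_trans by blast
  then show ?thesis using assms by (intro bounded_measurableI) (auto simp: bounded_measurable_def)
qed

lemma bounded_measurable_mult [bm_intros]:
  assumes "bounded_measurable N f" "bounded_measurable N g"
  shows "bounded_measurable N (\<lambda>x. f x * g x)"
proof -
  obtain B C where BC: "\<And>x. \<bar>f x\<bar> \<le> B" "\<And>x. \<bar>g x\<bar> \<le> C"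
    using assms by (auto simp: bounded_measurable_def)
  have "\<bar>f x * g x\<bar> \<le> B * C" for x
    unfolding abs_mult using BC[of x] by (intro mult_mono) (auto intro: order_trans[OF abs_ge_zero])
  then show ?thesis using assms by (intro bounded_measurableI) (auto simp: bounded_measurable_def)
qed

lemma bounded_measurable_minus [bm_intros]:
  assumes "bounded_measurable N f" shows "bounded_measurable N (\<lambda>x. - f x)"
  using assms by (auto simp: bounded_measurable_def)

lemma bounded_measurable_diff [bm_intros]:
  assumes "bounded_measurable N f" "bounded_measurable N g"
  shows "bounded_measurable N (\<lambda>x. f x - g x)"
  using bounded_measurable_add[OF assms(1) bounded_measurable_minus[OF assms(2)]] by simp

lemma bounded_measurable_divide_const [bm_intros]:
  assumes "bounded_measurable N f" shows "bounded_measurable N (\<lambda>x. f x / c)"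
  using bounded_measurable_mult[OF assms bounded_measurable_const[of N "1/c"]] by simp

lemma bounded_measurable_power [bm_intros]:
  assumes "bounded_measurable N f" shows "bounded_measurable N (\<lambda>x. f x ^ n)"
  by (induction n) (auto intro!: bm_intros assms)

lemma bounded_measurable_abs [bm_intros]:
  assumes "bounded_measurable N f" shows "bounded_measurable N (\<lambda>x. \<bar>f x\<bar>)"
  using assms by (auto simp: bounded_measurable_def)

lemma bounded_measurable_sum [bm_intros]:
  assumes "\<And>i. i \<in> I \<Longrightarrow> bounded_measurable N (f i)"
  shows "bounded_measurable N (\<lambda>x. \<Sum>i\<in>I. f i x)"
  using assms by (induction I rule: infinite_finite_induct) (auto intro!: bm_intros)

lemma bounded_measurable_prod [bm_intros]:
  assumes "\<And>i. i \<in> I \<Longrightarrow> bounded_measurable N (f i)"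
  shows "bounded_measurable N (\<lambda>x. \<Prod>i\<in>I. f i x)"
  using assms by (induction I rule: infinite_finite_induct) (auto intro!: bm_intros)

lemma bounded_measurable_compose:
  assumes "bounded_measurable N f" "g \<in> measurable N' N"
  shows "bounded_measurable N' (\<lambda>x. f (g x))"
  using assms measurable_compose[OF assms(2)] by (auto simp: bounded_measurable_def)

lemma bounded_measurable_indicator [bm_intros]:
  assumes "S \<in> sets N" shows "bounded_measurable N (indicator S)"
  by (rule bounded_measurableI[where B=1]) (use assms in \<open>auto simp: indicator_def\<close>)

lemma (in finite_measure) integrable_bounded_measurable:
  assumes "bounded_measurable M f" shows "integrable M f"
proof -
  obtain B where "\<And>x. \<bar>f x\<bar> \<le> B" using assms by (auto simp: bounded_measurable_def)
  then show ?thesis using assms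
    by (intro integrable_const_bound[where B=B]) (auto simp: bounded_measurable_def)
qed

lemma (in prob_space) bounded_measurable_integral:
  assumes "bounded_measurable (N \<Otimes>\<^sub>M M) (\<lambda>(x, y). F x y)"
  shows "bounded_measurable N (\<lambda>x. \<integral>y. F x y \<partial>M)"
proof -
  obtain B where B: "B \<ge> 1" "\<And>p. \<bar>(\<lambda>(x, y). F x y) p\<bar> \<le> B"
    using bounded_measurable_bound[OF assms] by metis
  have [measurable]: "(\<lambda>(x, y). F x y) \<in> borel_measurable (N \<Otimes>\<^sub>M M)"
    using assms by (simp add: bounded_measurable_def)
  have "\<bar>\<integral>y. F x y \<partial>M\<bar> \<le> B" for x
  proof (cases "integrable M (F x)")
    case True
    have "\<bar>\<integral>y. F x y \<partial>M\<bar> \<le> (\<integral>y. \<bar>F x y\<bar> \<partial>M)" by (rule integral_abs_bound)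
    also have "\<dots> \<le> (\<integral>y. B \<partial>M)"
      using True B(2)[of "(x, _)"] by (intro integral_mono) auto
    finally show ?thesis by (simp add: prob_space)
  next
    case False
    then show ?thesis using B(1) by (simp add: not_integrable_integral_eq)
  qed
  then show ?thesis by (intro bounded_measurableI[where B=B]) auto
qed

section \<open>Kernels as operators on a probability space\<close>

text \<open>The space is a whole type, so that kernels and test functions are total functions that are bounded
  everywhere and no side conditions on arguments arise.\<close>

locale full_prob_space = prob_space M for M :: "'a measure" +
  assumes space_UNIV [simp]: "space M = UNIV"
begin

sublocale square: pair_prob_space M M ..

abbreviation "bm \<equiv> bounded_measurable M"

abbreviation "M2 \<equiv> M \<Otimes>\<^sub>M M"

definition apply_kernel :: "('a \<times> 'a \<Rightarrow> real) \<Rightarrow> ('a \<Rightarrow> real) \<Rightarrow> 'a \<Rightarrow> real" where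
  "apply_kernel K f x = (\<integral>y. K (x, y) * f y \<partial>M)"

definition ip :: "('a \<Rightarrow> real) \<Rightarrow> ('a \<Rightarrow> real) \<Rightarrow> real" where
  "ip f g = (\<integral>x. f x * g x \<partial>M)"

definition sym_kernel :: "('a \<times> 'a \<Rightarrow> real) \<Rightarrow> bool" where
  "sym_kernel K \<longleftrightarrow> bounded_measurable M2 K \<and> (\<forall>x y. K (x, y) = K (y, x))"

definition psd :: "('a \<times> 'a \<Rightarrow> real) \<Rightarrow> bool" where
  "psd K \<longleftrightarrow> sym_kernel K \<and> (\<forall>f. bm f \<longrightarrow> 0 \<le> ip f (apply_kernel K f))"

lemma sym_kernel_bm: "sym_kernel K \<Longrightarrow> bounded_measurable M2 K"
  and sym_kernel_sym: "sym_kernel K \<Longrightarrow> K (x, y) = K (y, x)"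
  by (auto simp: sym_kernel_def)

lemma psd_sym: "psd K \<Longrightarrow> sym_kernel K"
  and psd_form: "psd K \<Longrightarrow> bm f \<Longrightarrow> 0 \<le> ip f (apply_kernel K f)"
  by (auto simp: psd_def)

lemmas bm_integrable = integrable_bounded_measurable

lemma prob_UNIV [simp]: "prob UNIV = 1"
  using prob_space by simp

lemma bm_section:
  assumes "bounded_measurable M2 K"
  shows "bm (\<lambda>y. K (x, y))" "bm (\<lambda>y. K (y, x))"
  using assms by (auto intro!: bounded_measurable_compose[OF assms])

lemma bm_fst [bm_intros]: "bm f \<Longrightarrow> bounded_measurable (M \<Otimes>\<^sub>M N) (\<lambda>p. f (fst p))"
  and bm_snd [bm_intros]: "bm f \<Longrightarrow> bounded_measurable (N \<Otimes>\<^sub>M M) (\<lambda>p. f (snd p))"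
  by (auto intro: bounded_measurable_compose)

lemma bm_integral_kernel:
  assumes "bounded_measurable M2 K"
  shows "bm (\<lambda>x. \<integral>y. K (x, y) \<partial>M)"
  by (rule bounded_measurable_integral) (use assms in \<open>simp add: case_prod_beta'\<close>)

lemma bm_apply [bm_intros]:
  assumes "bounded_measurable M2 K" "bm f"
  shows "bm (apply_kernel K f)"
proof -
  have "bounded_measurable M2 (\<lambda>p. K p * f (snd p))"
    by (intro bm_intros assms)
  from bm_integral_kernel[OF this] show ?thesis by (simp add: apply_kernel_def[abs_def])
qed

lemma integral_swap:
  assumes "bounded_measurable M2 F"
  shows "(\<integral>x. \<integral>y. F (x, y) \<partial>M \<partial>M) = (\<integral>y. \<integral>x. F (x, y) \<partial>M \<partial>M)"
  using square.Fubini_integral[of "\<lambda>x y. F (x, y)"] square.integrable_bounded_measurable[OF assms]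
  by simp

lemma integral_square:
  assumes "bounded_measurable M2 F"
  shows "(\<integral>p. F p \<partial>M2) = (\<integral>x. \<integral>y. F (x, y) \<partial>M \<partial>M)"
  using square.integral_fst'[OF square.integrable_bounded_measurable[OF assms]] by simp

lemma form_integral:
  assumes "bounded_measurable M2 K" "bm f" "bm g"
  shows "ip f (apply_kernel K g) = (\<integral>p. f (fst p) * K p * g (snd p) \<partial>M2)"
proof -
  have "(\<integral>p. f (fst p) * K p * g (snd p) \<partial>M2) =
      (\<integral>x. \<integral>y. f x * K (x, y) * g y \<partial>M \<partial>M)"
    by (subst integral_square) (auto intro!: bm_intros assms)
  also have "\<dots> = ip f (apply_kernel K g)"
    by (simp add: ip_def apply_kernel_def mult.assoc)
  finally show ?thesis by simp
qed

lemma ip_commute: "ip f g = ip g f"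
  by (simp add: ip_def mult.commute)

lemma form_sym:
  assumes "sym_kernel K" "bm f" "bm g"
  shows "ip f (apply_kernel K g) = ip (apply_kernel K f) g"
proof -
  have "ip f (apply_kernel K g) = (\<integral>x. \<integral>y. f x * K (x, y) * g y \<partial>M \<partial>M)"
    by (simp add: ip_def apply_kernel_def mult.assoc)
  also have "\<dots> = (\<integral>y. \<integral>x. f x * K (x, y) * g y \<partial>M \<partial>M)"
    using integral_swap[of "\<lambda>p. f (fst p) * K p * g (snd p)"]
      bounded_measurable_mult[OF bounded_measurable_mult[OF bm_fst[OF assms(2)]
        sym_kernel_bm[OF assms(1)]] bm_snd[OF assms(3)]]
    by simp
  also have "\<dots> = (\<integral>y. (\<integral>x. K (y, x) * f x \<partial>M) * g y \<partial>M)"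
    by (simp add: sym_kernel_sym[OF assms(1), of _ y for y] mult.commute flip: integral_mult_left_zero)
  finally show ?thesis by (simp add: ip_def apply_kernel_def)
qed

lemma ip_add_left: "bm f \<Longrightarrow> bm g \<Longrightarrow> bm h \<Longrightarrow> ip (\<lambda>x. f x + g x) h = ip f h + ip g h"
  by (simp add: ip_def distrib_right bm_integrable bm_intros)

lemma ip_add_right: "bm f \<Longrightarrow> bm g \<Longrightarrow> bm h \<Longrightarrow> ip h (\<lambda>x. f x + g x) = ip h f + ip h g"
  by (simp add: ip_def distrib_left bm_integrable bm_intros)

lemma ip_diff_left: "bm f \<Longrightarrow> bm g \<Longrightarrow> bm h \<Longrightarrow> ip (\<lambda>x. f x - g x) h = ip f h - ip g h"
  by (simp add: ip_def left_diff_distrib bm_integrable bm_intros)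

lemma ip_diff_right: "bm f \<Longrightarrow> bm g \<Longrightarrow> bm h \<Longrightarrow> ip h (\<lambda>x. f x - g x) = ip h f - ip h g"
  by (simp add: ip_def right_diff_distrib bm_integrable bm_intros)

lemma ip_scale_left: "ip (\<lambda>x. c * f x) g = c * ip f g"
  and ip_scale_right: "ip f (\<lambda>x. c * g x) = c * ip f g"
  by (simp_all add: ip_def mult.assoc mult.left_commute)

lemma ip_self_nonneg: "0 \<le> ip f f"
  by (simp add: ip_def)

lemma apply_add:
  assumes "bounded_measurable M2 K" "bm f" "bm g"
  shows "apply_kernel K (\<lambda>x. f x + g x) = (\<lambda>x. apply_kernel K f x + apply_kernel K g x)"
  using assms by (auto simp: apply_kernel_def fun_eq_iff distrib_left intro!: bm_integrable bm_intros bm_section Bochner_Integration.integral_add)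

lemma apply_diff:
  assumes "bounded_measurable M2 K" "bm f" "bm g"
  shows "apply_kernel K (\<lambda>x. f x - g x) = (\<lambda>x. apply_kernel K f x - apply_kernel K g x)"
  using assms by (auto simp: apply_kernel_def fun_eq_iff right_diff_distrib intro!: bm_integrable bm_intros bm_section Bochner_Integration.integral_diff)

lemma apply_scale: "apply_kernel K (\<lambda>x. c * f x) = (\<lambda>x. c * apply_kernel K f x)"
  by (simp add: apply_kernel_def fun_eq_iff mult.left_commute)

lemma apply_kernel_add:
  assumes "bounded_measurable M2 K" "bounded_measurable M2 L" "bm f"
  shows "apply_kernel (\<lambda>p. K p + L p) f = (\<lambda>x. apply_kernel K f x + apply_kernel L f x)"
  using assms by (auto simp: apply_kernel_def fun_eq_iff distrib_right intro!: bm_integrable bm_intros bm_section Bochner_Integration.integral_add)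

lemma apply_kernel_diff:
  assumes "bounded_measurable M2 K" "bounded_measurable M2 L" "bm f"
  shows "apply_kernel (\<lambda>p. K p - L p) f = (\<lambda>x. apply_kernel K f x - apply_kernel L f x)"
  using assms by (auto simp: apply_kernel_def fun_eq_iff left_diff_distrib intro!: bm_integrable bm_intros bm_section Bochner_Integration.integral_diff)

lemma apply_kernel_scale: "apply_kernel (\<lambda>p. c * K p) f = (\<lambda>x. c * apply_kernel K f x)"
  by (simp add: apply_kernel_def fun_eq_iff mult.assoc)

end

text \<open>Every Cauchy--Schwarz inequality below is an instance: the polynomial is the value of a
  semidefinite form at \<open>f + t g\<close>.\<close>

lemma quadratic_nonneg_imp_discriminant:
  fixes a b c :: real
  assumes "\<And>t. 0 \<le> a + 2 * t * b + t\<^sup>2 * c"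
  shows "b\<^sup>2 \<le> a * c"
proof (cases "c = 0")
  case True
  have "b = 0"
  proof (rule ccontr)
    assume "b \<noteq> 0"
    then show False using assms[of "- (a + 1) / (2 * b)"] True by (simp add: field_simps)
  qed
  then show ?thesis using True by simp
next
  case False
  have "c \<ge> 0"
  proof (rule ccontr)
    assume "\<not> c \<ge> 0"
    then have c: "c < 0" by simp
    define t where "t = 1 + (\<bar>a\<bar> + 2 * \<bar>b\<bar>) / (- c)"
    have t: "t \<ge> 1" "t * (- c) = (- c) + \<bar>a\<bar> + 2 * \<bar>b\<bar>" using c by (auto simp: t_def field_simps)
    have "a \<le> \<bar>a\<bar> * t" using t(1) mult_left_mono[of 1 t "\<bar>a\<bar>"] by simp
    moreover have "2 * t * b \<le> t * (2 * \<bar>b\<bar>)" using t(1) by (simp add: mult_left_mono)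
    moreover have "t\<^sup>2 * c = - t * ((- c) + \<bar>a\<bar> + 2 * \<bar>b\<bar>)"
      unfolding t(2)[symmetric] by (simp add: power2_eq_square)
    moreover have "t * (- c) > 0" using t(1) c by (simp add: zero_less_mult_iff mult_pos_neg)
    ultimately have "a + 2 * t * b + t\<^sup>2 * c < 0" by (simp add: algebra_simps)
    then show False using assms[of t] by simp
  qed
  with False have "c > 0" by simp
  then show ?thesis using assms[of "- b / c"] by (simp add: field_simps power2_eq_square)
qed

context full_prob_space
begin

lemma ip_cauchy_schwarz:
  assumes "bm f" "bm g" shows "(ip f g)\<^sup>2 \<le> ip f f * ip g g"
proof (rule quadratic_nonneg_imp_discriminant)
  fix t
  have "0 \<le> ip (\<lambda>x. f x + t * g x) (\<lambda>x. f x + t * g x)" by (rule ip_self_nonneg)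
  also have "\<dots> = ip f f + 2 * t * ip f g + t\<^sup>2 * ip g g"
    using assms by (simp add: ip_add_left ip_add_right ip_scale_left ip_scale_right bm_intros
        ip_commute[of g f] power2_eq_square algebra_simps)
  finally show "0 \<le> ip f f + 2 * t * ip f g + t\<^sup>2 * ip g g" .
qed

lemma psd_cauchy_schwarz:
  assumes "psd K" "bm f" "bm g"
  shows "(ip f (apply_kernel K g))\<^sup>2 \<le> ip f (apply_kernel K f) * ip g (apply_kernel K g)"
proof (rule quadratic_nonneg_imp_discriminant)
  fix t
  note K = psd_sym[OF assms(1)] sym_kernel_bm[OF psd_sym[OF assms(1)]]
  have eq: "ip g (apply_kernel K f) = ip f (apply_kernel K g)"
    using form_sym[OF K(1) assms(3,2)] by (simp add: ip_commute)
  have "0 \<le> ip (\<lambda>x. f x + t * g x) (apply_kernel K (\<lambda>x. f x + t * g x))"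
    by (intro psd_form[OF assms(1)] bm_intros assms)
  also have "\<dots> = ip f (apply_kernel K f) + 2 * t * ip f (apply_kernel K g) + t\<^sup>2 * ip g (apply_kernel K g)"
    using assms K by (simp add: apply_add apply_scale ip_add_left ip_add_right ip_scale_left ip_scale_right bm_intros
        eq power2_eq_square algebra_simps)
  finally show "0 \<le> ip f (apply_kernel K f) + 2 * t * ip f (apply_kernel K g) + t\<^sup>2 * ip g (apply_kernel K g)" .
qed

lemma sym_kernel_const: "sym_kernel (\<lambda>_. c)"
  and sym_kernel_add: "sym_kernel K \<Longrightarrow> sym_kernel L \<Longrightarrow> sym_kernel (\<lambda>p. K p + L p)"
  and sym_kernel_diff: "sym_kernel K \<Longrightarrow> sym_kernel L \<Longrightarrow> sym_kernel (\<lambda>p. K p - L p)"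
  and sym_kernel_mult: "sym_kernel K \<Longrightarrow> sym_kernel L \<Longrightarrow> sym_kernel (\<lambda>p. K p * L p)"
  and sym_kernel_rank_one: "bm f \<Longrightarrow> sym_kernel (\<lambda>p. c * f (fst p) * f (snd p))"
  by (auto simp: sym_kernel_def intro!: bm_intros)

lemma psd_add: "psd K \<Longrightarrow> psd L \<Longrightarrow> psd (\<lambda>p. K p + L p)"
  by (auto simp: psd_def sym_kernel_add apply_kernel_add sym_kernel_bm ip_add_right bm_intros)

lemma psd_scale:
  assumes "psd K" "c \<ge> 0" shows "psd (\<lambda>p. c * K p)"
  using assms sym_kernel_mult[OF sym_kernel_const[of c] psd_sym[OF assms(1)]]
  by (auto simp: psd_def apply_kernel_scale ip_scale_right)

text \<open>The Schur product with a rank one kernel \<open>f \<otimes> f\<close> moves the factor \<open>f\<close> into the test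
  function.\<close>

lemma form_rank_one_mult:
  assumes "sym_kernel K" "bm f" "bm g"
  shows "ip g (apply_kernel (\<lambda>p. c * f (fst p) * f (snd p) * K p) g) =
    c * ip (\<lambda>x. f x * g x) (apply_kernel K (\<lambda>x. f x * g x))"
  by (simp add: ip_def apply_kernel_def ac_simps flip: integral_mult_right_zero)

lemma psd_rank_one_mult:
  assumes "psd K" "bm f" "c \<ge> 0"
  shows "psd (\<lambda>p. c * f (fst p) * f (snd p) * K p)"
  unfolding psd_def using psd_sym[OF assms(1)] assms
  by (auto simp: form_rank_one_mult intro!: sym_kernel_mult sym_kernel_rank_one
      psd_form mult_nonneg_nonneg bm_intros)

end

section \<open>Powers of kernels\<close>

context full_prob_space
begin

definition comp_kernel :: "('a \<times> 'a \<Rightarrow> real) \<Rightarrow> ('a \<times> 'a \<Rightarrow> real) \<Rightarrow> 'a \<times> 'a \<Rightarrow> real" where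
  "comp_kernel A B p = (\<integral>z. A (fst p, z) * B (z, snd p) \<partial>M)"

definition kernel_power :: "('a \<times> 'a \<Rightarrow> real) \<Rightarrow> nat \<Rightarrow> 'a \<times> 'a \<Rightarrow> real" where
  "kernel_power K r = (comp_kernel K ^^ (r - 1)) K"

lemma bm_comp [bm_intros]:
  assumes A: "bounded_measurable M2 A" and B: "bounded_measurable M2 B"
  shows "bounded_measurable M2 (comp_kernel A B)"
proof -
  have "bounded_measurable (M2 \<Otimes>\<^sub>M M)
      (\<lambda>q. A (fst (fst q), snd q) * B (snd q, snd (fst q)))"
    by (intro bm_intros bounded_measurable_compose[OF A] bounded_measurable_compose[OF B]) auto
  then have "bounded_measurable (M2 \<Otimes>\<^sub>M M)
      (\<lambda>(p, z). A (fst p, z) * B (z, snd p))"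
    by (simp add: case_prod_beta')
  from bounded_measurable_integral[OF this] show ?thesis
    by (simp add: comp_kernel_def[abs_def])
qed

lemma comp_kernel_apply: "comp_kernel A B (x, y) = apply_kernel A (\<lambda>z. B (z, y)) x"
  by (simp add: comp_kernel_def apply_kernel_def)

lemma apply_comp:
  assumes A: "bounded_measurable M2 A" and B: "bounded_measurable M2 B"
    and f: "bm f"
  shows "apply_kernel (comp_kernel A B) f = apply_kernel A (apply_kernel B f)"
proof
  fix x
  have "bounded_measurable M2 (\<lambda>p. A (x, fst p) * B p * f (snd p))"
    by (intro bm_intros bounded_measurable_compose[OF A] B f) auto
  from integral_swap[OF this]
  show "apply_kernel (comp_kernel A B) f x = apply_kernel A (apply_kernel B f) x"
    by (simp add: apply_kernel_def comp_kernel_def mult.assoc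
        flip: integral_mult_left_zero integral_mult_right_zero)
qed

lemma comp_assoc:
  assumes "bounded_measurable M2 A" "bounded_measurable M2 B"
    "bounded_measurable M2 C"
  shows "comp_kernel (comp_kernel A B) C = comp_kernel A (comp_kernel B C)"
proof
  fix p :: "'a \<times> 'a"
  obtain x y where p: "p = (x, y)" by (cases p)
  show "comp_kernel (comp_kernel A B) C p = comp_kernel A (comp_kernel B C) p"
    using assms by (simp add: p comp_kernel_apply apply_comp bm_section)
qed

lemma comp_swap:
  assumes "sym_kernel A" "sym_kernel B"
  shows "comp_kernel A B (x, y) = comp_kernel B A (y, x)"
  by (simp add: comp_kernel_def mult.commute sym_kernel_sym[OF assms(1), of x]
      sym_kernel_sym[OF assms(2), of _ y])

lemma sym_kernel_square: "sym_kernel A \<Longrightarrow> sym_kernel (comp_kernel A A)"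
  unfolding sym_kernel_def[of "comp_kernel A A"]
  by (auto intro: comp_swap bm_comp sym_kernel_bm)

lemma kernel_power_1 [simp]: "kernel_power K (Suc 0) = K"
  by (simp add: kernel_power_def)

lemma kernel_power_Suc:
  assumes "r \<ge> 1" shows "kernel_power K (Suc r) = comp_kernel K (kernel_power K r)"
  using assms by (cases r) (auto simp: kernel_power_def)

lemma bm_kernel_power [bm_intros]:
  assumes "bounded_measurable M2 K"
  shows "bounded_measurable M2 (kernel_power K r)"
proof -
  have "bounded_measurable M2 ((comp_kernel K ^^ n) K)" for n
    by (induction n) (auto intro: bm_comp assms)
  then show ?thesis by (simp add: kernel_power_def)
qed

lemma kernel_power_nonneg:
  assumes "\<And>p. K p \<ge> 0" shows "kernel_power K r p \<ge> 0"
proof -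
  have "(comp_kernel K ^^ n) K p \<ge> 0" for n p
    by (induction n arbitrary: p) (auto simp: comp_kernel_def assms)
  then show ?thesis by (simp add: kernel_power_def)
qed

lemma apply_kernel_power:
  assumes "bounded_measurable M2 K" "bm f" "r \<ge> 1"
  shows "apply_kernel (kernel_power K r) f = (apply_kernel K ^^ r) f"
  using assms(3)
proof (induction r rule: dec_induct)
  case (step r)
  then show ?case using assms by (simp add: kernel_power_Suc apply_comp bm_intros)
qed simp

lemma bm_funpow_apply [bm_intros]:
  assumes "bounded_measurable M2 K" "bm f"
  shows "bm ((apply_kernel K ^^ n) f)"
  by (induction n) (auto intro!: bm_intros assms)

lemma sym_kernel_power:
  assumes K: "sym_kernel K" shows "sym_kernel (kernel_power K r)"
proof -
  note b = sym_kernel_bm[OF K]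
  have *: "sym_kernel ((comp_kernel K ^^ n) K) \<and>
      comp_kernel K ((comp_kernel K ^^ n) K) = comp_kernel ((comp_kernel K ^^ n) K) K" for n
  proof (induction n)
    case (Suc n)
    let ?L = "(comp_kernel K ^^ n) K"
    have L: "sym_kernel ?L" and comm: "comp_kernel K ?L = comp_kernel ?L K"
      using Suc by auto
    have "comp_kernel K ?L (x, y) = comp_kernel K ?L (y, x)" for x y
      using comp_swap[OF K L, of x y] comm by simp
    then have "sym_kernel (comp_kernel K ?L)"
      using b sym_kernel_bm[OF L] by (auto simp: sym_kernel_def intro: bm_comp)
    moreover have "comp_kernel K (comp_kernel K ?L) = comp_kernel (comp_kernel K ?L) K"
      using comm comp_assoc[OF b sym_kernel_bm[OF L] b] by simp
    ultimately show ?case by simp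
  qed (use K in simp)
  then show ?thesis by (simp add: kernel_power_def)
qed

lemma ip_funpow:
  assumes K: "sym_kernel K" and f: "bm f" and g: "bm g"
  shows "ip ((apply_kernel K ^^ m) f) ((apply_kernel K ^^ n) g) = ip f ((apply_kernel K ^^ (m + n)) g)"
proof (induction m arbitrary: n)
  case (Suc m)
  have "ip (apply_kernel K ((apply_kernel K ^^ m) f)) ((apply_kernel K ^^ n) g) =
      ip ((apply_kernel K ^^ m) f) ((apply_kernel K ^^ Suc n) g)"
    using form_sym[OF K, of "(apply_kernel K ^^ m) f" "(apply_kernel K ^^ n) g"]
    by (simp add: bm_intros f g sym_kernel_bm[OF K])
  then show ?case using Suc[of "Suc n"] by simp
qed simp

text \<open>An even power gives the square of a norm, an odd power the form of \<open>K\<close> itself.\<close>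

lemma funpow_form_nonneg:
  assumes K: "psd K" and f: "bm f"
  shows "0 \<le> ip f ((apply_kernel K ^^ n) f)"
proof -
  note s = psd_sym[OF K]
  note b = sym_kernel_bm[OF s]
  obtain m where "n = m + m \<or> n = m + Suc m"
    by (metis add_Suc_right mult_2 oddE even_two_times_div_two Suc_eq_plus1)
  then show ?thesis
  proof
    assume "n = m + m"
    then show ?thesis using ip_funpow[OF s f f, of m m] ip_self_nonneg by metis
  next
    assume n: "n = m + Suc m"
    have "0 \<le> ip ((apply_kernel K ^^ m) f) (apply_kernel K ((apply_kernel K ^^ m) f))"
      by (intro psd_form[OF K] bm_intros b f)
    then show ?thesis using ip_funpow[OF s f f, of m "Suc m"] n by simp
  qed
qed

lemma psd_kernel_power:
  assumes "psd K" "r \<ge> 1" shows "psd (kernel_power K r)"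
  using assms funpow_form_nonneg[OF assms(1)] sym_kernel_power[OF psd_sym[OF assms(1)]]
    sym_kernel_bm[OF psd_sym[OF assms(1)]]
  by (auto simp: psd_def apply_kernel_power)

end

section \<open>Kernels tending weakly to zero\<close>

context full_prob_space
begin

text \<open>Convergence is required against rectangles only; together with the \<open>L\<^sup>2\<close> bound it then holds against
  every bounded function of two variables.\<close>

definition weakly_null :: "(nat \<Rightarrow> 'a \<times> 'a \<Rightarrow> real) \<Rightarrow> bool" where
  "weakly_null R \<longleftrightarrow> (\<forall>n. bounded_measurable M2 (R n)) \<and>
     (\<exists>B. \<forall>n. (\<integral>p. (R n p)\<^sup>2 \<partial>M2) \<le> B\<^sup>2) \<and>
     (\<forall>X\<in>sets M. \<forall>Y\<in>sets M.
        (\<lambda>n. ip (indicator X) (apply_kernel (R n) (indicator Y))) \<longlonglongrightarrow> 0)"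

lemma pairing_bound:
  assumes R: "bounded_measurable M2 R" and G: "bounded_measurable M2 G"
    and B: "(\<integral>p. (R p)\<^sup>2 \<partial>M2) \<le> B\<^sup>2"
  shows "(\<integral>p. R p * G p \<partial>M2)\<^sup>2 \<le> B\<^sup>2 * (\<integral>p. (G p)\<^sup>2 \<partial>M2)"
proof -
  have int [simp]: "integrable M2 f" if "bounded_measurable M2 f" for f
    by (rule square.integrable_bounded_measurable[OF that])
  have "(\<integral>p. R p * G p \<partial>M2)\<^sup>2 \<le>
      (\<integral>p. (R p)\<^sup>2 \<partial>M2) * (\<integral>p. (G p)\<^sup>2 \<partial>M2)"
  proof (rule quadratic_nonneg_imp_discriminant)
    fix t
    have "0 \<le> (\<integral>p. (R p + t * G p)\<^sup>2 \<partial>M2)" by simp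
    also have "\<dots> = (\<integral>p. (R p)\<^sup>2 + (2 * t) * (R p * G p) + t\<^sup>2 * (G p)\<^sup>2 \<partial>M2)"
      by (intro Bochner_Integration.integral_cong) (auto simp: power2_eq_square algebra_simps)
    also have "\<dots> = (\<integral>p. (R p)\<^sup>2 \<partial>M2) + 2 * t * (\<integral>p. R p * G p \<partial>M2) +
        t\<^sup>2 * (\<integral>p. (G p)\<^sup>2 \<partial>M2)"
      using R G by (simp add: bm_intros)
    finally show "0 \<le> (\<integral>p. (R p)\<^sup>2 \<partial>M2) + 2 * t * (\<integral>p. R p * G p \<partial>M2) +
        t\<^sup>2 * (\<integral>p. (G p)\<^sup>2 \<partial>M2)" .
  qed
  also have "\<dots> \<le> B\<^sup>2 * (\<integral>p. (G p)\<^sup>2 \<partial>M2)"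
    by (intro mult_right_mono B) simp
  finally show ?thesis .
qed

text \<open>Pairing is uniformly continuous in \<open>L\<^sup>2\<close> along the sequence, so that the set of functions with pairing
  tending to zero is closed.\<close>

lemma pairing_limit:
  assumes R: "weakly_null R"
    and G: "bounded_measurable M2 G" and H: "\<And>k. bounded_measurable M2 (H k)"
    and conv: "\<And>k. (\<lambda>n. \<integral>p. R n p * H k p \<partial>M2) \<longlonglongrightarrow> 0"
    and lim: "(\<lambda>k. \<integral>p. (G p - H k p)\<^sup>2 \<partial>M2) \<longlonglongrightarrow> 0"
  shows "(\<lambda>n. \<integral>p. R n p * G p \<partial>M2) \<longlonglongrightarrow> 0"
proof (rule LIMSEQ_I)
  fix e :: real assume e: "e > 0"
  obtain B0 where B0: "\<And>n. (\<integral>p. (R n p)\<^sup>2 \<partial>M2) \<le> B0\<^sup>2"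
    using R by (auto simp: weakly_null_def)
  define B where "B = max 1 \<bar>B0\<bar>"
  have "B0\<^sup>2 \<le> B\<^sup>2" unfolding B_def by (metis abs_ge_zero max.cobounded2 power2_abs power_mono)
  then have B: "B \<ge> 1" "\<And>n. (\<integral>p. (R n p)\<^sup>2 \<partial>M2) \<le> B\<^sup>2"
    using B0 order_trans by (auto simp: B_def)
  have Rb: "bounded_measurable M2 (R n)" for n using R by (simp add: weakly_null_def)
  define I where "I n F = (\<integral>p. R n p * F p \<partial>M2)" for n F
  have "e\<^sup>2 / (4 * B\<^sup>2) > 0" using e B by simp
  from LIMSEQ_D[OF lim this] obtain k where k: "(\<integral>p. (G p - H k p)\<^sup>2 \<partial>M2) < e\<^sup>2 / (4 * B\<^sup>2)"
    by force
  have "e / 2 > 0" using e by simp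
  from LIMSEQ_D[OF conv[of k] this] obtain n0 where n0: "\<And>n. n \<ge> n0 \<Longrightarrow> \<bar>I n (H k)\<bar> < e / 2"
    by (auto simp: I_def)
  show "\<exists>n0. \<forall>n\<ge>n0. norm ((\<integral>p. R n p * G p \<partial>M2) - 0) < e"
  proof (intro exI[of _ n0] allI impI)
    fix n assume n: "n \<ge> n0"
    have "(I n (\<lambda>p. G p - H k p))\<^sup>2 \<le> B\<^sup>2 * (\<integral>p. (G p - H k p)\<^sup>2 \<partial>M2)"
      unfolding I_def by (intro pairing_bound Rb B bm_intros G H)
    also have "\<dots> < B\<^sup>2 * (e\<^sup>2 / (4 * B\<^sup>2))" using k B(1) by (intro mult_strict_left_mono) auto
    also have "\<dots> = (e / 2)\<^sup>2" using B(1) by (simp add: power2_eq_square)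
    finally have "\<bar>I n (\<lambda>p. G p - H k p)\<bar> < e / 2"
      using e by (intro power2_less_imp_less[of _ "e / 2"]) auto
    moreover have "I n G = I n (\<lambda>p. G p - H k p) + I n (H k)"
    proof -
      have "I n (\<lambda>p. G p - H k p) = I n G - I n (H k)"
        unfolding I_def right_diff_distrib
        by (intro Bochner_Integration.integral_diff square.integrable_bounded_measurable bm_intros Rb G H)
      then show ?thesis by simp
    qed
    ultimately show "norm ((\<integral>p. R n p * G p \<partial>M2) - 0) < e"
      using n0[OF n] by (simp add: I_def)
  qed
qed

text \<open>Rectangles generate the product sets, and closedness makes the admissible sets a Dynkin system.\<close>

lemma pairing_indicator_tendsto_0:
  assumes R: "weakly_null R" and S: "S \<in> sets M2"
  shows "(\<lambda>n. \<integral>p. R n p * indicator S p \<partial>M2) \<longlonglongrightarrow> 0"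
proof -
  have Rb: "bounded_measurable M2 (R n)" for n using R by (simp add: weakly_null_def)
  have rect: "(\<lambda>n. \<integral>p. R n p * indicator (X \<times> Y) p \<partial>M2) \<longlonglongrightarrow> 0"
    if X: "X \<in> sets M" and Y: "Y \<in> sets M" for X Y
  proof -
    let ?x = "indicator X :: 'a \<Rightarrow> real" and ?y = "indicator Y :: 'a \<Rightarrow> real"
    have eq: "(\<integral>p. R n p * indicator (X \<times> Y) p \<partial>M2) =
        ip (indicator X) (apply_kernel (R n) (indicator Y))" for n
      by (subst form_integral[OF Rb bounded_measurable_indicator[OF X] bounded_measurable_indicator[OF Y]])
        (auto intro!: Bochner_Integration.integral_cong simp: indicator_def)
    show ?thesis unfolding eq using R X Y by (simp add: weakly_null_def)
  qed
  have gen: "sets M2 = sigma_sets UNIV {X \<times> Y | X Y. X \<in> sets M \<and> Y \<in> sets M}"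
    by (simp add: sets_pair_measure)
  have S': "S \<in> sigma_sets UNIV {X \<times> Y | X Y. X \<in> sets M \<and> Y \<in> sets M}" using S gen by simp
  show ?thesis
  proof (rule sigma_sets_induct_disjoint[OF _ _ S'])
    show "Int_stable {X \<times> Y | X Y. X \<in> sets M \<and> Y \<in> sets M}"
      by (rule Int_stable_pair_measure_generator)
    show "{X \<times> Y | X Y. X \<in> sets M \<and> Y \<in> sets M} \<subseteq> Pow UNIV" by simp
  next
    fix S assume "S \<in> {X \<times> Y | X Y. X \<in> sets M \<and> Y \<in> sets M}"
    then show "(\<lambda>n. \<integral>p. R n p * indicator S p \<partial>M2) \<longlonglongrightarrow> 0"
      using rect by auto
  next
    show "(\<lambda>n. \<integral>p. R n p * indicator {} p \<partial>M2) \<longlonglongrightarrow> 0" by simp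
  next
    fix S assume S: "S \<in> sigma_sets UNIV {X \<times> Y | X Y. X \<in> sets M \<and> Y \<in> sets M}"
      and lim: "(\<lambda>n. \<integral>p. R n p * indicator S p \<partial>M2) \<longlonglongrightarrow> 0"
    have S': "S \<in> sets M2" using S gen by simp
    have "(\<integral>p. R n p * indicator (UNIV - S) p \<partial>M2) =
        (\<integral>p. R n p * indicator (UNIV \<times> UNIV) p \<partial>M2) -
        (\<integral>p. R n p * indicator S p \<partial>M2)" for n
    proof -
      have "(\<integral>p. R n p * indicator (UNIV - S) p \<partial>M2) =
          (\<integral>p. R n p * indicator (UNIV \<times> UNIV) p - R n p * indicator S p \<partial>M2)"
        by (intro Bochner_Integration.integral_cong) (auto simp: indicator_def)
      also have "\<dots> = (\<integral>p. R n p * indicator (UNIV \<times> UNIV) p \<partial>M2) -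
          (\<integral>p. R n p * indicator S p \<partial>M2)"
        by (intro Bochner_Integration.integral_diff square.integrable_bounded_measurable bm_intros Rb S')
          (metis pair_measureI sets.top space_UNIV)
      finally show ?thesis .
    qed
    then show "(\<lambda>n. \<integral>p. R n p * indicator (UNIV - S) p \<partial>M2) \<longlonglongrightarrow> 0"
      using tendsto_diff[OF rect[of UNIV UNIV] lim] sets.top[of M] by simp
  next
    fix S :: "nat \<Rightarrow> ('a \<times> 'a) set"
    assume disj: "disjoint_family S"
      and S: "range S \<subseteq> sigma_sets UNIV {X \<times> Y | X Y. X \<in> sets M \<and> Y \<in> sets M}"
      and lim: "\<And>i. (\<lambda>n. \<integral>p. R n p * indicator (S i) p \<partial>M2) \<longlonglongrightarrow> 0"
    have S': "S i \<in> sets M2" for i using S gen by auto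
    let ?H = "\<lambda>k p. \<Sum>i<k. indicator (S i) p :: real"
    have H: "bounded_measurable M2 (?H k)" for k by (intro bm_intros S')
    have U: "bounded_measurable M2 (indicator (\<Union>i. S i))"
      using S' by (intro bm_intros) auto
    have HU: "?H k p = indicator (\<Union>i<k. S i) p" for k p
      by (rule indicator_UN_disjoint[symmetric])
        (use disj in \<open>auto simp: disjoint_family_on_def\<close>)
    show "(\<lambda>n. \<integral>p. R n p * indicator (\<Union>i. S i) p \<partial>M2) \<longlonglongrightarrow> 0"
    proof (rule pairing_limit[OF R U H])
      fix k
      have "(\<integral>p. R n p * ?H k p \<partial>M2) =
          (\<Sum>i<k. \<integral>p. R n p * indicator (S i) p \<partial>M2)" for n
        unfolding sum_distrib_left
        by (intro Bochner_Integration.integral_sum square.integrable_bounded_measurable bm_intros Rb S')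
      then show "(\<lambda>n. \<integral>p. R n p * ?H k p \<partial>M2) \<longlonglongrightarrow> 0"
        using tendsto_sum[of "{..<k}", OF lim] by simp
    next
      have "(\<lambda>k. \<integral>p. (indicator (\<Union>i. S i) p - ?H k p)\<^sup>2 \<partial>M2) \<longlonglongrightarrow> (\<integral>p. 0 \<partial>M2)"
      proof (rule integral_dominated_convergence[where w="\<lambda>_. 1"])
        show "(\<lambda>p. (indicator (\<Union>i. S i) p - ?H k p)\<^sup>2) \<in> borel_measurable M2" for k
          by (intro bounded_measurable_measurable bm_intros U H)
        have "\<bar>indicator (\<Union>i. S i) p - indicator (\<Union>i<k. S i) p\<bar> \<le> (1::real)" for k p
          by (auto simp: indicator_def)
        then show "AE p in M2. norm ((indicator (\<Union>i. S i) p - ?H k p)\<^sup>2) \<le> (1::real)" for k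
          unfolding HU by (intro AE_I2) (simp add: abs_square_le_1)
        have "(\<lambda>k. (indicator (\<Union>i. S i) p - ?H k p)\<^sup>2) \<longlonglongrightarrow> 0" for p
        proof -
          have "(\<lambda>k. indicator (\<Union>i<k. S i) p) \<longlonglongrightarrow> (indicator (\<Union>i. S i) p :: real)"
            by (rule LIMSEQ_indicator_UN)
          from tendsto_diff[OF tendsto_const[of "indicator (\<Union>i. S i) p"] this]
          have "(\<lambda>k. indicator (\<Union>i. S i) p - indicator (\<Union>i<k. S i) p) \<longlonglongrightarrow> (0::real)" by simp
          from tendsto_power[OF this, of 2] show ?thesis unfolding HU by simp
        qed
        then show "AE p in M2. (\<lambda>k. (indicator (\<Union>i. S i) p - ?H k p)\<^sup>2) \<longlonglongrightarrow> 0" by simp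
      qed auto
      then show "(\<lambda>k. \<integral>p. (indicator (\<Union>i. S i) p - ?H k p)\<^sup>2 \<partial>M2) \<longlonglongrightarrow> 0" by simp
    qed
  qed
qed

lemma weakly_null_pairing:
  assumes R: "weakly_null R" and G: "bounded_measurable M2 G"
  shows "(\<lambda>n. \<integral>p. R n p * G p \<partial>M2) \<longlonglongrightarrow> 0"
proof -
  have Rb: "bounded_measurable M2 (R n)" for n using R by (simp add: weakly_null_def)
  have sp: "space M2 = UNIV" by (simp add: space_pair_measure)
  obtain B where B: "\<And>p. \<bar>G p\<bar> \<le> B" using bounded_measurable_bound[OF G] by metis
  have "G \<in> borel_measurable M2" using G by (simp add: bounded_measurable_def)
  from borel_measurable_implies_sequence_metric[OF this, of 0] sp
  obtain F where F: "\<And>k. simple_function M2 (F k)"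
    "\<And>p. (\<lambda>k. F k p) \<longlonglongrightarrow> G p" "\<And>k p. \<bar>F k p\<bar> \<le> 2 * \<bar>G p\<bar>"
    by auto
  have FB: "\<bar>F k p\<bar> \<le> 2 * B" for k p using F(3)[of k p] B[of p] by linarith
  have Fb: "bounded_measurable M2 (F k)" for k
    by (rule bounded_measurableI[OF borel_measurable_simple_function[OF F(1)] FB])
  show ?thesis
  proof (rule pairing_limit[OF R G Fb])
    fix k
    let ?S = "\<lambda>y. F k -` {y}"
    have fin: "finite (range (F k))" and S: "\<And>y. ?S y \<in> sets M2"
      using F(1)[of k] simple_functionD(1)[OF F(1)[of k]] simple_functionD(2)[OF F(1)[of k]] sp by auto
    have rep: "F k p = (\<Sum>y\<in>range (F k). y * indicator (?S y) p)" for p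
      by (subst simple_function_indicator_representation_banach[OF F(1)[of k], of p])
        (simp_all add: sp mult.commute del: indicator_simps)
    have "(\<integral>p. R n p * F k p \<partial>M2) =
        (\<Sum>y\<in>range (F k). y * (\<integral>p. R n p * indicator (?S y) p \<partial>M2))" for n
    proof -
      have "(\<integral>p. R n p * F k p \<partial>M2) =
          (\<integral>p. (\<Sum>y\<in>range (F k). y * (R n p * indicator (?S y) p)) \<partial>M2)"
        by (intro Bochner_Integration.integral_cong refl, subst rep)
          (simp add: sum_distrib_left mult.left_commute del: indicator_simps)
      also have "\<dots> = (\<Sum>y\<in>range (F k). \<integral>p. y * (R n p * indicator (?S y) p) \<partial>M2)"
        by (intro Bochner_Integration.integral_sum square.integrable_bounded_measurable bm_intros Rb S)
      finally show ?thesis by simp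
    qed
    moreover have "(\<lambda>n. \<Sum>y\<in>range (F k). y * (\<integral>p. R n p * indicator (?S y) p \<partial>M2))
        \<longlonglongrightarrow> (\<Sum>y\<in>range (F k). y * 0)"
      by (intro tendsto_intros pairing_indicator_tendsto_0 R S)
    ultimately show "(\<lambda>n. \<integral>p. R n p * F k p \<partial>M2) \<longlonglongrightarrow> 0" by simp
  next
    have "(\<lambda>k. \<integral>p. (G p - F k p)\<^sup>2 \<partial>M2) \<longlonglongrightarrow> (\<integral>p. 0 \<partial>M2)"
    proof (rule integral_dominated_convergence[where w="\<lambda>_. (3 * B)\<^sup>2"])
      show "(\<lambda>p. (G p - F k p)\<^sup>2) \<in> borel_measurable M2" for k
        by (intro bounded_measurable_measurable bm_intros G Fb)
      have "\<bar>G p - F k p\<bar> \<le> 3 * B" for k p using FB[of k p] B[of p] by linarith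
      then have "(G p - F k p)\<^sup>2 \<le> (3 * B)\<^sup>2" for k p
        by (metis abs_ge_zero power2_abs power_mono)
      then show "AE p in M2. norm ((G p - F k p)\<^sup>2) \<le> (3 * B)\<^sup>2" for k by simp
      have "(\<lambda>k. (G p - F k p)\<^sup>2) \<longlonglongrightarrow> 0" for p
      proof -
        have "(\<lambda>k. (G p - F k p)\<^sup>2) \<longlonglongrightarrow> (G p - G p)\<^sup>2" by (intro tendsto_intros F)
        then show ?thesis by simp
      qed
      then show "AE p in M2. (\<lambda>k. (G p - F k p)\<^sup>2) \<longlonglongrightarrow> 0" by simp
    qed auto
    then show "(\<lambda>k. \<integral>p. (G p - F k p)\<^sup>2 \<partial>M2) \<longlonglongrightarrow> 0" by simp
  qed
qed

end

section \<open>The Schur product theorem\<close>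

context full_prob_space
begin

text \<open>As operators, \<open>0 \<le> A \<le> 1\<close>.\<close>

definition contraction :: "('a \<times> 'a \<Rightarrow> real) \<Rightarrow> bool" where
  "contraction A \<longleftrightarrow> psd A \<and> (\<forall>f. bm f \<longrightarrow> ip f (apply_kernel A f) \<le> ip f f)"

lemma form_diff_square:
  assumes A: "sym_kernel A" and f: "bm f"
  shows "ip f (apply_kernel (\<lambda>p. A p - comp_kernel A A p) f) =
    ip f (apply_kernel A f) - ip (apply_kernel A f) (apply_kernel A f)"
  using assms sym_kernel_bm[OF A] form_sym[OF A f, of "apply_kernel A f"]
  by (simp add: apply_kernel_diff apply_comp ip_diff_right bm_intros)

lemma contraction_diff_square:
  assumes "contraction A" shows "contraction (\<lambda>p. A p - comp_kernel A A p)"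
proof -
  have psd: "psd A" and le: "\<And>f. bm f \<Longrightarrow> ip f (apply_kernel A f) \<le> ip f f"
    using assms by (auto simp: contraction_def)
  note s = psd_sym[OF psd]
  note b = sym_kernel_bm[OF s]
  have "0 \<le> ip f (apply_kernel A f) - ip (apply_kernel A f) (apply_kernel A f) \<and>
      ip f (apply_kernel A f) - ip (apply_kernel A f) (apply_kernel A f) \<le> ip f f"
    if f: "bm f" for f
  proof
    define g where "g = apply_kernel A f"
    have g: "bm g" unfolding g_def by (intro bm_intros b f)
    have d: "bm (\<lambda>x. f x - g x)" by (intro bm_intros f g)
    have "0 \<le> ip (\<lambda>x. f x - g x) (apply_kernel A (\<lambda>x. f x - g x))"
      by (intro psd_form psd d)
    also have "\<dots> = ip f g - 2 * ip g g + ip g (apply_kernel A g)"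
      using form_sym[OF s f g] f g b
      by (simp add: apply_diff ip_diff_left ip_diff_right bm_intros flip: g_def)
    \<comment> \<open>\<open>A - A\<^sup>2 = A (1 - A) A + (1 - A) A (1 - A)\<close>\<close>
    finally show "0 \<le> ip f (apply_kernel A f) - ip (apply_kernel A f) (apply_kernel A f)"
      using le[OF g] by (simp add: g_def)
    show "ip f (apply_kernel A f) - ip (apply_kernel A f) (apply_kernel A f) \<le> ip f f"
      using le[OF f] ip_self_nonneg[of "apply_kernel A f"] by linarith
  qed
  then show ?thesis unfolding contraction_def psd_def
    using sym_kernel_diff[OF s sym_kernel_square[OF s]] form_diff_square[OF s] by auto
qed

text \<open>Iterating \<open>A \<mapsto> A - A\<^sup>2\<close> expands \<open>A\<close> as a sum of squares of kernels plus a remainder. The Schur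
  product of a square with a semidefinite kernel is semidefinite because a square is an average of
  rank one kernels, and the remainder tends weakly to zero.\<close>

fun residual :: "('a \<times> 'a \<Rightarrow> real) \<Rightarrow> nat \<Rightarrow> 'a \<times> 'a \<Rightarrow> real" where
  "residual A 0 = A"
| "residual A (Suc n) = (\<lambda>p. residual A n p - comp_kernel (residual A n) (residual A n) p)"

lemma contraction_residual: "contraction A \<Longrightarrow> contraction (residual A n)"
  by (induction n) (auto intro: contraction_diff_square)

lemma contraction_sym: "contraction A \<Longrightarrow> sym_kernel A"
  and contraction_bm: "contraction A \<Longrightarrow> bounded_measurable M2 A"
  by (auto simp: contraction_def psd_def sym_kernel_def)

text \<open>One step changes a row \<open>g\<close> into \<open>g - R g\<close>, and \<open>\<parallel>R g\<parallel>\<^sup>2 \<le> \<langle>g, R g\<rangle>\<close> because the next residual is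
  semidefinite; hence the norm of a row does not grow.\<close>

lemma residual_row_bound:
  assumes A: "contraction A"
  shows "(\<integral>y. (residual A n (x, y))\<^sup>2 \<partial>M) \<le> (\<integral>y. (A (x, y))\<^sup>2 \<partial>M)"
proof (induction n)
  case (Suc n)
  let ?R = "residual A n"
  have R: "contraction ?R" by (rule contraction_residual[OF A])
  note s = contraction_sym[OF R] and b = contraction_bm[OF R]
  define g where "g = (\<lambda>y. ?R (x, y))"
  have g: "bm g" unfolding g_def by (rule bm_section[OF b])
  have Ag: "bm (apply_kernel ?R g)" by (intro bm_intros g b)
  have "comp_kernel ?R ?R (x, y) = apply_kernel ?R g y" for y
    using comp_swap[OF s s, of x y] sym_kernel_sym[OF s, of x]
    by (simp add: comp_kernel_apply g_def)
  then have "(\<integral>y. (residual A (Suc n) (x, y))\<^sup>2 \<partial>M) =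
      ip (\<lambda>y. g y - apply_kernel ?R g y) (\<lambda>y. g y - apply_kernel ?R g y)"
    by (simp add: ip_def g_def power2_eq_square)
  also have "\<dots> = ip g g - 2 * ip g (apply_kernel ?R g) + ip (apply_kernel ?R g) (apply_kernel ?R g)"
    using g Ag by (simp add: ip_diff_left ip_diff_right bm_intros ip_commute[of "apply_kernel ?R g" g])
  also have "\<dots> \<le> ip g g"
  proof -
    have "contraction (residual A (Suc n))" by (rule contraction_residual[OF A])
    then have "0 \<le> ip g (apply_kernel (residual A (Suc n)) g)"
      using g by (auto simp: contraction_def psd_def)
    moreover have "0 \<le> ip g (apply_kernel ?R g)" using R g by (auto simp: contraction_def psd_def)
    ultimately show ?thesis using form_diff_square[OF s g] by simp
  qed
  also have "ip g g = (\<integral>y. (?R (x, y))\<^sup>2 \<partial>M)" by (simp add: ip_def g_def power2_eq_square)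
  finally show ?case using Suc by simp
qed simp

text \<open>The squared norms are differences of consecutive forms, so that their series telescopes.\<close>

lemma residual_apply_tendsto_0:
  assumes A: "contraction A" and f: "bm f"
  shows "(\<lambda>n. ip (apply_kernel (residual A n) f) (apply_kernel (residual A n) f)) \<longlonglongrightarrow> 0"
proof -
  let ?a = "\<lambda>n. ip (apply_kernel (residual A n) f) (apply_kernel (residual A n) f)"
  let ?q = "\<lambda>n. ip f (apply_kernel (residual A n) f)"
  have R: "contraction (residual A n)" for n by (rule contraction_residual[OF A])
  have a: "?a n = ?q n - ?q (Suc n)" for n
    using form_diff_square[OF contraction_sym[OF R] f, of n] by simp
  have q: "?q n \<ge> 0" for n using R[of n] f by (auto simp: contraction_def psd_def)
  have "(\<Sum>i<n. ?a i) = ?q 0 - ?q n" for n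
    unfolding a by (rule sum_lessThan_telescope')
  then have "(\<Sum>i<n. ?a i) \<le> ?q 0" for n using q[of n] by simp
  then have "summable ?a"
    by (intro bounded_imp_summable[where B="?q 0"]) (simp_all only: ip_self_nonneg flip: lessThan_Suc_atMost)
  then show ?thesis by (rule summable_LIMSEQ_zero)
qed

lemma residual_square_integral_le:
  assumes A: "contraction A" and B: "\<And>p. \<bar>A p\<bar> \<le> B"
  shows "(\<integral>p. (residual A n p)\<^sup>2 \<partial>M2) \<le> B\<^sup>2"
proof -
  let ?R = "residual A n"
  have R: "bounded_measurable M2 ?R" by (rule contraction_bm[OF contraction_residual[OF A]])
  have B2: "(A p)\<^sup>2 \<le> B\<^sup>2" for p using B[of p] by (metis abs_ge_zero power2_abs power_mono)
  have "(\<integral>p. (?R p)\<^sup>2 \<partial>M2) = (\<integral>x. \<integral>y. (?R (x, y))\<^sup>2 \<partial>M \<partial>M)"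
    by (rule integral_square[OF bounded_measurable_power[OF R]])
  also have "\<dots> \<le> (\<integral>x. B\<^sup>2 \<partial>M)"
  proof (rule integral_mono)
    show "integrable M (\<lambda>x. \<integral>y. (?R (x, y))\<^sup>2 \<partial>M)"
      by (rule bm_integrable[OF bm_integral_kernel[OF bounded_measurable_power[OF R]]])
    show "integrable M (\<lambda>x. B\<^sup>2)" by simp
    fix x
    have "(\<integral>y. (?R (x, y))\<^sup>2 \<partial>M) \<le> (\<integral>y. (A (x, y))\<^sup>2 \<partial>M)" by (rule residual_row_bound[OF A])
    also have "\<dots> \<le> (\<integral>y. B\<^sup>2 \<partial>M)"
      by (intro integral_mono bm_integrable bm_intros bm_section[OF contraction_bm[OF A]] B2)
    finally show "(\<integral>y. (?R (x, y))\<^sup>2 \<partial>M) \<le> B\<^sup>2" by (simp add: prob_space)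
  qed
  finally show ?thesis by (simp add: prob_space)
qed

lemma residual_weakly_null:
  assumes A: "contraction A" shows "weakly_null (residual A)"
proof -
  have R: "bounded_measurable M2 (residual A n)" for n
    by (rule contraction_bm[OF contraction_residual[OF A]])
  obtain B where B: "\<And>p. \<bar>A p\<bar> \<le> B" using bounded_measurable_bound[OF contraction_bm[OF A]] by metis
  have "(\<lambda>n. ip f (apply_kernel (residual A n) g)) \<longlonglongrightarrow> 0" if f: "bm f" and g: "bm g" for f g
  proof -
    let ?a = "\<lambda>n. ip (apply_kernel (residual A n) g) (apply_kernel (residual A n) g)"
    have "(\<lambda>n. sqrt (ip f f * ?a n)) \<longlonglongrightarrow> sqrt (ip f f * 0)"
      by (intro tendsto_intros residual_apply_tendsto_0 A g)
    then have lim: "(\<lambda>n. sqrt (ip f f * ?a n)) \<longlonglongrightarrow> 0" by simp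
    have "\<bar>ip f (apply_kernel (residual A n) g)\<bar> \<le> sqrt (ip f f * ?a n)" for n
      by (rule real_le_rsqrt) (auto intro!: ip_cauchy_schwarz bm_intros R f g)
    then show ?thesis by (intro Lim_null_comparison[OF _ lim]) auto
  qed
  then show ?thesis
    using R residual_square_integral_le[OF A B] unfolding weakly_null_def by (auto intro: bm_intros)
qed

text \<open>The kernel \<open>A\<^sup>2\<close> is the average over \<open>z\<close> of the rank one kernels \<open>A(\<cdot>, z) \<otimes> A(\<cdot>, z)\<close>.\<close>

lemma form_square_mult_nonneg:
  assumes A: "sym_kernel A" and L: "psd L" and f: "bm f"
  shows "0 \<le> ip f (apply_kernel (\<lambda>p. comp_kernel A A p * L p) f)"
proof -
  interpret cube: pair_prob_space "M2" M ..
  note b = sym_kernel_bm[OF A] and l = sym_kernel_bm[OF psd_sym[OF L]]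
  let ?F = "\<lambda>p z. f (fst p) * (A (fst p, z) * A (z, snd p)) * L p * f (snd p)"
  have F: "bounded_measurable (M2 \<Otimes>\<^sub>M M) (\<lambda>q. ?F (fst q) (snd q))"
    by (intro bm_intros bounded_measurable_compose[OF b] bounded_measurable_compose[OF l]
        bounded_measurable_compose[OF f]) auto
  have "ip f (apply_kernel (\<lambda>p. comp_kernel A A p * L p) f) =
      (\<integral>p. (\<integral>z. ?F p z \<partial>M) \<partial>M2)"
    unfolding form_integral[OF bounded_measurable_mult[OF bm_comp[OF b b] l] f f]
    by (simp add: comp_kernel_def mult.assoc flip: integral_mult_left_zero integral_mult_right_zero)
  also have "\<dots> = (\<integral>z. (\<integral>p. ?F p z \<partial>M2) \<partial>M)"
    using cube.Fubini_integral[of ?F] cube.integrable_bounded_measurable[OF F]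
    by (simp add: case_prod_beta')
  also have "\<dots> \<ge> 0"
  proof (rule Bochner_Integration.integral_nonneg)
    fix z
    let ?g = "\<lambda>x. f x * A (x, z)"
    have g: "bm ?g" by (intro bm_intros f bm_section[OF b])
    have "(\<integral>p. ?F p z \<partial>M2) = ip ?g (apply_kernel L ?g)"
      by (subst form_integral[OF l g g])
        (auto intro!: Bochner_Integration.integral_cong simp: sym_kernel_sym[OF A, of z] ac_simps)
    then show "0 \<le> (\<integral>p. ?F p z \<partial>M2)" using psd_form[OF L g] by simp
  qed
  finally show ?thesis .
qed

text \<open>A bounded kernel satisfies \<open>\<langle>f, A f\<rangle> \<le> B (\<integral>\<bar>f\<bar>)\<^sup>2 \<le> B \<parallel>f\<parallel>\<^sup>2\<close> on a probability space.\<close>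

lemma contraction_scale:
  assumes A: "psd A" and B: "\<And>p. \<bar>A p\<bar> \<le> B" "B > 0"
  shows "contraction (\<lambda>p. (1 / B) * A p)"
  unfolding contraction_def
proof (intro conjI allI impI)
  show "psd (\<lambda>p. (1 / B) * A p)" using B by (intro psd_scale A) simp
  fix f assume f: "bm f"
  note b = sym_kernel_bm[OF psd_sym[OF A]]
  have "ip f (apply_kernel A f) = (\<integral>p. f (fst p) * A p * f (snd p) \<partial>M2)"
    by (rule form_integral[OF b f f])
  also have "\<dots> \<le> (\<integral>p. B * (\<bar>f (fst p)\<bar> * \<bar>f (snd p)\<bar>) \<partial>M2)"
  proof (intro integral_mono square.integrable_bounded_measurable bm_intros b f)
    fix p
    have "f (fst p) * A p * f (snd p) \<le> \<bar>A p\<bar> * (\<bar>f (fst p)\<bar> * \<bar>f (snd p)\<bar>)"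
      by (metis abs_ge_self abs_mult mult.assoc mult.commute)
    also have "\<dots> \<le> B * (\<bar>f (fst p)\<bar> * \<bar>f (snd p)\<bar>)" by (intro mult_right_mono B) auto
    finally show "f (fst p) * A p * f (snd p) \<le> B * (\<bar>f (fst p)\<bar> * \<bar>f (snd p)\<bar>)" .
  qed
  also have "\<dots> = B * (ip (\<lambda>x. \<bar>f x\<bar>) (\<lambda>_. 1))\<^sup>2"
    by (subst integral_square) (auto simp: ip_def power2_eq_square intro!: bm_intros f)
  also have "\<dots> \<le> B * (ip (\<lambda>x. \<bar>f x\<bar>) (\<lambda>x. \<bar>f x\<bar>) * ip (\<lambda>_. 1) (\<lambda>_. 1))"
    using B by (intro mult_left_mono ip_cauchy_schwarz bm_intros f) simp
  also have "\<dots> = B * ip f f" by (simp add: ip_def prob_UNIV)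
  finally show "ip f (apply_kernel (\<lambda>p. (1 / B) * A p) f) \<le> ip f f"
    using B unfolding apply_kernel_scale ip_scale_right by (simp add: field_simps)
qed

theorem psd_mult:
  assumes A: "psd A" and L: "psd L" shows "psd (\<lambda>p. A p * L p)"
  unfolding psd_def
proof (intro conjI allI impI)
  show "sym_kernel (\<lambda>p. A p * L p)" by (intro sym_kernel_mult psd_sym A L)
  fix f assume f: "bm f"
  note l = sym_kernel_bm[OF psd_sym[OF L]]
  obtain B where B: "B \<ge> 1" "\<And>p. \<bar>A p\<bar> \<le> B"
    using bounded_measurable_bound[OF sym_kernel_bm[OF psd_sym[OF A]]] by metis
  define S where "S = (\<lambda>p. (1 / B) * A p)"
  have S: "contraction S" unfolding S_def using B by (intro contraction_scale A) auto
  have R: "contraction (residual S n)" for n by (rule contraction_residual[OF S])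
  note Rb = contraction_bm[OF R]
  define Q where "Q n = ip f (apply_kernel (\<lambda>p. residual S n p * L p) f)" for n
  have "Q (Suc n) \<le> Q n" for n
  proof -
    have "Q n = ip f (apply_kernel (\<lambda>p. residual S (Suc n) p * L p +
        comp_kernel (residual S n) (residual S n) p * L p) f)"
      by (simp add: Q_def left_diff_distrib)
    also have "\<dots> = Q (Suc n) + ip f (apply_kernel (\<lambda>p. comp_kernel (residual S n) (residual S n) p * L p) f)"
      unfolding Q_def using f l Rb[of n] Rb[of "Suc n"]
      by (simp add: apply_kernel_add ip_add_right bm_intros del: residual.simps)
    finally show ?thesis using form_square_mult_nonneg[OF contraction_sym[OF R] L f, of n] by simp
  qed
  then have "decseq Q" by (rule decseq_SucI)
  moreover have "Q \<longlonglongrightarrow> 0"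
  proof -
    have "Q n = (\<integral>p. residual S n p * (f (fst p) * L p * f (snd p)) \<partial>M2)" for n
      unfolding Q_def by (subst form_integral) (auto intro!: bm_intros f l Rb simp: ac_simps)
    then have "Q = (\<lambda>n. \<integral>p. residual S n p * (f (fst p) * L p * f (snd p)) \<partial>M2)"
      by (rule ext)
    moreover have "(\<lambda>n. \<integral>p. residual S n p * (f (fst p) * L p * f (snd p)) \<partial>M2) \<longlonglongrightarrow> 0"
      by (intro weakly_null_pairing residual_weakly_null S bm_intros f l)
    ultimately show ?thesis by simp
  qed
  ultimately have "Q 0 \<ge> 0" by (rule decseq_ge)
  moreover have "Q 0 = (1 / B) * ip f (apply_kernel (\<lambda>p. A p * L p) f)"
    unfolding Q_def S_def residual.simps mult.assoc apply_kernel_scale ip_scale_right ..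
  ultimately show "0 \<le> ip f (apply_kernel (\<lambda>p. A p * L p) f)"
    using B(1) by (simp add: zero_le_mult_iff zero_le_divide_iff)
qed

end

section \<open>Complete graphs\<close>

lemma power_tangent_le:
  fixes x a :: real assumes "x \<ge> 0" "a > 0"
  shows "a ^ n + real n * a ^ (n - 1) * (x - a) \<le> x ^ n"
proof -
  have "1 + real n * (x / a - 1) \<le> (1 + (x / a - 1)) ^ n"
    using assms by (intro Bernoulli_inequality) simp
  then have "a ^ n * (1 + real n * (x / a - 1)) \<le> a ^ n * (x / a) ^ n"
    using assms by (intro mult_left_mono) auto
  also have "\<dots> = x ^ n" using assms by (simp add: power_divide)
  also have "a ^ n * (1 + real n * (x / a - 1)) = a ^ n + real n * a ^ (n - 1) * (x - a)"
    using assms by (cases n) (auto simp: field_simps)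
  finally show ?thesis .
qed

text \<open>The pointwise bound in the induction step for complete graphs: the left-hand side is affine in
  \<open>b\<close> and \<open>c\<close>, so that it can be integrated, and it is attained at \<open>c = a\<close>, \<open>b = a\<^sup>2\<close>, the values of
  a kernel with constant row integrals.\<close>

lemma star_tangent_le:
  fixes a b c :: real and n :: nat
  assumes a: "a > 0" and c: "c \<ge> 0" and b: "b \<ge> 0" "c = 0 \<Longrightarrow> b = 0"
  defines "m \<equiv> Suc n"
  shows "a ^ (m * m) + real m * a ^ (m * n) * (a ^ n * c + real n * a ^ (n - 1) * (b - a * c) - a ^ m)
    \<le> c ^ m * (b / c) ^ (m * n)"
proof -
  define y where "y = c * (b / c) ^ n"
  have y: "y \<ge> 0" using b c by (simp add: y_def)
  have "a ^ n * c + real n * a ^ (n - 1) * (b - a * c) \<le> y"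
  proof (cases "c = 0")
    case False
    then have "c > 0" using c by simp
    have "c * (a ^ n + real n * a ^ (n - 1) * (b / c - a)) \<le> c * (b / c) ^ n"
      using b c a by (intro mult_left_mono power_tangent_le) auto
    also have "c * (a ^ n + real n * a ^ (n - 1) * (b / c - a)) =
        a ^ n * c + real n * a ^ (n - 1) * (b - a * c)"
      using \<open>c > 0\<close> by (simp add: field_simps)
    finally show ?thesis by (simp add: y_def)
  qed (use b in \<open>simp add: y_def\<close>)
  then have "a ^ (m * m) + real m * a ^ (m * n) * (a ^ n * c + real n * a ^ (n - 1) * (b - a * c) - a ^ m)
      \<le> a ^ (m * m) + real m * a ^ (m * n) * (y - a ^ m)"
    using a by (intro add_left_mono mult_left_mono) auto
  also have "\<dots> = (a ^ m) ^ m + real m * (a ^ m) ^ (m - 1) * (y - a ^ m)"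
    by (simp only: m_def power_mult diff_Suc_1)
  also have "\<dots> \<le> y ^ m" using a y by (intro power_tangent_le) auto
  also have "y ^ m = c ^ m * (b / c) ^ (m * n)"
    by (simp add: y_def power_mult_distrib mult.commute flip: power_mult)
  finally show ?thesis .
qed

lemma nsets_2_Suc:
  "nsets {1..Suc m} 2 = nsets {1..m} 2 \<union> (\<lambda>j. {j, Suc m}) ` {1..m}"
proof (intro equalityI subsetI)
  fix e assume e: "e \<in> nsets {1..Suc m} 2"
  then obtain x y where xy: "e = {x, y}" "x \<noteq> y" by (auto simp: nsets_def card_2_iff)
  with e have "x \<in> {1..Suc m}" "y \<in> {1..Suc m}" by (auto simp: nsets_def)
  then consider "x = Suc m" "y \<in> {1..m}" | "y = Suc m" "x \<in> {1..m}" | "x \<in> {1..m}" "y \<in> {1..m}"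
    using xy(2) by (auto simp: le_Suc_eq)
  then show "e \<in> nsets {1..m} 2 \<union> (\<lambda>j. {j, Suc m}) ` {1..m}"
    using xy by cases (auto simp: nsets_def insert_commute)
next
  fix e assume "e \<in> nsets {1..m} 2 \<union> (\<lambda>j. {j, Suc m}) ` {1..m}"
  then show "e \<in> nsets {1..Suc m} 2" by (auto simp: nsets_def)
qed

lemma prod_nsets_2_Suc:
  fixes g :: "nat \<Rightarrow> nat \<Rightarrow> real"
  shows "(\<Prod>e\<in>nsets {1..Suc m} 2. g (Min e) (Max e)) =
    (\<Prod>j\<in>{1..m}. g j (Suc m)) * (\<Prod>e\<in>nsets {1..m} 2. g (Min e) (Max e))"
proof -
  have disj: "nsets {1..m} 2 \<inter> (\<lambda>j. {j, Suc m}) ` {1..m} = {}" by (auto simp: nsets_def)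
  have inj: "inj_on (\<lambda>j. {j, Suc m}) {1..m}" by (auto simp: inj_on_def doubleton_eq_iff)
  have "(\<Prod>e\<in>(\<lambda>j. {j, Suc m}) ` {1..m}. g (Min e) (Max e)) = (\<Prod>j\<in>{1..m}. g j (Suc m))"
    using inj by (subst prod.reindex) (auto intro!: prod.cong simp: min_def max_def)
  then show ?thesis unfolding nsets_2_Suc
    by (subst prod.union_disjoint) (use disj finite_nsets_2 in auto)
qed

context full_prob_space
begin

sublocale PM: product_prob_space "\<lambda>_::'i. M" UNIV ..

abbreviation cube :: "'i set \<Rightarrow> ('i \<Rightarrow> 'a) measure" where
  "cube I \<equiv> PiM I (\<lambda>_. M)"

lemma prob_space_cube: "prob_space (cube I)"
  by (intro prob_space_PiM) unfold_locales

lemma bm_coord [bm_intros]: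
  assumes "bm f" "i \<in> I" shows "bounded_measurable (cube I) (\<lambda>x. f (x i))"
  by (rule bounded_measurable_compose[OF assms(1)]) (use assms in measurable)

lemma bm_coord_pair [bm_intros]:
  assumes "bounded_measurable M2 K" "i \<in> I" "j \<in> I"
  shows "bounded_measurable (cube I) (\<lambda>x. K (x i, x j))"
  by (rule bounded_measurable_compose[OF assms(1)]) (use assms in measurable)

lemma integrable_cube:
  assumes "bounded_measurable (cube I) f" shows "integrable (cube I) f"
  using finite_measure.integrable_bounded_measurable[OF prob_space.finite_measure[OF prob_space_cube] assms] .

lemma integral_cube_insert:
  assumes "finite I" "i \<notin> I" "bounded_measurable (cube (insert i I)) f"
  shows "integral\<^sup>L (cube (insert i I)) f = (\<integral>x. \<integral>y. f (x(i := y)) \<partial>M \<partial>cube I)"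
    and "integral\<^sup>L (cube (insert i I)) f = (\<integral>y. \<integral>x. f (x(i := y)) \<partial>cube I \<partial>M)"
proof -
  show 1: "integral\<^sup>L (cube (insert i I)) f = (\<integral>x. \<integral>y. f (x(i := y)) \<partial>M \<partial>cube I)"
    using assms by (intro PM.product_integral_insert integrable_cube)
  interpret I: prob_space "cube I" by (rule prob_space_cube)
  interpret Q: pair_prob_space "cube I" M ..
  have "(\<lambda>p. (fst p)(i := snd p)) \<in> cube I \<Otimes>\<^sub>M M \<rightarrow>\<^sub>M cube (insert i I)"
    by measurable
  from bounded_measurable_compose[OF assms(3) this]
  have "integrable (cube I \<Otimes>\<^sub>M M) (\<lambda>(x, y). f (x(i := y)))"
    using Q.integrable_bounded_measurable by (simp add: case_prod_beta')
  from Q.Fubini_integral[OF this] 1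
  show "integral\<^sup>L (cube (insert i I)) f = (\<integral>y. \<integral>x. f (x(i := y)) \<partial>cube I \<partial>M)" by simp
qed

text \<open>The density of a complete graph with a vertex weight. Fixing the last vertex at \<open>z\<close> turns it
  into the density of a smaller complete graph with the weight multiplied by the row of \<open>z\<close>, so
  weights make an induction on the number of vertices possible.\<close>

definition clique_density :: "('a \<times> 'a \<Rightarrow> real) \<Rightarrow> nat \<Rightarrow> ('a \<Rightarrow> real) \<Rightarrow> real" where
  "clique_density W m w = (\<integral>x. (\<Prod>i\<in>{1..m}. w (x i)) *
     (\<Prod>e\<in>nsets {1..m} 2. W (x (Min e), x (Max e))) \<partial>cube {1..m})"

lemma bm_clique_integrand:
  assumes "bounded_measurable M2 W"
  shows "bounded_measurable (cube {1..m}) (\<lambda>x. \<Prod>e\<in>nsets {1..m::nat} 2. W (x (Min e), x (Max e)))"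
  using nsets_2_Min_Max by (intro bm_intros assms) auto

lemma clique_density_Suc:
  assumes W: "bounded_measurable M2 W" and w: "bm w"
  shows "clique_density W (Suc m) w = (\<integral>z. w z * clique_density W m (\<lambda>x. w x * W (x, z)) \<partial>M)"
proof -
  let ?f = "\<lambda>x. (\<Prod>i\<in>{1..Suc m}. w (x i)) * (\<Prod>e\<in>nsets {1..Suc m} 2. W (x (Min e), x (Max e)))"
  have ins: "{1..Suc m} = insert (Suc m) {1..m}" by auto
  have f: "bounded_measurable (cube (insert (Suc m) {1..m})) ?f"
    unfolding ins[symmetric] by (intro bm_intros w bm_clique_integrand W)
  have "clique_density W (Suc m) w = integral\<^sup>L (cube (insert (Suc m) {1..m})) ?f"
    unfolding clique_density_def ins ..
  also have "\<dots> = (\<integral>z. \<integral>x. ?f (x(Suc m := z)) \<partial>cube {1..m} \<partial>M)"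
    by (rule integral_cube_insert(2)[OF _ _ f]) auto
  also have "\<dots> = (\<integral>z. w z * clique_density W m (\<lambda>x. w x * W (x, z)) \<partial>M)"
  proof (intro Bochner_Integration.integral_cong refl)
    fix z
    have "?f (x(Suc m := z)) = w z * ((\<Prod>i\<in>{1..m}. w (x i) * W (x i, z)) *
        (\<Prod>e\<in>nsets {1..m} 2. W (x (Min e), x (Max e))))" for x
    proof -
      have "(\<Prod>e\<in>nsets {1..m} 2. W ((x(Suc m := z)) (Min e), (x(Suc m := z)) (Max e))) =
          (\<Prod>e\<in>nsets {1..m} 2. W (x (Min e), x (Max e)))"
        using nsets_2_Min_Max(1,2)[of _ m] by (intro prod.cong refl) fastforce
      moreover have "(\<Prod>j\<in>{1..m}. W ((x(Suc m := z)) j, (x(Suc m := z)) (Suc m))) =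
          (\<Prod>j\<in>{1..m}. W (x j, z))"
        by (intro prod.cong) auto
      moreover have "(\<Prod>i\<in>{1..m}. w ((x(Suc m := z)) i)) = (\<Prod>i\<in>{1..m}. w (x i))"
        by (intro prod.cong) auto
      then have "(\<Prod>i\<in>{1..Suc m}. w ((x(Suc m := z)) i)) = (\<Prod>i\<in>{1..m}. w (x i)) * w z"
        by simp
      ultimately show ?thesis
        unfolding prod_nsets_2_Suc[of "\<lambda>i j. W ((x(Suc m := z)) i, (x(Suc m := z)) j)"]
        by (simp add: prod.distrib)
    qed
    then show "(\<integral>x. ?f (x(Suc m := z)) \<partial>cube {1..m}) =
        w z * clique_density W m (\<lambda>x. w x * W (x, z))"
      unfolding clique_density_def by (simp only: integral_mult_right_zero)
  qed
  finally show ?thesis .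
qed

lemma clique_density_nonneg:
  assumes "\<And>x. w x \<ge> 0" "\<And>p. W p \<ge> 0" shows "clique_density W m w \<ge> 0"
  unfolding clique_density_def
  by (intro Bochner_Integration.integral_nonneg mult_nonneg_nonneg prod_nonneg) (use assms in auto)

lemma clique_density_0 [simp]: "clique_density W 0 w = 1"
proof -
  have "nsets {1..0::nat} 2 = {}" by (auto simp: nsets_def)
  interpret P: prob_space "cube {1..0::nat}" by (rule prob_space_cube)
  show ?thesis using P.prob_space \<open>nsets {1..0} 2 = {}\<close> by (simp add: clique_density_def)
qed

lemma ip_affine:
  assumes "bm w" "bm f" "bm g"
  shows "ip w (\<lambda>x. \<alpha> + \<beta> * f x + \<gamma> * g x) = \<alpha> * integral\<^sup>L M w + \<beta> * ip w f + \<gamma> * ip w g"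
proof -
  have "ip w (\<lambda>_. \<alpha>) = \<alpha> * integral\<^sup>L M w" by (simp add: ip_def mult.commute)
  then show ?thesis
    using assms by (simp add: ip_add_right ip_scale_right bm_intros)
qed

lemma bm_clique_density_row:
  assumes W: "bounded_measurable M2 W" and w: "bm w"
  shows "bm (\<lambda>z. clique_density W m (\<lambda>x. w x * W (x, z)))"
proof -
  interpret P: prob_space "cube {1..m}" by (rule prob_space_cube)
  have "bounded_measurable (M \<Otimes>\<^sub>M cube {1..m}) (\<lambda>q. (\<Prod>i\<in>{1..m}. w (snd q i) * W (snd q i, fst q)) *
     (\<Prod>e\<in>nsets {1..m} 2. W (snd q (Min e), snd q (Max e))))"
  proof (intro bounded_measurable_mult bounded_measurable_prod)
    fix i assume i: "i \<in> {1..m}"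
    have [measurable]: "(\<lambda>q. snd q i) \<in> M \<Otimes>\<^sub>M cube {1..m} \<rightarrow>\<^sub>M M"
      using i by measurable
    show "bounded_measurable (M \<Otimes>\<^sub>M cube {1..m}) (\<lambda>q. w (snd q i))"
      by (rule bounded_measurable_compose[OF w]) measurable
    show "bounded_measurable (M \<Otimes>\<^sub>M cube {1..m}) (\<lambda>q. W (snd q i, fst q))"
      by (rule bounded_measurable_compose[OF W]) measurable
  next
    fix e assume "e \<in> nsets {1..m} 2"
    from nsets_2_Min_Max[OF this]
    have [measurable]: "(\<lambda>q. snd q (Min e)) \<in> M \<Otimes>\<^sub>M cube {1..m} \<rightarrow>\<^sub>M M"
      "(\<lambda>q. snd q (Max e)) \<in> M \<Otimes>\<^sub>M cube {1..m} \<rightarrow>\<^sub>M M"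
      by measurable
    show "bounded_measurable (M \<Otimes>\<^sub>M cube {1..m}) (\<lambda>q. W (snd q (Min e), snd q (Max e)))"
      by (rule bounded_measurable_compose[OF W]) measurable
  qed
  from P.bounded_measurable_integral[of M, unfolded case_prod_beta', OF this]
  show ?thesis by (simp add: clique_density_def)
qed

text \<open>The step fixes the last vertex \<open>z\<close>: the weight becomes \<open>w W(\<cdot>, z)\<close>, whose mass is \<open>c z\<close> and whose
  form is at least \<open>(b z)\<^sup>2 / q\<close> by Cauchy--Schwarz for the semidefinite form of \<open>W\<close>. Averaging over
  \<open>z\<close> is Jensen's inequality, applied through the tangent at \<open>a = q / \<integral>w\<close>.\<close>

lemma clique_density_weighted_ge:
  assumes W: "psd W" and W0: "\<And>p. W p \<ge> 0"
    and w: "bm w" and w0: "\<And>x. w x \<ge> 0"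
  shows "integral\<^sup>L M w ^ m * (ip w (apply_kernel W w) / (integral\<^sup>L M w)\<^sup>2) ^ (m choose 2)
    \<le> clique_density W m w"
  using w w0
proof (induction m arbitrary: w)
  case (Suc m)
  note w = Suc.prems(1) and w0 = Suc.prems(2)
  note s = psd_sym[OF W]
  note b = sym_kernel_bm[OF s]
  define c0 where "c0 = integral\<^sup>L M w"
  define c where "c = apply_kernel W w"
  define q where "q = ip w c"
  have c: "bm c" unfolding c_def by (intro bm_intros b w)
  have cn: "c x \<ge> 0" for x unfolding c_def apply_kernel_def by (simp add: W0 w0)
  have c0: "c0 \<ge> 0" unfolding c0_def by (simp add: w0)
  have q0: "q \<ge> 0" unfolding q_def ip_def by (simp add: w0 cn)
  have T0: "clique_density W (Suc m) w \<ge> 0" by (intro clique_density_nonneg w0 W0)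
  consider "m = 0" | "m \<noteq> 0" "c0 = 0 \<or> q = 0" | n where "m = Suc n" "c0 > 0" "q > 0"
    using c0 q0 not0_implies_Suc by fastforce
  then show ?case
  proof cases
    case 1
    then show ?thesis using clique_density_Suc[OF b w, of 0]
      by (simp add: c0_def choose_two)
  next
    case 2
    have "Suc m choose 2 \<noteq> 0" using 2(1) by (simp add: binomial_eq_0_iff)
    then show ?thesis using 2(2) T0 by (auto simp: c0_def q_def c_def power_0_left)
  next
    case 3
    define a where "a = q / c0"
    have a: "a > 0" "q = a * c0" using 3 by (auto simp: a_def)
    define k where "k = m choose 2"
    have k: "2 * k = m * n" using 3(1) by (simp add: k_def choose_two)
    define wz where "wz z x = w x * W (x, z)" for z x
    have wz_eq: "wz z = (\<lambda>x. w x * W (x, z))" for z by (simp add: wz_def fun_eq_iff)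
    define \<beta> where "\<beta> = apply_kernel W (\<lambda>x. w x * c x)"
    have wc: "bm (\<lambda>x. w x * c x)" by (intro bm_intros w c)
    have \<beta>: "bm \<beta>" unfolding \<beta>_def by (intro bm_intros b wc)
    have \<beta>0: "\<beta> z \<ge> 0" for z unfolding \<beta>_def apply_kernel_def by (simp add: W0 w0 cn)
    have wz: "bm (wz z)" for z unfolding wz_eq by (intro bm_intros w bm_section[OF b])
    have wz0: "wz z x \<ge> 0" for z x by (simp add: wz_def w0 W0)
    have mass: "integral\<^sup>L M (wz z) = c z" for z
      by (simp add: wz_eq c_def apply_kernel_def mult.commute sym_kernel_sym[OF s, of z])
    define L where "L z = a ^ (m * m) + real m * a ^ (m * n) *
      (a ^ n * c z + real n * a ^ (n - 1) * (\<beta> z - a * c z) - a ^ m)" for z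
    have step: "L z / q ^ k \<le> clique_density W m (wz z)" for z
    proof -
      let ?Q = "ip (wz z) (apply_kernel W (wz z))"
      have \<beta>_eq: "ip (wz z) (apply_kernel W w) = \<beta> z"
        unfolding \<beta>_def ip_def apply_kernel_def[of W "\<lambda>x. w x * c x"]
        by (intro Bochner_Integration.integral_cong refl)
          (simp add: wz_def c_def sym_kernel_sym[OF s, of z])
      have "(\<beta> z)\<^sup>2 \<le> ?Q * q"
        using psd_cauchy_schwarz[OF W wz[of z] w] unfolding \<beta>_eq q_def c_def .
      then have Q: "(\<beta> z)\<^sup>2 / q \<le> ?Q" using 3(3) by (simp add: field_simps)
      have cz: "\<beta> z = 0" if "c z = 0"
      proof -
        obtain B where B: "\<And>x. \<bar>c x\<bar> \<le> B" using bounded_measurable_bound[OF c] by metis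
        have "\<beta> z \<le> (\<integral>x. B * wz z x \<partial>M)"
          unfolding \<beta>_def apply_kernel_def
        proof (intro integral_mono bm_integrable bm_intros w c bm_section[OF b] wz)
          fix x
          have "W (z, x) * (w x * c x) = wz z x * c x"
            by (simp add: wz_def sym_kernel_sym[OF s, of z])
          also have "\<dots> \<le> wz z x * B" using B[of x] by (intro mult_left_mono wz0) auto
          finally show "W (z, x) * (w x * c x) \<le> B * wz z x" by (simp add: mult.commute)
        qed
        also have "\<dots> = 0" using mass that by simp
        finally show ?thesis using \<beta>0[of z] by simp
      qed
      have "L z \<le> c z ^ m * (\<beta> z / c z) ^ (m * n)"
        unfolding L_def 3(1) using a(1) cn \<beta>0 cz by (intro star_tangent_le) auto
      then have "L z / q ^ k \<le> c z ^ m * (\<beta> z / c z) ^ (2 * k) / q ^ k"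
        unfolding k using 3(3) by (intro divide_right_mono) auto
      also have "\<dots> = c z ^ m * ((\<beta> z)\<^sup>2 / q / (c z)\<^sup>2) ^ k"
        by (simp only: power_mult power_divide times_divide_eq_right divide_divide_eq_left
            power_mult_distrib) (simp only: mult.commute)
      also have "\<dots> \<le> c z ^ m * (?Q / (c z)\<^sup>2) ^ k"
        using Q q0 cn[of z] by (intro mult_left_mono power_mono divide_right_mono) auto
      also have "\<dots> \<le> clique_density W m (wz z)"
        using Suc.IH[OF wz wz0, of z] by (simp add: mass k_def)
      finally show ?thesis .
    qed
    have moments: "ip w (\<lambda>_. 1) = c0" "ip w c = q" "ip w \<beta> \<ge> a * q"
    proof -
      show 1: "ip w (\<lambda>_. 1) = c0" "ip w c = q" by (simp_all add: ip_def c0_def q_def)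
      have "0 \<le> ip w (\<lambda>x. (c x - a)\<^sup>2)" unfolding ip_def by (simp add: w0)
      also have "(\<lambda>x. (c x - a)\<^sup>2) = (\<lambda>x. a\<^sup>2 + (- 2 * a) * c x + 1 * (c x * c x))"
        by (simp add: fun_eq_iff power2_eq_square algebra_simps)
      also have "ip w \<dots> = a\<^sup>2 * c0 - 2 * a * q + ip w (\<lambda>x. c x * c x)"
        by (subst ip_affine[OF w c bounded_measurable_mult[OF c c]]) (simp add: 1 c0_def)
      also have "a\<^sup>2 * c0 = a * q" using a by (simp add: power2_eq_square)
      also have "ip w (\<lambda>x. c x * c x) = ip w \<beta>"
        using form_sym[OF s w wc] by (simp add: \<beta>_def ip_def flip: c_def) (simp add: ac_simps)
      finally show "a * q \<le> ip w \<beta>" by simp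
    qed
    have Lb: "bm L" unfolding L_def by (intro bm_intros c \<beta>)
    have "c0 * a ^ (m * m) \<le> ip w L"
    proof -
      have L_alt: "L = (\<lambda>z. (a ^ (m * m) - real m * a ^ (m * n) * a ^ m) +
          (real m * a ^ (m * n) * (a ^ n - real n * a ^ (n - 1) * a)) * c z +
          (real m * a ^ (m * n) * (real n * a ^ (n - 1))) * \<beta> z)"
        by (simp add: L_def fun_eq_iff algebra_simps)
      have "ip w L = (a ^ (m * m) - real m * a ^ (m * n) * a ^ m) * c0 +
          (real m * a ^ (m * n) * (a ^ n - real n * a ^ (n - 1) * a)) * q +
          (real m * a ^ (m * n) * (real n * a ^ (n - 1))) * ip w \<beta>"
        unfolding L_alt ip_affine[OF w c \<beta>] moments(2) c0_def ..
      moreover have "(real m * a ^ (m * n) * (real n * a ^ (n - 1))) * (a * q) \<le>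
          (real m * a ^ (m * n) * (real n * a ^ (n - 1))) * ip w \<beta>"
        using a(1) by (intro mult_left_mono moments(3)) auto
      moreover have "(a ^ (m * m) - real m * a ^ (m * n) * a ^ m) * c0 +
          (real m * a ^ (m * n) * (a ^ n - real n * a ^ (n - 1) * a)) * q +
          (real m * a ^ (m * n) * (real n * a ^ (n - 1))) * (a * q) = c0 * a ^ (m * m)"
      proof -
        have "(A - r * X * (a * Z)) * c0 + r * X * (Z - t * Y * a) * (a * c0) +
            r * X * (t * Y) * (a * (a * c0)) = c0 * A" for A r X Y Z t :: real
          by (simp add: algebra_simps)
        moreover have "a ^ m = a * a ^ n" by (simp add: 3(1))
        ultimately show ?thesis unfolding a(2) by simp
      qed
      ultimately show ?thesis by linarith
    qed
    then have "c0 * a ^ (m * m) / q ^ k \<le> ip w L / q ^ k"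
      using 3(3) by (intro divide_right_mono) auto
    also have "\<dots> = (\<integral>z. w z * (L z / q ^ k) \<partial>M)"
      by (simp add: ip_def)
    also have "\<dots> \<le> (\<integral>z. w z * clique_density W m (wz z) \<partial>M)"
    proof (rule integral_mono_AE')
      show "integrable M (\<lambda>z. w z * clique_density W m (wz z))"
        by (rule bm_integrable) (unfold wz_eq, intro bounded_measurable_mult[OF w] bm_clique_density_row[OF b w])
      show "AE z in M. w z * (L z / q ^ k) \<le> w z * clique_density W m (wz z)"
        by (intro AE_I2 mult_left_mono step w0)
      show "AE z in M. 0 \<le> w z * clique_density W m (wz z)"
        by (intro AE_I2 mult_nonneg_nonneg w0 clique_density_nonneg wz0 W0)
    qed
    also have "\<dots> = clique_density W (Suc m) w"
      unfolding clique_density_Suc[OF b w] wz_eq ..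
    finally have main: "c0 * a ^ (m * m) / q ^ k \<le> clique_density W (Suc m) w" .
    have "Suc m choose 2 = k + m" by (simp add: k_def numeral_2_eq_2)
    moreover have "m * m = 2 * k + m" using k 3(1) by simp
    ultimately have "c0 ^ Suc m * (q / c0\<^sup>2) ^ (Suc m choose 2) =
        c0 * c0 ^ m * (a ^ k * a ^ m / (c0 ^ k * c0 ^ m))"
      and "c0 * a ^ (m * m) / q ^ k = c0 * (a ^ k * a ^ k * a ^ m) / (a ^ k * c0 ^ k)"
      using 3(2) by (simp_all only: a(2) power_add power_divide power_mult_distrib mult_2 power2_eq_square
          power_Suc) (simp_all add: power_add power_divide)
    then have "c0 ^ Suc m * (q / c0\<^sup>2) ^ (Suc m choose 2) = c0 * a ^ (m * m) / q ^ k"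
      using 3(2) a(1) by simp
    then show ?thesis using main by (simp add: c0_def q_def c_def)
  qed
qed (simp add: choose_two)

theorem clique_density_ge:
  assumes W: "psd W" and W0: "\<And>p. W p \<ge> 0"
  shows "(\<integral>p. W p \<partial>M2) ^ (m choose 2) \<le>
    (\<integral>x. (\<Prod>e\<in>nsets {1..m} 2. W (x (Min e), x (Max e))) \<partial>cube {1..m})"
proof -
  have "ip (\<lambda>_. 1) (apply_kernel W (\<lambda>_. 1)) = (\<integral>p. W p \<partial>M2)"
    using form_integral[OF sym_kernel_bm[OF psd_sym[OF W]], of "\<lambda>_. 1" "\<lambda>_. 1"]
    by (simp add: bm_intros)
  then show ?thesis
    using clique_density_weighted_ge[OF W W0 bounded_measurable_const[of M 1], of m]
    by (simp add: clique_density_def)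
qed

end

section \<open>Theta patterns\<close>

context full_prob_space
begin

definition theta_kernel :: "('a \<times> 'a \<Rightarrow> real) \<Rightarrow> nat multiset \<Rightarrow> 'a \<times> 'a \<Rightarrow> real" where
  "theta_kernel K \<Theta> p = (\<Prod>r\<in>#\<Theta>. kernel_power K r p)"

lemma theta_kernel_empty [simp]: "theta_kernel K {#} = (\<lambda>_. 1)"
  and theta_kernel_add [simp]:
    "theta_kernel K (add_mset r \<Theta>) = (\<lambda>p. kernel_power K r p * theta_kernel K \<Theta> p)"
  by (auto simp: theta_kernel_def)

lemma theta_kernel_nonneg:
  assumes "\<And>p. K p \<ge> 0" shows "theta_kernel K \<Theta> p \<ge> 0"
  by (induction \<Theta>) (auto intro: mult_nonneg_nonneg kernel_power_nonneg assms)

lemma psd_const: "c \<ge> 0 \<Longrightarrow> psd (\<lambda>_. c)"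
proof -
  assume "c \<ge> 0"
  have "psd (\<lambda>_. 1)"
    by (auto simp: psd_def sym_kernel_const ip_def apply_kernel_def)
  from psd_scale[OF this \<open>c \<ge> 0\<close>] show ?thesis by simp
qed

lemma psd_theta_kernel:
  assumes "psd K" "\<forall>r\<in>#\<Theta>. r \<ge> 1" shows "psd (theta_kernel K \<Theta>)"
  using assms(2)
proof (induction \<Theta>)
  case (add r \<Theta>)
  then have "psd (kernel_power K r)" "psd (theta_kernel K \<Theta>)"
    using psd_kernel_power[OF assms(1)] by auto
  then show ?case by (simp add: psd_mult)
qed (simp add: psd_const)

lemma psd_integral_nonneg: "psd A \<Longrightarrow> 0 \<le> (\<integral>p. A p \<partial>M2)"
  using psd_form[of A "\<lambda>_. 1"] form_integral[of A "\<lambda>_. 1" "\<lambda>_. 1"]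
  by (simp add: bm_intros sym_kernel_bm psd_sym)

lemma ip_one_apply_one:
  assumes "bounded_measurable M2 A"
  shows "ip (\<lambda>_. 1) (apply_kernel A (\<lambda>_. 1)) = (\<integral>p. A p \<partial>M2)"
  using form_integral[OF assms, of "\<lambda>_. 1" "\<lambda>_. 1"] by (simp add: bm_intros)

text \<open>In the Loewner order, a semidefinite kernel \<open>A\<close> dominates the rank one kernel
  \<open>(A u) \<otimes> (A u) / \<langle>u, A u\<rangle>\<close>: this is the Cauchy--Schwarz inequality for the form of \<open>A\<close>.\<close>

lemma psd_minus_rank_one:
  assumes A: "psd A" and u: "bm u" and pos: "ip u (apply_kernel A u) > 0"
  shows "psd (\<lambda>p. A p - 1 / ip u (apply_kernel A u) * apply_kernel A u (fst p) * apply_kernel A u (snd p))"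
  unfolding psd_def
proof (intro conjI allI impI)
  note s = psd_sym[OF A]
  note b = sym_kernel_bm[OF s]
  define w where "w = apply_kernel A u"
  define q where "q = ip u w"
  have w: "bm w" unfolding w_def by (intro bm_intros b u)
  have q: "q > 0" using pos by (simp add: q_def w_def)
  show "sym_kernel (\<lambda>p. A p - 1 / ip u (apply_kernel A u) * apply_kernel A u (fst p) * apply_kernel A u (snd p))"
    by (intro sym_kernel_diff s sym_kernel_rank_one bm_intros b u)
  fix f assume f: "bm f"
  have R: "apply_kernel (\<lambda>p. 1 / q * w (fst p) * w (snd p)) f = (\<lambda>x. 1 / q * ip w f * w x)"
    by (simp add: apply_kernel_def fun_eq_iff ip_def mult.assoc)
  have "(ip f w)\<^sup>2 \<le> ip f (apply_kernel A f) * q"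
    using psd_cauchy_schwarz[OF A f u] by (simp add: w_def q_def)
  then have "(ip f w)\<^sup>2 / q \<le> ip f (apply_kernel A f)" using q by (simp add: field_simps)
  moreover have "ip f (apply_kernel (\<lambda>p. A p - 1 / q * w (fst p) * w (snd p)) f) =
      ip f (apply_kernel A f) - (ip f w)\<^sup>2 / q"
  proof -
    have r: "bounded_measurable M2 (\<lambda>p. 1 / q * w (fst p) * w (snd p))"
      by (intro bm_intros w)
    have "bm (\<lambda>x. 1 / q * ip w f * w x)" by (intro bm_intros w)
    then show ?thesis
      unfolding apply_kernel_diff[OF b r f] R using bm_apply[OF b f] f
      by (subst ip_diff_right)
        (simp_all only: ip_scale_right ip_commute[of w f] power2_eq_square, simp)
  qed
  ultimately show "0 \<le> ip f (apply_kernel (\<lambda>p. A p - 1 / ip u (apply_kernel A u) *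
      apply_kernel A u (fst p) * apply_kernel A u (snd p)) f)"
    by (simp add: w_def q_def)
qed

text \<open>Schur products preserve these rank one bounds.\<close>

lemma psd_prod_minus_rank_one:
  assumes "\<forall>r\<in>#\<Theta>. psd (A r) \<and> c r \<ge> 0 \<and> bm (w r) \<and> psd (\<lambda>p. A r p - c r * w r (fst p) * w r (snd p))"
  shows "psd (\<lambda>p. \<Prod>r\<in>#\<Theta>. A r p) \<and> bm (\<lambda>x. \<Prod>r\<in>#\<Theta>. w r x) \<and> (\<Prod>r\<in>#\<Theta>. c r) \<ge> 0 \<and>
    psd (\<lambda>p. (\<Prod>r\<in>#\<Theta>. A r p) - (\<Prod>r\<in>#\<Theta>. c r) * (\<Prod>r\<in>#\<Theta>. w r (fst p)) * (\<Prod>r\<in>#\<Theta>. w r (snd p)))"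
  using assms
proof (induction \<Theta>)
  case empty
  then show ?case by (auto intro: psd_const bm_intros)
next
  case (add r \<Theta>)
  define X where "X p = (\<Prod>r\<in>#\<Theta>. A r p)" for p
  define V where "V x = (\<Prod>r\<in>#\<Theta>. w r x)" for x
  define C where "C = (\<Prod>r\<in>#\<Theta>. c r)"
  have IH: "psd X" "bm V" "C \<ge> 0" "psd (\<lambda>p. X p - C * V (fst p) * V (snd p))"
    using add by (auto simp: X_def[abs_def] V_def[abs_def] C_def)
  have r: "psd (A r)" "c r \<ge> 0" "bm (w r)" "psd (\<lambda>p. A r p - c r * w r (fst p) * w r (snd p))"
    using add.prems by auto
  have "psd (\<lambda>p. A r p * (X p - C * V (fst p) * V (snd p)) +
      C * V (fst p) * V (snd p) * (A r p - c r * w r (fst p) * w r (snd p)))"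
    by (intro psd_add psd_mult psd_rank_one_mult IH r)
  also have "(\<lambda>p. A r p * (X p - C * V (fst p) * V (snd p)) +
      C * V (fst p) * V (snd p) * (A r p - c r * w r (fst p) * w r (snd p))) =
      (\<lambda>p. A r p * X p - c r * C * (w r (fst p) * V (fst p)) * (w r (snd p) * V (snd p)))"
    by (simp add: fun_eq_iff algebra_simps)
  finally show ?case
    using psd_mult[OF r(1) IH(1)] bounded_measurable_mult[OF r(3) IH(2)] r(2) IH(3)
    by (simp add: X_def[abs_def] V_def[abs_def] C_def)
qed

text \<open>The rank one bounds of all branches for the same \<open>u\<close> are multiplied, and the resulting semidefinite
  difference is tested with the constant function \<open>1\<close>.\<close>

lemma theta_integral_ge:
  assumes K: "psd K" and \<Theta>: "\<forall>r\<in>#\<Theta>. r \<ge> 1" and u: "bm u"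
    and pos: "\<And>r. r \<ge> 1 \<Longrightarrow> ip u ((apply_kernel K ^^ r) u) > 0"
  shows "(\<integral>x. (\<Prod>r\<in>#\<Theta>. (apply_kernel K ^^ r) u x) \<partial>M)\<^sup>2 \<le>
    (\<integral>p. theta_kernel K \<Theta> p \<partial>M2) * (\<Prod>r\<in>#\<Theta>. ip u ((apply_kernel K ^^ r) u))"
proof -
  note b = sym_kernel_bm[OF psd_sym[OF K]]
  let ?w = "\<lambda>r. (apply_kernel K ^^ r) u"
  let ?c = "\<lambda>r. 1 / ip u (?w r)"
  let ?V = "\<lambda>x. \<Prod>r\<in>#\<Theta>. ?w r x"
  let ?C = "\<Prod>r\<in>#\<Theta>. ?c r"
  have "\<forall>r\<in>#\<Theta>. psd (kernel_power K r) \<and> ?c r \<ge> 0 \<and> bm (?w r) \<and>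
      psd (\<lambda>p. kernel_power K r p - ?c r * ?w r (fst p) * ?w r (snd p))"
  proof
    fix r assume "r \<in># \<Theta>"
    then have r: "r \<ge> 1" using \<Theta> by auto
    have "apply_kernel (kernel_power K r) u = ?w r" by (rule apply_kernel_power[OF b u r])
    then show "psd (kernel_power K r) \<and> ?c r \<ge> 0 \<and> bm (?w r) \<and>
      psd (\<lambda>p. kernel_power K r p - ?c r * ?w r (fst p) * ?w r (snd p))"
      using psd_minus_rank_one[OF psd_kernel_power[OF K r] u] pos[OF r] psd_kernel_power[OF K r]
        bm_funpow_apply[OF b u, of r] by (simp add: less_imp_le)
  qed
  from psd_prod_minus_rank_one[OF this]
  have V: "bm ?V" and psd: "psd (theta_kernel K \<Theta>)"
    "psd (\<lambda>p. theta_kernel K \<Theta> p - ?C * ?V (fst p) * ?V (snd p))"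
    by (auto simp: theta_kernel_def[abs_def])
  note t = sym_kernel_bm[OF psd_sym[OF psd(1)]]
  have rb: "bounded_measurable M2 (\<lambda>p. ?C * ?V (fst p) * ?V (snd p))"
    by (intro bm_intros bm_fst[OF V] bm_snd[OF V])
  have "0 \<le> (\<integral>p. theta_kernel K \<Theta> p - ?C * ?V (fst p) * ?V (snd p) \<partial>M2)"
    by (rule psd_integral_nonneg[OF psd(2)])
  also have "\<dots> = (\<integral>p. theta_kernel K \<Theta> p \<partial>M2) -
      (\<integral>p. ?C * ?V (fst p) * ?V (snd p) \<partial>M2)"
    by (intro Bochner_Integration.integral_diff square.integrable_bounded_measurable t rb)
  also have "(\<integral>p. ?C * ?V (fst p) * ?V (snd p) \<partial>M2) = ?C * (integral\<^sup>L M ?V)\<^sup>2"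
    by (subst integral_square[OF rb]) (simp add: power2_eq_square mult.assoc)
  finally have "?C * (integral\<^sup>L M ?V)\<^sup>2 \<le> (\<integral>p. theta_kernel K \<Theta> p \<partial>M2)" by simp
  moreover have "?C * (\<Prod>r\<in>#\<Theta>. ip u (?w r)) = 1 \<and> (\<Prod>r\<in>#\<Theta>. ip u (?w r)) > 0"
    using \<Theta>
  proof (induction \<Theta>)
    case (add r \<Theta>)
    then have "ip u (?w r) > 0" using pos by simp
    then show ?case using add by simp
  qed simp
  moreover have "I \<le> t * P" if "C * I \<le> t" "C * P = 1 \<and> P > 0" for C I t P :: real
  proof -
    have "I = C * I * P" using that(2) by (simp add: mult.commute mult.left_commute)
    also have "\<dots> \<le> t * P" using that by (intro mult_right_mono) auto
    finally show ?thesis .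
  qed
  ultimately show ?thesis by blast
qed

end

section \<open>Walks\<close>

context full_prob_space
begin

definition walk_moment :: "('a \<times> 'a \<Rightarrow> real) \<Rightarrow> ('a \<Rightarrow> real) \<Rightarrow> nat \<Rightarrow> real" where
  "walk_moment K f n = ip f ((apply_kernel K ^^ n) f)"

lemma walk_moment_nonneg: "psd K \<Longrightarrow> bm f \<Longrightarrow> walk_moment K f n \<ge> 0"
  by (simp add: walk_moment_def funpow_form_nonneg)

text \<open>The middle exponent splits into two halves either with or without a copy of \<open>K\<close> left between them;
  accordingly the Cauchy--Schwarz inequality of the form of \<open>K\<close> or of the inner product applies.\<close>

lemma walk_moment_log_convex:
  assumes K: "psd K" and f: "bm f"
  shows "(walk_moment K f (Suc n))\<^sup>2 \<le> walk_moment K f n * walk_moment K f (Suc (Suc n))"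
proof -
  note s = psd_sym[OF K]
  note b = sym_kernel_bm[OF s]
  let ?g = "\<lambda>i. (apply_kernel K ^^ i) f"
  have g: "bm (?g i)" for i by (intro bm_intros b f)
  have m: "ip (?g i) (?g j) = walk_moment K f (i + j)" for i j
    unfolding walk_moment_def by (rule ip_funpow[OF s f f])
  have m': "ip (?g i) (apply_kernel K (?g j)) = walk_moment K f (Suc (i + j))" for i j
    using m[of i "Suc j"] by simp
  have "\<exists>k. n = k + k \<or> n = Suc (k + k)" by presburger
  then obtain k where "n = k + k \<or> n = Suc (k + k)" by blast
  then show ?thesis
  proof
    assume n: "n = k + k"
    show ?thesis using ip_cauchy_schwarz[OF g[of k] g[of "Suc k"]] unfolding m n by simp
  next
    assume n: "n = Suc (k + k)"
    show ?thesis using psd_cauchy_schwarz[OF K g[of k] g[of "Suc k"]] unfolding m' n by simp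
  qed
qed

lemma walk_moment_zero_descends:
  assumes K: "psd K" and f: "bm f" and "walk_moment K f n = 0" "n \<ge> 1"
  shows "walk_moment K f 1 = 0"
  using assms(4,3)
proof (induction n rule: dec_induct)
  case (step n)
  obtain k where "n = Suc k" using step(1) by (cases n) auto
  then have "(walk_moment K f n)\<^sup>2 \<le> 0" using walk_moment_log_convex[OF K f, of k] step.prems by simp
  then show ?case using step.IH by simp
qed simp

abbreviation "mass K n \<equiv> walk_moment K (\<lambda>_. 1) n"

lemma mass_0 [simp]: "mass K 0 = 1"
  by (simp add: walk_moment_def ip_def)

lemma mass_1:
  assumes "bounded_measurable M2 K" shows "mass K (Suc 0) = (\<integral>p. K p \<partial>M2)"
  using ip_one_apply_one[OF assms] by (simp add: walk_moment_def)

lemma mass_power: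
  assumes "bounded_measurable M2 K" "r \<ge> 1"
  shows "(\<integral>p. kernel_power K r p \<partial>M2) = mass K r"
  using ip_one_apply_one[OF bm_kernel_power[OF assms(1)], of r]
  by (simp add: walk_moment_def apply_kernel_power[OF assms(1) bounded_measurable_const assms(2)])

lemma mass_ratio:
  assumes K: "psd K" and p: "mass K (Suc 0) > 0"
  shows "mass K n > 0" "incseq (\<lambda>n. mass K (Suc n) / mass K n)"
    "mass K (Suc 0) \<le> mass K (Suc n) / mass K n"
proof -
  have one: "bm (\<lambda>_. 1)" by (rule bounded_measurable_const)
  note lc = walk_moment_log_convex[OF K one]
  have pos: "mass K n > 0 \<and> mass K (Suc n) > 0" for n
  proof (induction n)
    case (Suc n)
    have "0 < (mass K (Suc n))\<^sup>2" using Suc by simp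
    also have "\<dots> \<le> mass K n * mass K (Suc (Suc n))" by (rule lc)
    finally show ?case using Suc by (simp add: zero_less_mult_iff)
  qed (use p in simp)
  then show "mass K n > 0" by simp
  show inc: "incseq (\<lambda>n. mass K (Suc n) / mass K n)"
  proof (rule incseq_SucI)
    fix n
    show "mass K (Suc n) / mass K n \<le> mass K (Suc (Suc n)) / mass K (Suc n)"
      using lc[of n] pos[of n] pos[of "Suc n"] by (simp add: field_simps power2_eq_square)
  qed
  show "mass K (Suc 0) \<le> mass K (Suc n) / mass K n"
    using incseqD[OF inc, of 0 n] by simp
qed

lemma mass_ge_power:
  assumes K: "psd K" and p: "mass K (Suc 0) > 0"
  shows "mass K (Suc 0) ^ n \<le> mass K n"
proof (induction n)
  case (Suc n)
  have "mass K (Suc 0) ^ Suc n \<le> mass K (Suc 0) * mass K n"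
    using Suc p by (simp add: mult_left_mono)
  also have "\<dots> \<le> mass K (Suc n)"
    using mass_ratio(1)[OF K p, of n] mass_ratio(3)[OF K p, of n] by (simp add: field_simps)
  finally show ?case .
qed simp

text \<open>The limit is the top eigenvalue seen from the constant function.\<close>

lemma mass_ratio_converges:
  assumes K: "psd K" and K0: "\<And>p. K p \<ge> 0" and p: "mass K (Suc 0) > 0"
  obtains l where "(\<lambda>n. mass K (Suc n) / mass K n) \<longlonglongrightarrow> l"
    "\<And>n. mass K (Suc n) / mass K n \<le> l"
proof -
  note b = sym_kernel_bm[OF psd_sym[OF K]]
  obtain B where B: "\<And>p. \<bar>K p\<bar> \<le> B" using bounded_measurable_bound[OF b] by metis
  let ?d = "\<lambda>n. (apply_kernel K ^^ n) (\<lambda>_. 1)"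
  have d: "bm (?d n)" for n by (intro bm_intros b)
  have d0: "?d n x \<ge> 0" for n x
    by (induction n arbitrary: x) (auto simp: apply_kernel_def K0)
  have "mass K (Suc n) \<le> B * mass K n" for n
  proof -
    have "apply_kernel K (?d n) x \<le> B * mass K n" for x
    proof -
      have "apply_kernel K (?d n) x \<le> (\<integral>y. B * ?d n y \<partial>M)"
        unfolding apply_kernel_def[of K "?d n"]
        by (intro integral_mono bm_integrable bm_intros bm_section[OF b] d mult_right_mono d0)
          (use B in \<open>auto simp: abs_le_iff\<close>)
      then show ?thesis by (simp add: walk_moment_def ip_def)
    qed
    then have "(\<integral>x. apply_kernel K (?d n) x \<partial>M) \<le> (\<integral>x. B * mass K n \<partial>M)"
      by (intro integral_mono bm_integrable bm_intros b d)
    then show ?thesis by (simp add: walk_moment_def ip_def)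
  qed
  then have "mass K (Suc n) / mass K n \<le> B" for n
    using mass_ratio(1)[OF K p, of n] by (simp add: field_simps)
  then obtain l where "(\<lambda>n. mass K (Suc n) / mass K n) \<longlonglongrightarrow> l" "\<forall>n. mass K (Suc n) / mass K n \<le> l"
    using incseq_convergent[OF mass_ratio(2)[OF K p], of B] by auto
  then show ?thesis by (intro that) auto
qed

end

section \<open>The lower bound for theta patterns\<close>

lemma power_ge_quadratic_tangent:
  fixes u :: real assumes "u \<ge> 0" "s \<ge> 2"
  shows "1 + real s / 2 * (u\<^sup>2 - 1) \<le> u ^ s"
proof -
  have "2 * u ^ s - real s * u\<^sup>2 + real s - 2 \<ge> 0"
    using assms(2)
  proof (induction s rule: dec_induct)
    case (step s)
    \<comment> \<open>the difference of the next case and \<open>u\<close> times this case is a square times a linear factor\<close>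
    have "2 * u ^ Suc s - real (Suc s) * u\<^sup>2 + real (Suc s) - 2 =
        u * (2 * u ^ s - real s * u\<^sup>2 + real s - 2) + (u - 1)\<^sup>2 * (real s * u + real s - 1)"
      by (simp add: power2_eq_square algebra_simps)
    moreover have "real s * u \<ge> 0" "real s \<ge> 2" using step assms(1) by auto
    then have "(u - 1)\<^sup>2 * (real s * u + real s - 1) \<ge> 0"
      by (intro mult_nonneg_nonneg) auto
    moreover have "u * (2 * u ^ s - real s * u\<^sup>2 + real s - 2) \<ge> 0"
      using step assms(1) by (intro mult_nonneg_nonneg) auto
    ultimately show ?case by linarith
  qed simp
  then show ?thesis by (simp add: field_simps)
qed

lemma abs_add_mult_le: "\<bar>a + c * b\<bar> \<le> \<bar>a\<bar> + \<bar>c\<bar> * \<bar>b\<bar>" for a b c :: real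
  using abs_triangle_ineq[of a "c * b"] by (simp add: abs_mult)

context full_prob_space
begin

text \<open>The normalised walk functions approximate a top eigenfunction of \<open>K\<close>; they are the
  test functions in the lower bound for theta patterns.\<close>

definition walk_unit :: "('a \<times> 'a \<Rightarrow> real) \<Rightarrow> nat \<Rightarrow> 'a \<Rightarrow> real" where
  "walk_unit K n x = (apply_kernel K ^^ Suc n) (\<lambda>_. 1) x / sqrt (mass K (2 * Suc n))"

lemma integral_abs_apply_le:
  assumes b: "bounded_measurable M2 K" and B: "\<And>p. \<bar>K p\<bar> \<le> B" and g: "bm g"
  shows "(\<integral>x. \<bar>apply_kernel K g x\<bar> \<partial>M) \<le> B * (\<integral>x. \<bar>g x\<bar> \<partial>M)"
    and "\<bar>apply_kernel K g x\<bar> \<le> B * (\<integral>x. \<bar>g x\<bar> \<partial>M)"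
proof -
  show 1: "\<bar>apply_kernel K g x\<bar> \<le> B * (\<integral>x. \<bar>g x\<bar> \<partial>M)" for x
  proof -
    have "\<bar>apply_kernel K g x\<bar> \<le> (\<integral>y. \<bar>K (x, y) * g y\<bar> \<partial>M)"
      unfolding apply_kernel_def by (rule integral_abs_bound)
    also have "\<dots> \<le> (\<integral>y. B * \<bar>g y\<bar> \<partial>M)"
      unfolding abs_mult
      by (intro integral_mono bm_integrable bm_intros bm_section[OF b] g mult_right_mono B) simp
    finally show ?thesis by simp
  qed
  have "(\<integral>x. \<bar>apply_kernel K g x\<bar> \<partial>M) \<le> (\<integral>x. B * (\<integral>x. \<bar>g x\<bar> \<partial>M) \<partial>M)"
    by (intro integral_mono bm_integrable bm_intros b g 1)
  then show "(\<integral>x. \<bar>apply_kernel K g x\<bar> \<partial>M) \<le> B * (\<integral>x. \<bar>g x\<bar> \<partial>M)" by simp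
qed

lemma funpow_apply_nonneg:
  assumes "\<And>p. K p \<ge> 0" "\<And>x. f x \<ge> 0" shows "(apply_kernel K ^^ n) f x \<ge> 0"
  by (induction n arbitrary: x) (auto simp: apply_kernel_def assms)

lemma funpow_apply_scale:
  "(apply_kernel K ^^ n) (\<lambda>x. c * f x) = (\<lambda>x. c * (apply_kernel K ^^ n) f x)"
  by (induction n) (simp_all add: apply_scale)

lemma bm_one: "bm (\<lambda>_. 1)"
  by (rule bounded_measurable_const)

context
  fixes K :: "'a \<times> 'a \<Rightarrow> real" and l :: real
  assumes K: "psd K" and K0: "\<And>p. K p \<ge> 0" and p: "mass K (Suc 0) > 0"
    and l: "(\<lambda>n. mass K (Suc n) / mass K n) \<longlonglongrightarrow> l"
begin

private lemma kernel_bm: "bounded_measurable M2 K" by (rule sym_kernel_bm[OF psd_sym[OF K]])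

private lemma mass_nz: "mass K n \<noteq> 0"
  using mass_ratio(1)[OF K p, of n] by simp

lemma bm_walk_unit: "bm (walk_unit K n)"
  unfolding walk_unit_def[abs_def] by (intro bm_intros kernel_bm)

lemma walk_unit_nonneg: "walk_unit K n x \<ge> 0"
  unfolding walk_unit_def by (intro divide_nonneg_nonneg funpow_apply_nonneg K0)
    (simp_all add: walk_moment_nonneg[OF K bm_one])

lemma walk_unit_moment: "ip (walk_unit K n) ((apply_kernel K ^^ r) (walk_unit K n)) =
  mass K (2 * Suc n + r) / mass K (2 * Suc n)"
proof -
  let ?c = "1 / sqrt (mass K (2 * Suc n))"
  have u: "walk_unit K n = (\<lambda>x. ?c * (apply_kernel K ^^ Suc n) (\<lambda>_. 1) x)"
    by (simp add: walk_unit_def[abs_def])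
  have "?c * ?c = 1 / mass K (2 * Suc n)"
    using walk_moment_nonneg[OF K bm_one, of "2 * Suc n"] by simp
  moreover have "ip ((apply_kernel K ^^ Suc n) (\<lambda>_. 1)) ((apply_kernel K ^^ r) ((apply_kernel K ^^ Suc n) (\<lambda>_. 1))) =
      mass K (2 * Suc n + r)"
    unfolding funpow_add[symmetric, THEN fun_cong, unfolded comp_def] walk_moment_def
    by (subst ip_funpow[OF psd_sym[OF K] bm_one bm_one]) (simp only: mult_2 add_ac)
  ultimately show ?thesis
    unfolding u funpow_apply_scale ip_scale_left ip_scale_right by (simp add: field_simps)
qed

lemma walk_unit_moment_tendsto:
  "(\<lambda>n. ip (walk_unit K n) ((apply_kernel K ^^ r) (walk_unit K n))) \<longlonglongrightarrow> l ^ r"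
proof (induction r)
  case 0
  have "ip (walk_unit K n) ((apply_kernel K ^^ 0) (walk_unit K n)) = 1" for n
    unfolding walk_unit_moment using mass_ratio(1)[OF K p, of "2 * Suc n"] by simp
  then show ?case by simp
next
  case (Suc r)
  have "(\<lambda>n. mass K (Suc (2 * Suc n + r)) / mass K (2 * Suc n + r)) \<longlonglongrightarrow> l"
    by (rule filterlim_compose[OF l, of "\<lambda>n. 2 * Suc n + r"])
      (rule filterlim_subseq, simp add: strict_mono_def)
  from tendsto_mult[OF this Suc]
  have "(\<lambda>n. mass K (Suc (2 * Suc n + r)) / mass K (2 * Suc n + r) *
      (mass K (2 * Suc n + r) / mass K (2 * Suc n))) \<longlonglongrightarrow> l * l ^ r"
    unfolding walk_unit_moment .
  also have "(\<lambda>n. mass K (Suc (2 * Suc n + r)) / mass K (2 * Suc n + r) *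
      (mass K (2 * Suc n + r) / mass K (2 * Suc n))) =
      (\<lambda>n. mass K (2 * Suc n + Suc r) / mass K (2 * Suc n))"
    using mass_nz by (simp add: fun_eq_iff)
  finally show ?case unfolding walk_unit_moment by simp
qed

text \<open>A bound uniform in \<open>n\<close> and \<open>x\<close> is what makes convergence in \<open>L\<^sup>1\<close> compatible with products.\<close>

lemma walk_unit_uniform_bound: obtains C where "C \<ge> 1" "\<And>n x. \<bar>walk_unit K n x\<bar> \<le> C"
proof -
  obtain B where B: "B \<ge> 1" "\<And>p. \<bar>K p\<bar> \<le> B" using bounded_measurable_bound[OF kernel_bm] by metis
  have "\<bar>walk_unit K n x\<bar> \<le> B / mass K (Suc 0)" for n x
  proof -
    let ?d = "(apply_kernel K ^^ n) (\<lambda>_. 1)"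
    have d: "bm ?d" by (intro bm_intros kernel_bm)
    have "(mass K n)\<^sup>2 \<le> mass K (2 * n)"
      using ip_cauchy_schwarz[OF bm_one d] ip_funpow[OF psd_sym[OF K] bm_one bm_one, of n n]
      by (simp add: walk_moment_def mult_2 ip_def[of "\<lambda>_. 1" "\<lambda>_. 1"])
    then have m: "mass K n \<le> sqrt (mass K (2 * n))" by (rule real_le_rsqrt)
    have pos: "mass K (2 * n) > 0" "mass K (2 * Suc n) > 0" by (rule mass_ratio(1)[OF K p])+
    have "mass K (Suc 0) * mass K (2 * n) \<le> mass K (Suc (2 * n))"
      "mass K (Suc 0) * mass K (Suc (2 * n)) \<le> mass K (2 * Suc n)"
      using mass_ratio(1,3)[OF K p, of "2 * n"] mass_ratio(1,3)[OF K p, of "Suc (2 * n)"]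
      by (simp_all add: field_simps)
    then have "(mass K (Suc 0))\<^sup>2 * mass K (2 * n) \<le> mass K (2 * Suc n)"
      unfolding power2_eq_square mult.assoc using p
      by (meson less_imp_le mult_left_mono order_trans)
    then have "sqrt ((mass K (Suc 0))\<^sup>2 * mass K (2 * n)) \<le> sqrt (mass K (2 * Suc n))"
      by (rule real_sqrt_le_mono)
    then have s: "mass K (Suc 0) * sqrt (mass K (2 * n)) \<le> sqrt (mass K (2 * Suc n))"
      using p by (simp add: real_sqrt_mult)
    have "(\<integral>x. \<bar>?d x\<bar> \<partial>M) = mass K n"
      using funpow_apply_nonneg[OF K0, of "\<lambda>_. 1" n] by (simp add: walk_moment_def ip_def)
    then have "\<bar>apply_kernel K ?d x\<bar> \<le> B * mass K n"
      using integral_abs_apply_le(2)[OF kernel_bm B(2) d] by simp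
    also have "\<dots> \<le> B * sqrt (mass K (2 * n))" using m B(1) by (intro mult_left_mono) auto
    also have "\<dots> = B / mass K (Suc 0) * (mass K (Suc 0) * sqrt (mass K (2 * n)))"
      using p by simp
    also have "\<dots> \<le> B / mass K (Suc 0) * sqrt (mass K (2 * Suc n))"
      using p B(1) by (intro mult_left_mono s) simp
    finally have "\<bar>apply_kernel K ?d x\<bar> \<le> B / mass K (Suc 0) * sqrt (mass K (2 * Suc n))" .
    then have "\<bar>apply_kernel K ?d x\<bar> / sqrt (mass K (2 * Suc n)) \<le> B / mass K (Suc 0)"
      using pos(2) by (subst pos_divide_le_eq) auto
    then show ?thesis using pos(2) by (simp add: walk_unit_def abs_divide)
  qed
  then show ?thesis
    by (intro that[of "max 1 (B / mass K (Suc 0))"]) (auto simp: max.coboundedI2)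
qed

text \<open>For \<open>r = 1\<close> the squared \<open>L\<^sup>2\<close> distance expands into moments with limit \<open>l\<^sup>2 - 2 l l + l\<^sup>2 = 0\<close>.\<close>

lemma walk_unit_eigen_tendsto:
  "(\<lambda>n. \<integral>x. \<bar>(apply_kernel K ^^ r) (walk_unit K n) x - l ^ r * walk_unit K n x\<bar> \<partial>M) \<longlonglongrightarrow> 0"
proof (induction r)
  case (Suc r)
  obtain B where B: "B \<ge> 1" "\<And>p. \<bar>K p\<bar> \<le> B" using bounded_measurable_bound[OF kernel_bm] by metis
  let ?u = "walk_unit K"
  note u = bm_walk_unit
  have Ku: "bm (apply_kernel K (?u n))" for n by (intro bm_intros kernel_bm u)
  have base: "(\<lambda>n. \<integral>x. \<bar>apply_kernel K (?u n) x - l * ?u n x\<bar> \<partial>M) \<longlonglongrightarrow> 0"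
  proof -
    let ?g = "\<lambda>n x. apply_kernel K (?u n) x - l * ?u n x"
    have g: "bm (?g n)" for n by (intro bm_intros Ku u)
    have "ip (?g n) (?g n) = ip (?u n) ((apply_kernel K ^^ 2) (?u n)) -
        2 * l * ip (?u n) ((apply_kernel K ^^ 1) (?u n)) + l\<^sup>2 * ip (?u n) ((apply_kernel K ^^ 0) (?u n))" for n
    proof -
      have "ip (apply_kernel K (?u n)) (apply_kernel K (?u n)) = ip (?u n) ((apply_kernel K ^^ 2) (?u n))"
        using ip_funpow[OF psd_sym[OF K] u[of n] u[of n], of 1 1] by (simp add: numeral_2_eq_2)
      moreover have "ip (\<lambda>x. f x - l * g x) (\<lambda>x. f x - l * g x) = ip f f - 2 * l * ip g f + l\<^sup>2 * ip g g"
        if "bm f" "bm g" for f g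
        using that by (simp add: ip_diff_left ip_diff_right ip_scale_left ip_scale_right bm_intros
            power2_eq_square ip_commute[of f g] algebra_simps)
      note this[OF Ku u]
      ultimately show ?thesis by simp
    qed
    then have "(\<lambda>n. ip (?g n) (?g n)) \<longlonglongrightarrow> l ^ 2 - 2 * l * l ^ 1 + l\<^sup>2 * l ^ 0"
      by (simp only:) (intro tendsto_intros walk_unit_moment_tendsto)
    moreover have "l ^ 2 - 2 * l * l ^ 1 + l\<^sup>2 * l ^ 0 = 0" by (simp add: power2_eq_square)
    ultimately have "(\<lambda>n. ip (?g n) (?g n)) \<longlonglongrightarrow> 0" by (simp only:)
    from tendsto_real_sqrt[OF this]
    have lim: "(\<lambda>n. sqrt (ip (?g n) (?g n))) \<longlonglongrightarrow> 0" by simp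
    have "(\<integral>x. \<bar>?g n x\<bar> \<partial>M) \<le> sqrt (ip (?g n) (?g n))" for n
    proof (rule real_le_rsqrt)
      have "(ip (\<lambda>_. 1) (\<lambda>x. \<bar>?g n x\<bar>))\<^sup>2 \<le> ip (\<lambda>_. 1) (\<lambda>_. 1) * ip (\<lambda>x. \<bar>?g n x\<bar>) (\<lambda>x. \<bar>?g n x\<bar>)"
        by (intro ip_cauchy_schwarz bm_one bounded_measurable_abs g)
      then show "(\<integral>x. \<bar>?g n x\<bar> \<partial>M)\<^sup>2 \<le> ip (?g n) (?g n)" by (simp add: ip_def)
    qed
    then show ?thesis by (intro Lim_null_comparison[OF always_eventually lim] allI) (simp only: real_norm_def abs_of_nonneg
        Bochner_Integration.integral_nonneg abs_ge_zero)
  qed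
  let ?e = "\<lambda>r n x. (apply_kernel K ^^ r) (?u n) x - l ^ r * ?u n x"
  have e: "bm (?e r n)" for r n by (intro bm_intros kernel_bm u)
  have "(\<integral>x. \<bar>?e (Suc r) n x\<bar> \<partial>M) \<le> B * (\<integral>x. \<bar>?e r n x\<bar> \<partial>M) +
      \<bar>l\<bar> ^ r * (\<integral>x. \<bar>apply_kernel K (?u n) x - l * ?u n x\<bar> \<partial>M)" for n
  proof -
    have f: "bm ((apply_kernel K ^^ r) (?u n))" by (intro bm_intros kernel_bm u)
    have lu: "bm (\<lambda>x. l ^ r * ?u n x)" by (intro bm_intros u)
    have "apply_kernel K (?e r n) = (\<lambda>x. (apply_kernel K ^^ Suc r) (?u n) x - l ^ r * apply_kernel K (?u n) x)"
      by (simp add: apply_diff[OF kernel_bm f lu] apply_scale)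
    then have "?e (Suc r) n x = apply_kernel K (?e r n) x + l ^ r * (apply_kernel K (?u n) x - l * ?u n x)" for x
      by (simp add: algebra_simps)
    then have "\<bar>?e (Suc r) n x\<bar> \<le> \<bar>apply_kernel K (?e r n) x\<bar> + \<bar>l\<bar> ^ r * \<bar>apply_kernel K (?u n) x - l * ?u n x\<bar>" for x
      by (simp only: power_abs[symmetric] abs_add_mult_le)
    then have "(\<integral>x. \<bar>?e (Suc r) n x\<bar> \<partial>M) \<le>
        (\<integral>x. \<bar>apply_kernel K (?e r n) x\<bar> + \<bar>l\<bar> ^ r * \<bar>apply_kernel K (?u n) x - l * ?u n x\<bar> \<partial>M)"
      by (intro integral_mono bm_integrable bounded_measurable_abs bounded_measurable_add
          bounded_measurable_mult bounded_measurable_const bounded_measurable_diff bm_apply e kernel_bm u Ku)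
    also have "\<dots> = (\<integral>x. \<bar>apply_kernel K (?e r n) x\<bar> \<partial>M) +
        \<bar>l\<bar> ^ r * (\<integral>x. \<bar>apply_kernel K (?u n) x - l * ?u n x\<bar> \<partial>M)"
      by (subst Bochner_Integration.integral_add)
        (intro bm_integrable bounded_measurable_abs bounded_measurable_mult bounded_measurable_const
          bounded_measurable_diff bm_apply e kernel_bm u Ku | simp only: integral_mult_right_zero)+
    finally show ?thesis using integral_abs_apply_le(1)[OF kernel_bm B(2) e[of r n]] by linarith
  qed
  moreover have "(\<lambda>n. B * (\<integral>x. \<bar>?e r n x\<bar> \<partial>M) +
      \<bar>l\<bar> ^ r * (\<integral>x. \<bar>apply_kernel K (?u n) x - l * ?u n x\<bar> \<partial>M)) \<longlonglongrightarrow> B * 0 + \<bar>l\<bar> ^ r * 0"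
    by (intro tendsto_intros Suc base)
  then have z: "(\<lambda>n. B * (\<integral>x. \<bar>?e r n x\<bar> \<partial>M) +
      \<bar>l\<bar> ^ r * (\<integral>x. \<bar>apply_kernel K (?u n) x - l * ?u n x\<bar> \<partial>M)) \<longlonglongrightarrow> 0" by simp
  ultimately show ?case
    by (intro Lim_null_comparison[OF always_eventually z] allI) (simp only: real_norm_def abs_of_nonneg
        Bochner_Integration.integral_nonneg abs_ge_zero)
qed simp

lemma walk_unit_product_tendsto:
  "(\<lambda>n. \<integral>x. \<bar>(\<Prod>r\<in>#\<Theta>. (apply_kernel K ^^ r) (walk_unit K n) x) -
      l ^ sum_mset \<Theta> * walk_unit K n x ^ size \<Theta>\<bar> \<partial>M) \<longlonglongrightarrow> 0 \<and>
   (\<forall>n. bm (\<lambda>x. \<Prod>r\<in>#\<Theta>. (apply_kernel K ^^ r) (walk_unit K n) x)) \<and>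
   (\<exists>D. \<forall>n x. \<bar>\<Prod>r\<in>#\<Theta>. (apply_kernel K ^^ r) (walk_unit K n) x\<bar> \<le> D)"
proof (induction \<Theta>)
  case empty
  then show ?case by (auto intro: bm_intros)
next
  case (add r \<Theta>)
  let ?u = "walk_unit K"
  note u = bm_walk_unit
  define P where "P n x = (\<Prod>r\<in>#\<Theta>. (apply_kernel K ^^ r) (?u n) x)" for n x
  define Q where "Q n x = l ^ sum_mset \<Theta> * ?u n x ^ size \<Theta>" for n x
  define a where "a n x = (apply_kernel K ^^ r) (?u n) x" for n x
  obtain D where D: "\<And>n x. \<bar>P n x\<bar> \<le> D" using add by (auto simp: P_def)
  have P: "bm (P n)" for n using add by (auto simp: P_def[abs_def])
  have Q: "bm (Q n)" for n unfolding Q_def[abs_def] by (intro bm_intros u)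
  have a: "bm (a n)" for n unfolding a_def[abs_def] by (intro bm_intros kernel_bm u)
  have lim: "(\<lambda>n. \<integral>x. \<bar>P n x - Q n x\<bar> \<partial>M) \<longlonglongrightarrow> 0" using add by (simp add: P_def Q_def)
  obtain C where C: "C \<ge> 1" "\<And>n x. \<bar>?u n x\<bar> \<le> C" using walk_unit_uniform_bound by metis
  obtain B where B: "B \<ge> 1" "\<And>p. \<bar>K p\<bar> \<le> B" using bounded_measurable_bound[OF kernel_bm] by metis
  have aB: "\<bar>a n x\<bar> \<le> B ^ r * C" for n x
    unfolding a_def
  proof (induction r arbitrary: x)
    case (Suc r)
    have f: "bm ((apply_kernel K ^^ r) (?u n))" by (intro bm_intros kernel_bm u)
    have "\<bar>(apply_kernel K ^^ Suc r) (?u n) x\<bar> \<le> B * (\<integral>x. \<bar>(apply_kernel K ^^ r) (?u n) x\<bar> \<partial>M)"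
      using integral_abs_apply_le(2)[OF kernel_bm B(2) f] by simp
    also have "\<dots> \<le> B * (\<integral>x. B ^ r * C \<partial>M)"
      using B(1) by (intro mult_left_mono integral_mono bm_integrable bounded_measurable_abs f Suc bounded_measurable_const) auto
    finally show ?case by (simp add: mult.assoc)
  qed (use C in simp)
  have main: "\<bar>a n x * P n x - l ^ r * ?u n x * Q n x\<bar> \<le>
      D * \<bar>a n x - l ^ r * ?u n x\<bar> + \<bar>l\<bar> ^ r * C * \<bar>P n x - Q n x\<bar>" for n x
  proof -
    have "a n x * P n x - l ^ r * ?u n x * Q n x = P n x * (a n x - l ^ r * ?u n x) + l ^ r * ?u n x * (P n x - Q n x)"
      by (simp add: algebra_simps)
    then have "\<bar>a n x * P n x - l ^ r * ?u n x * Q n x\<bar> \<le>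
        \<bar>P n x\<bar> * \<bar>a n x - l ^ r * ?u n x\<bar> + \<bar>l\<bar> ^ r * \<bar>?u n x\<bar> * \<bar>P n x - Q n x\<bar>"
      using abs_add_mult_le[of "P n x * (a n x - l ^ r * ?u n x)" "l ^ r * ?u n x" "P n x - Q n x"]
      by (simp only: abs_mult power_abs)
    also have "\<dots> \<le> D * \<bar>a n x - l ^ r * ?u n x\<bar> + \<bar>l\<bar> ^ r * C * \<bar>P n x - Q n x\<bar>"
      by (intro add_mono mult_right_mono mult_left_mono D C) auto
    finally show ?thesis .
  qed
  have bound: "(\<integral>x. \<bar>a n x * P n x - l ^ r * ?u n x * Q n x\<bar> \<partial>M) \<le>
      D * (\<integral>x. \<bar>a n x - l ^ r * ?u n x\<bar> \<partial>M) + \<bar>l\<bar> ^ r * C * (\<integral>x. \<bar>P n x - Q n x\<bar> \<partial>M)" for n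
  proof -
    have 1: "bm (\<lambda>x. D * \<bar>a n x - l ^ r * ?u n x\<bar>)" "bm (\<lambda>x. \<bar>l\<bar> ^ r * C * \<bar>P n x - Q n x\<bar>)"
      by (intro bm_intros a u P Q)+
    have "(\<integral>x. \<bar>a n x * P n x - l ^ r * ?u n x * Q n x\<bar> \<partial>M) \<le>
        (\<integral>x. D * \<bar>a n x - l ^ r * ?u n x\<bar> + \<bar>l\<bar> ^ r * C * \<bar>P n x - Q n x\<bar> \<partial>M)"
      by (intro integral_mono main bm_integrable bounded_measurable_add 1) (intro bm_intros a u P Q)
    also have "\<dots> = D * (\<integral>x. \<bar>a n x - l ^ r * ?u n x\<bar> \<partial>M) + \<bar>l\<bar> ^ r * C * (\<integral>x. \<bar>P n x - Q n x\<bar> \<partial>M)"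
      using Bochner_Integration.integral_add[OF bm_integrable[OF 1(1)] bm_integrable[OF 1(2)]] by simp
    finally show ?thesis .
  qed
  have "(\<lambda>n. D * (\<integral>x. \<bar>a n x - l ^ r * ?u n x\<bar> \<partial>M) + \<bar>l\<bar> ^ r * C * (\<integral>x. \<bar>P n x - Q n x\<bar> \<partial>M))
      \<longlonglongrightarrow> D * 0 + \<bar>l\<bar> ^ r * C * 0"
    unfolding a_def by (intro tendsto_intros lim walk_unit_eigen_tendsto)
  then have z: "(\<lambda>n. D * (\<integral>x. \<bar>a n x - l ^ r * ?u n x\<bar> \<partial>M) + \<bar>l\<bar> ^ r * C * (\<integral>x. \<bar>P n x - Q n x\<bar> \<partial>M))
      \<longlonglongrightarrow> 0" by simp
  have "(\<lambda>n. \<integral>x. \<bar>a n x * P n x - l ^ r * ?u n x * Q n x\<bar> \<partial>M) \<longlonglongrightarrow> 0"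
    by (intro Lim_null_comparison[OF always_eventually z] allI) (use bound in \<open>simp only: real_norm_def
        abs_of_nonneg Bochner_Integration.integral_nonneg abs_ge_zero\<close>)
  moreover have "\<bar>a n x * P n x\<bar> \<le> B ^ r * C * D" for n x
    unfolding abs_mult using D[of n x] aB[of n x] by (intro mult_mono) (auto intro: order_trans[OF abs_ge_zero])
  then have "\<exists>D. \<forall>n x. \<bar>a n x * P n x\<bar> \<le> D" by blast
  ultimately show ?case using bounded_measurable_mult[OF a P]
    by (simp add: P_def Q_def a_def power_add mult.assoc mult.left_commute)
qed

text \<open>If \<open>u\<close> were an exact eigenfunction with \<open>\<integral> u\<^sup>2 = 1\<close>, the Schur product bound would read
  \<open>t \<ge> l\<^bsup>e\<^esup> (\<integral> u\<^bsup>s\<^esup>)\<^sup>2\<close> for \<open>s\<close> branches of total length \<open>e\<close>, and \<open>\<integral> u\<^bsup>s\<^esup> \<ge> 1\<close> for \<open>s \<ge> 2\<close>. The errors made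
  by the approximate eigenfunctions vanish in the limit.\<close>

lemma theta_integral_ge_limit:
  assumes \<Theta>: "\<forall>r\<in>#\<Theta>. r \<ge> 1" "size \<Theta> \<ge> 2"
  shows "l ^ sum_mset \<Theta> \<le> (\<integral>p. theta_kernel K \<Theta> p \<partial>M2)"
proof -
  let ?u = "walk_unit K"
  note u = bm_walk_unit
  define e where "e = sum_mset \<Theta>"
  define s where "s = size \<Theta>"
  define t where "t = (\<integral>p. theta_kernel K \<Theta> p \<partial>M2)"
  define I where "I n = (\<integral>x. (\<Prod>r\<in>#\<Theta>. (apply_kernel K ^^ r) (?u n) x) \<partial>M)" for n
  define E where "E n = (\<integral>x. \<bar>(\<Prod>r\<in>#\<Theta>. (apply_kernel K ^^ r) (?u n) x) - l ^ e * ?u n x ^ s\<bar> \<partial>M)" for n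
  define G where "G n = (\<Prod>r\<in>#\<Theta>. ip (?u n) ((apply_kernel K ^^ r) (?u n)))" for n
  have mom: "ip (?u n) ((apply_kernel K ^^ r) (?u n)) > 0" for n r
    unfolding walk_unit_moment by (intro divide_pos_pos mass_ratio(1)[OF K p])
  have l0: "l > 0"
  proof -
    have "mass K (Suc 0) \<le> l"
      by (rule LIMSEQ_le_const[OF l]) (use mass_ratio(3)[OF K p] in blast)
    then show ?thesis using p by simp
  qed
  have "E \<longlonglongrightarrow> 0" and Pb: "bm (\<lambda>x. \<Prod>r\<in>#\<Theta>. (apply_kernel K ^^ r) (?u n) x)" for n
    using walk_unit_product_tendsto[of \<Theta>] by (auto simp: E_def[abs_def] e_def s_def)
  have G: "G \<longlonglongrightarrow> l ^ e"
    unfolding G_def[abs_def] e_def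
  proof (induction \<Theta>)
    case (add r \<Theta>)
    from tendsto_mult[OF walk_unit_moment_tendsto[of r] this] show ?case by (simp add: power_add)
  qed simp
  have u1: "(\<integral>x. ?u n x ^ s \<partial>M) \<ge> 1" for n
  proof -
    have "ip (?u n) (?u n) = 1"
      using walk_unit_moment[of n 0] mass_ratio(1)[OF K p, of "2 * Suc n"] by simp
    then have sq: "(\<integral>x. (?u n x)\<^sup>2 \<partial>M) = 1" by (simp add: ip_def power2_eq_square)
    have "(\<integral>x. 1 + real s / 2 * ((?u n x)\<^sup>2 - 1) \<partial>M) \<le> (\<integral>x. ?u n x ^ s \<partial>M)"
      using \<Theta>(2) by (intro integral_mono bm_integrable bm_intros u power_ge_quadratic_tangent walk_unit_nonneg)
        (simp add: s_def)
    moreover have "(\<integral>x. 1 + real s / 2 * ((?u n x)\<^sup>2 - 1) \<partial>M) = 1 + real s / 2 * ((\<integral>x. (?u n x)\<^sup>2 \<partial>M) - 1)"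
      using u[of n] by (simp add: bm_integrable bm_intros)
    ultimately show ?thesis using sq by simp
  qed
  have I_ge: "l ^ e - E n \<le> I n" for n
  proof -
    have "l ^ e * 1 \<le> l ^ e * (\<integral>x. ?u n x ^ s \<partial>M)" using l0 u1 by (intro mult_left_mono) auto
    also have "\<dots> = (\<integral>x. l ^ e * ?u n x ^ s \<partial>M)" by simp
    also have "\<dots> \<le> (\<integral>x. (\<Prod>r\<in>#\<Theta>. (apply_kernel K ^^ r) (?u n) x) +
        \<bar>(\<Prod>r\<in>#\<Theta>. (apply_kernel K ^^ r) (?u n) x) - l ^ e * ?u n x ^ s\<bar> \<partial>M)"
      by (intro integral_mono bm_integrable bounded_measurable_add bounded_measurable_abs
          bounded_measurable_diff Pb) (intro bm_intros u, intro bm_intros u, linarith)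
    also have "\<dots> = I n + E n"
      unfolding I_def E_def
      by (intro Bochner_Integration.integral_add bm_integrable bounded_measurable_abs
          bounded_measurable_diff Pb) (intro bm_intros u)
    finally show ?thesis by simp
  qed
  have le: "(I n)\<^sup>2 \<le> t * G n" for n
    unfolding I_def t_def G_def by (rule theta_integral_ge[OF K \<Theta>(1) u mom])
  have lim: "(\<lambda>n. l ^ e - E n) \<longlonglongrightarrow> l ^ e"
    using tendsto_diff[OF tendsto_const[of "l ^ e"] \<open>E \<longlonglongrightarrow> 0\<close>] by simp
  have "eventually (\<lambda>n. (l ^ e - E n)\<^sup>2 \<le> t * G n) sequentially"
    using order_tendstoD(1)[OF lim, of 0]
  proof (rule eventually_mono)
    fix n assume "0 < l ^ e - E n"
    then have "(l ^ e - E n)\<^sup>2 \<le> (I n)\<^sup>2" using I_ge[of n] by (intro power_mono) auto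
    then show "(l ^ e - E n)\<^sup>2 \<le> t * G n" using le[of n] by simp
  qed (use l0 in simp)
  moreover have "(\<lambda>n. (l ^ e - E n)\<^sup>2) \<longlonglongrightarrow> (l ^ e)\<^sup>2" by (intro tendsto_power lim)
  moreover have "(\<lambda>n. t * G n) \<longlonglongrightarrow> t * l ^ e" by (intro tendsto_intros G)
  ultimately have "(l ^ e)\<^sup>2 \<le> t * l ^ e"
    using tendsto_le[OF trivial_limit_sequentially] by blast
  then show ?thesis using l0 by (simp add: power2_eq_square t_def e_def)
qed

end

end

section \<open>Equality for theta patterns\<close>

context full_prob_space
begin

text \<open>A single branch is covered by log-convexity of the walk moments; the eigenfunction argument needs
  \<open>u\<^bsup>s\<^esup>\<close> with \<open>s \<ge> 2\<close>.\<close>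

theorem theta_integral_ge_power:
  assumes K: "psd K" and K0: "\<And>p. K p \<ge> 0" and p: "(\<integral>p. K p \<partial>M2) > 0"
    and \<Theta>: "\<forall>r\<in>#\<Theta>. r \<ge> 1" "\<Theta> \<noteq> {#}"
  shows "(\<integral>p. K p \<partial>M2) ^ sum_mset \<Theta> \<le> (\<integral>p. theta_kernel K \<Theta> p \<partial>M2)"
proof -
  note b = sym_kernel_bm[OF psd_sym[OF K]]
  have m: "mass K (Suc 0) > 0" using p mass_1[OF b] by simp
  consider "size \<Theta> = 1" | "size \<Theta> \<ge> 2"
    using \<Theta>(2) by (metis One_nat_def Suc_1 Suc_leI less_one linorder_neqE_nat size_eq_0_iff_empty)
  then show ?thesis
  proof cases
    case 1
    then obtain r where r: "\<Theta> = {#r#}" by (metis One_nat_def size_1_singleton_mset)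
    then have "r \<ge> 1" using \<Theta>(1) by simp
    then show ?thesis using mass_power[OF b] mass_ge_power[OF K m, of r] mass_1[OF b] by (simp add: r)
  next
    case 2
    obtain l where l: "(\<lambda>n. mass K (Suc n) / mass K n) \<longlonglongrightarrow> l" "\<And>n. mass K (Suc n) / mass K n \<le> l"
      using mass_ratio_converges[OF K K0 m] by metis
    have "mass K (Suc 0) ^ sum_mset \<Theta> \<le> l ^ sum_mset \<Theta>"
      using l(2)[of 0] m by (intro power_mono) auto
    also have "\<dots> \<le> (\<integral>p. theta_kernel K \<Theta> p \<partial>M2)"
      by (rule theta_integral_ge_limit[OF K K0 m l(1) \<Theta>(1) 2])
    finally show ?thesis using mass_1[OF b] by simp
  qed
qed

text \<open>The constant sequence \<open>D\<close> is weakly null, and its pairing with \<open>D\<close> is the square of the \<open>L\<^sup>2\<close> norm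
  of \<open>D\<close>.\<close>

lemma kernel_AE_zero_of_forms:
  assumes D: "bounded_measurable M2 D"
    and z: "\<And>f g. bm f \<Longrightarrow> bm g \<Longrightarrow> ip g (apply_kernel D f) = 0"
  shows "AE p in M2. D p = 0"
proof -
  have "weakly_null (\<lambda>_. D)"
    unfolding weakly_null_def
  proof (intro conjI allI ballI)
    show "\<exists>B. \<forall>n::nat. (\<integral>p. (D p)\<^sup>2 \<partial>M2) \<le> B\<^sup>2"
      by (intro exI[of _ "sqrt (\<integral>p. (D p)\<^sup>2 \<partial>M2)"]) simp
  qed (auto simp: z D bounded_measurable_indicator)
  from weakly_null_pairing[OF this D]
  have "(\<integral>p. D p * D p \<partial>M2) = 0" by (simp add: LIMSEQ_const_iff)
  then have "AE p in M2. D p * D p = 0"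
    by (subst (asm) integral_nonneg_eq_0_iff_AE)
      (auto intro!: square.integrable_bounded_measurable bm_intros D)
  then show ?thesis by simp
qed

text \<open>When the row integrals are constant, the constant function is an eigenfunction, and every power
  splits as \<open>p\<^bsup>r\<^esup>\<close> plus a semidefinite kernel of integral zero.\<close>

context
  fixes K :: "'a \<times> 'a \<Rightarrow> real" and p :: real
  assumes K: "psd K" and p: "p > 0" and row: "AE x in M. apply_kernel K (\<lambda>_. 1) x = p"
begin

private lemma regular_bm: "bounded_measurable M2 K" by (rule sym_kernel_bm[OF psd_sym[OF K]])

lemma ip_one_funpow_regular:
  assumes f: "bm f" shows "ip (\<lambda>_. 1) ((apply_kernel K ^^ r) f) = p ^ r * integral\<^sup>L M f"
proof (induction r)
  case (Suc r)
  let ?g = "(apply_kernel K ^^ r) f"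
  have g: "bm ?g" by (intro bm_intros regular_bm f)
  have "ip (\<lambda>_. 1) (apply_kernel K ?g) = ip (apply_kernel K (\<lambda>_. 1)) ?g"
    by (rule form_sym[OF psd_sym[OF K] bm_one g])
  also have "\<dots> = (\<integral>x. p * ?g x \<partial>M)"
    unfolding ip_def
  proof (rule integral_cong_AE)
    show "(\<lambda>x. apply_kernel K (\<lambda>_. 1) x * ?g x) \<in> borel_measurable M"
      "(\<lambda>x. p * ?g x) \<in> borel_measurable M"
      by (intro bounded_measurable_measurable bm_intros regular_bm bm_one g)+
    show "AE x in M. apply_kernel K (\<lambda>_. 1) x * ?g x = p * ?g x" using row by auto
  qed
  also have "\<dots> = p * ip (\<lambda>_. 1) ?g" by (simp add: ip_def)
  finally show ?case using Suc by simp
qed (simp add: ip_def)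

lemma form_minus_const:
  assumes r: "r \<ge> 1" and f: "bm f"
  shows "ip f (apply_kernel (\<lambda>q. kernel_power K r q - p ^ r) f) =
    walk_moment K f r - p ^ r * (integral\<^sup>L M f)\<^sup>2"
proof -
  have "apply_kernel (\<lambda>_. p ^ r) f = (\<lambda>x. p ^ r * integral\<^sup>L M f)"
    by (simp add: apply_kernel_def fun_eq_iff)
  moreover have "ip f (\<lambda>x. p ^ r * integral\<^sup>L M f) = p ^ r * (integral\<^sup>L M f)\<^sup>2"
    by (simp add: ip_def power2_eq_square)
  moreover have "bm (\<lambda>x. p ^ r * integral\<^sup>L M f)" by (rule bounded_measurable_const)
  ultimately show ?thesis
    using bm_funpow_apply[OF regular_bm f, of r] f
    by (simp only: apply_kernel_diff[OF bm_kernel_power[OF regular_bm] bounded_measurable_const f]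
        apply_kernel_power[OF regular_bm f r] walk_moment_def ip_diff_right)
qed

lemma psd_minus_const:
  assumes r: "r \<ge> 1" shows "psd (\<lambda>q. kernel_power K r q - p ^ r)"
  unfolding psd_def
proof (intro conjI allI impI)
  show "sym_kernel (\<lambda>q. kernel_power K r q - p ^ r)"
    by (intro sym_kernel_diff sym_kernel_power psd_sym K sym_kernel_const)
  fix f assume f: "bm f"
  have "ip f (apply_kernel (kernel_power K r) (\<lambda>_. 1)) = p ^ r * integral\<^sup>L M f"
    using form_sym[OF psd_sym[OF psd_kernel_power[OF K r]] f bm_one] ip_one_funpow_regular[OF f, of r]
    by (simp add: apply_kernel_power[OF regular_bm f r] ip_commute[of "\<lambda>_. 1"])
  moreover have "ip (\<lambda>_. 1) (apply_kernel (kernel_power K r) (\<lambda>_. 1)) = p ^ r"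
    using ip_one_funpow_regular[OF bm_one, of r] by (simp add: apply_kernel_power[OF regular_bm bm_one r])
  moreover have "ip f (apply_kernel (kernel_power K r) f) = walk_moment K f r"
    by (simp add: apply_kernel_power[OF regular_bm f r] walk_moment_def)
  ultimately have "(p ^ r * integral\<^sup>L M f)\<^sup>2 \<le> walk_moment K f r * p ^ r"
    using psd_cauchy_schwarz[OF psd_kernel_power[OF K r] f bm_one] by simp
  then have "p ^ r * (integral\<^sup>L M f)\<^sup>2 \<le> walk_moment K f r"
    using p by (simp add: power2_eq_square mult.assoc mult.left_commute)
  then show "0 \<le> ip f (apply_kernel (\<lambda>q. kernel_power K r q - p ^ r) f)"
    unfolding form_minus_const[OF r f] by simp
qed

lemma integral_minus_const:
  assumes r: "r \<ge> 1" shows "(\<integral>q. kernel_power K r q - p ^ r \<partial>M2) = 0"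
proof -
  have "walk_moment K (\<lambda>_. 1) r = p ^ r"
    using ip_one_funpow_regular[OF bm_one, of r] by (simp add: walk_moment_def)
  then have "ip (\<lambda>_. 1) (apply_kernel (\<lambda>q. kernel_power K r q - p ^ r) (\<lambda>_. 1)) = 0"
    unfolding form_minus_const[OF r bm_one] by simp
  then show ?thesis
    using ip_one_apply_one[OF sym_kernel_bm[OF psd_sym[OF psd_minus_const[OF r]]]] by simp
qed

text \<open>All branches except two are replaced by the constants that they dominate in the Loewner order; the
  cross terms of the remaining two vanish because their semidefinite parts have integral zero.\<close>

lemma theta_integral_two_branches_le:
  assumes a: "a \<ge> 1" and k: "k \<ge> 1" and \<Theta>: "\<forall>r\<in>#\<Theta>. r \<ge> 1"
  shows "p ^ sum_mset \<Theta> * (p ^ (a + k) +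
      (\<integral>q. (kernel_power K a q - p ^ a) * (kernel_power K k q - p ^ k) \<partial>M2))
    \<le> (\<integral>q. theta_kernel K (add_mset a (add_mset k \<Theta>)) q \<partial>M2)"
proof -
  define A where "A q = kernel_power K a q - p ^ a" for q
  define B where "B q = kernel_power K k q - p ^ k" for q
  define T where "T = theta_kernel K \<Theta>"
  define c where "c = p ^ sum_mset \<Theta>"
  have A: "psd A" "(\<integral>q. A q \<partial>M2) = 0" and B: "psd B" "(\<integral>q. B q \<partial>M2) = 0"
    unfolding A_def[abs_def] B_def[abs_def] using psd_minus_const integral_minus_const a k by auto
  have "(\<Prod>r\<in>#\<Theta>. p ^ r) = c" unfolding c_def by (induction \<Theta>) (auto simp: power_add)
  moreover have "\<forall>r\<in>#\<Theta>. psd (kernel_power K r) \<and> p ^ r \<ge> 0 \<and> bm (\<lambda>_. 1) \<and>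
      psd (\<lambda>q. kernel_power K r q - p ^ r * 1 * 1)"
    using \<Theta> p psd_minus_const psd_kernel_power[OF K] bm_one by auto
  note psd_prod_minus_rank_one[OF this]
  ultimately have T: "psd T" "psd (\<lambda>q. T q - c)"
    by (simp_all add: T_def theta_kernel_def[abs_def])
  have ps: "psd (\<lambda>q. kernel_power K a q * kernel_power K k q)"
    by (intro psd_mult psd_kernel_power K a k)
  note bounds = sym_kernel_bm[OF psd_sym[OF A(1)]] sym_kernel_bm[OF psd_sym[OF B(1)]]
    sym_kernel_bm[OF psd_sym[OF T(1)]] sym_kernel_bm[OF psd_sym[OF ps]]
  have int: "integrable M2 f" if "bounded_measurable M2 f" for f
    by (rule square.integrable_bounded_measurable[OF that])
  have two: "(\<integral>q. kernel_power K a q * kernel_power K k q \<partial>M2) =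
      (\<integral>q. A q * B q \<partial>M2) + p ^ (a + k)"
  proof -
    have "kernel_power K a q * kernel_power K k q = A q * B q + (p ^ a * B q + (p ^ k * A q + p ^ (a + k)))" for q
      by (simp add: A_def B_def power_add algebra_simps)
    then have "(\<integral>q. kernel_power K a q * kernel_power K k q \<partial>M2) =
        (\<integral>q. A q * B q + (p ^ a * B q + (p ^ k * A q + p ^ (a + k))) \<partial>M2)"
      by simp
    also have "\<dots> = (\<integral>q. A q * B q \<partial>M2) + p ^ (a + k)"
      using bounds A(2) B(2) by (simp add: int bm_intros square.prob_space)
    finally show ?thesis .
  qed
  have "0 \<le> (\<integral>q. (kernel_power K a q * kernel_power K k q) * (T q - c) \<partial>M2)"
    by (intro psd_integral_nonneg psd_mult[OF ps T(2)])
  also have "\<dots> = (\<integral>q. (kernel_power K a q * kernel_power K k q) * T q - c * (kernel_power K a q * kernel_power K k q) \<partial>M2)"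
    by (simp add: algebra_simps)
  also have "\<dots> = (\<integral>q. (kernel_power K a q * kernel_power K k q) * T q \<partial>M2) -
      (\<integral>q. c * (kernel_power K a q * kernel_power K k q) \<partial>M2)"
    by (intro Bochner_Integration.integral_diff int bounded_measurable_mult[OF bounds(4) bounds(3)]
        bounded_measurable_mult[OF bounded_measurable_const bounds(4)])
  finally show ?thesis
    using two by (simp add: T_def c_def A_def B_def mult.assoc add.commute)
qed

text \<open>In the Loewner order \<open>B\<close> dominates a positive multiple of \<open>B f \<otimes> B f\<close>, and the integral of the
  Schur product of \<open>A\<close> with \<open>B f \<otimes> B f\<close> is the form of \<open>A\<close> at \<open>B f\<close>.\<close>

lemma psd_pair_form_le_0:
  assumes A: "psd A" and B: "psd B" and z: "(\<integral>q. A q * B q \<partial>M2) \<le> 0" and f: "bm f"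
  shows "ip (apply_kernel B f) (apply_kernel A (apply_kernel B f)) \<le> 0"
proof -
  define g where "g = apply_kernel B f"
  define \<beta> where "\<beta> = ip f g"
  note ab = sym_kernel_bm[OF psd_sym[OF A]] and bb = sym_kernel_bm[OF psd_sym[OF B]]
  have g: "bm g" unfolding g_def by (intro bm_intros bb f)
  have "\<beta> \<ge> 0" unfolding \<beta>_def g_def by (rule psd_form[OF B f])
  show ?thesis
  proof (cases "\<beta> = 0")
    case True
    have "(ip g g)\<^sup>2 \<le> ip g (apply_kernel B g) * ip f (apply_kernel B f)"
      using psd_cauchy_schwarz[OF B g f] by (simp flip: g_def)
    then have "ip g g = 0" using True by (simp add: \<beta>_def flip: g_def)
    then have "AE x in M. g x * g x = 0"
      unfolding ip_def by (subst (asm) integral_nonneg_eq_0_iff_AE)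
        (auto intro!: bm_integrable bm_intros g)
    then have "ip g (apply_kernel A g) = (\<integral>x. 0 \<partial>M)"
      unfolding ip_def by (intro integral_cong_AE bounded_measurable_measurable bm_intros g ab) auto
    then show ?thesis by (simp flip: g_def)
  next
    case False
    then have pos: "\<beta> > 0" using \<open>\<beta> \<ge> 0\<close> by simp
    have "psd (\<lambda>q. B q - 1 / \<beta> * g (fst q) * g (snd q))"
      using psd_minus_rank_one[OF B f] pos by (simp add: g_def \<beta>_def)
    from psd_integral_nonneg[OF psd_mult[OF A this]]
    have "0 \<le> (\<integral>q. A q * B q - 1 / \<beta> * (g (fst q) * A q * g (snd q)) \<partial>M2)"
      by (simp add: algebra_simps)
    also have "\<dots> = (\<integral>q. A q * B q \<partial>M2) - 1 / \<beta> * ip g (apply_kernel A g)"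
      unfolding form_integral[OF ab g g]
      by (subst Bochner_Integration.integral_diff)
        (intro square.integrable_bounded_measurable bm_intros ab bb g | simp only: integral_mult_right_zero)+
    finally have "1 / \<beta> * ip g (apply_kernel A g) \<le> 0" using z by linarith
    then show ?thesis using pos by (simp add: divide_le_0_iff flip: g_def)
  qed
qed

text \<open>For \<open>f\<close> of integral zero the form of \<open>K\<^bsup>a\<^esup> - p\<^bsup>a\<^esup>\<close> at \<open>K\<^bsup>k\<^esup> f\<close> is \<open>\<langle>f, K\<^bsup>a + 2k\<^esup> f\<rangle>\<close>. Once it vanishes,
  log-convexity brings the exponent down to one, and \<open>K - p\<close> has vanishing form.\<close>

lemma regular_rigidity:
  assumes a: "a \<ge> 1" and k: "k \<ge> 1"
    and z: "(\<integral>q. (kernel_power K a q - p ^ a) * (kernel_power K k q - p ^ k) \<partial>M2) \<le> 0"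
  shows "AE q in M2. K q = p"
proof -
  let ?D = "\<lambda>q. kernel_power K (Suc 0) q - p ^ Suc 0"
  have D: "psd ?D" by (rule psd_minus_const) simp
  note bD = sym_kernel_bm[OF psd_sym[OF D]]
  have centred: "walk_moment K f 1 = 0" if f: "bm f" and f0: "integral\<^sup>L M f = 0" for f
  proof -
    define B where "B q = kernel_power K k q - p ^ k" for q
    have "apply_kernel B f = (\<lambda>x. (apply_kernel K ^^ k) f x - p ^ k * integral\<^sup>L M f)"
      unfolding B_def[abs_def]
      by (simp add: apply_kernel_diff[OF bm_kernel_power[OF regular_bm] bounded_measurable_const f]
          apply_kernel_power[OF regular_bm f k]) (simp add: apply_kernel_def)
    then have Bf: "apply_kernel B f = (apply_kernel K ^^ k) f" using f0 by simp
    define g where "g = (apply_kernel K ^^ k) f"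
    have g: "bm g" unfolding g_def by (intro bm_intros regular_bm f)
    have g0: "integral\<^sup>L M g = 0"
      using ip_one_funpow_regular[OF f, of k] f0 by (simp add: g_def ip_def)
    have "ip g (apply_kernel (\<lambda>q. kernel_power K a q - p ^ a) g) \<le> 0"
      using psd_pair_form_le_0[OF psd_minus_const[OF a] psd_minus_const[OF k] z f] Bf
      by (simp add: B_def[abs_def] g_def)
    then have "walk_moment K g a \<le> 0" unfolding form_minus_const[OF a g] g0 by simp
    moreover have "walk_moment K g a = walk_moment K f (k + (a + k))"
      unfolding walk_moment_def g_def funpow_add[of a k, unfolded comp_def, THEN fun_cong, symmetric]
      by (rule ip_funpow[OF psd_sym[OF K] f f])
    ultimately have "walk_moment K f (k + (a + k)) = 0"
      using walk_moment_nonneg[OF K f, of "k + (a + k)"] by simp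
    then show ?thesis using walk_moment_zero_descends[OF K f, of "k + (a + k)"] a by simp
  qed
  have diag: "ip f (apply_kernel ?D f) = 0" if f: "bm f" for f
  proof -
    define m where "m = integral\<^sup>L M f"
    define f0 where "f0 = (\<lambda>x. f x - m * 1)"
    have f0: "bm f0" unfolding f0_def by (intro bm_intros f)
    have m1: "bm (\<lambda>_. m * 1)" by (rule bounded_measurable_const)
    have K1: "bm (apply_kernel K (\<lambda>_. 1))" and Kf: "bm (apply_kernel K f)" by (intro bm_intros regular_bm f bm_one)+
    have cross: "ip (\<lambda>_. 1) (apply_kernel K f) = p * m" "ip (\<lambda>_. 1) (apply_kernel K (\<lambda>_. 1)) = p"
      using ip_one_funpow_regular[OF f, of 1] ip_one_funpow_regular[OF bm_one, of 1] by (auto simp: m_def)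
    have cross': "ip f (apply_kernel K (\<lambda>_. 1)) = p * m"
      using form_sym[OF psd_sym[OF K] f bm_one] cross(1) by (simp add: ip_commute)
    have "integral\<^sup>L M f0 = 0" unfolding f0_def using f by (simp add: bm_integrable m_def)
    from centred[OF f0 this] have "0 = ip f0 (apply_kernel K f0)" by (simp add: walk_moment_def)
    also have "\<dots> = ip f (apply_kernel K f) - m * (p * m) - m * (p * m - m * p)"
      unfolding f0_def apply_diff[OF regular_bm f m1] apply_scale
        ip_diff_left[OF f m1 bounded_measurable_diff[OF Kf bounded_measurable_mult[OF bounded_measurable_const K1]]]
        ip_diff_right[OF Kf bounded_measurable_mult[OF bounded_measurable_const K1] f]
        ip_diff_right[OF Kf bounded_measurable_mult[OF bounded_measurable_const K1] m1]
        ip_scale_left ip_scale_right cross cross' by (simp add: algebra_simps)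
    finally have "ip f (apply_kernel K f) = p * m\<^sup>2" by (simp add: power2_eq_square algebra_simps)
    then show ?thesis
      unfolding form_minus_const[OF le_refl[of "Suc 0", folded One_nat_def] f, simplified One_nat_def]
      by (simp add: walk_moment_def m_def)
  qed
  have "AE q in M2. ?D q = 0"
  proof (rule kernel_AE_zero_of_forms[OF bD])
    fix f g assume f: "bm f" and g: "bm g"
    have "(ip g (apply_kernel ?D f))\<^sup>2 \<le> 0"
      using psd_cauchy_schwarz[OF D g f] diag[OF f] by simp
    then show "ip g (apply_kernel ?D f) = 0" by simp
  qed
  then show ?thesis by simp
qed

end

text \<open>Equality forces \<open>l\<close> to be the mean of the row integrals; as \<open>l\<close> bounds the ratio of their second
  moment to their mean, they have variance zero.\<close>

theorem theta_integral_rigidity: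
  assumes K: "psd K" and K0: "\<And>p. K p \<ge> 0" and p: "(\<integral>p. K p \<partial>M2) > 0"
    and \<Theta>: "\<forall>r\<in>#\<Theta>. r \<ge> 1" "size \<Theta> \<ge> 2"
    and eq: "(\<integral>p. theta_kernel K \<Theta> p \<partial>M2) \<le> (\<integral>p. K p \<partial>M2) ^ sum_mset \<Theta>"
  shows "AE q in M2. K q = (\<integral>p. K p \<partial>M2)"
proof -
  note b = sym_kernel_bm[OF psd_sym[OF K]]
  have one: "bm (\<lambda>_. 1)" by (rule bounded_measurable_const)
  define \<rho> where "\<rho> = (\<integral>p. K p \<partial>M2)"
  have m: "mass K (Suc 0) = \<rho>" "\<rho> > 0" using p mass_1[OF b] by (auto simp: \<rho>_def)
  then have mp: "mass K (Suc 0) > 0" by simp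
  obtain a \<Theta>1 where "\<Theta> = add_mset a \<Theta>1" using \<Theta>(2) by (cases \<Theta>) auto
  moreover obtain k \<Theta>' where "\<Theta>1 = add_mset k \<Theta>'" using \<Theta>(2) calculation by (cases \<Theta>1) auto
  ultimately have \<Theta>': "\<Theta> = add_mset a (add_mset k \<Theta>')" by simp
  then have ab: "a \<ge> 1" "k \<ge> 1" "\<forall>r\<in>#\<Theta>'. r \<ge> 1" using \<Theta>(1) by auto
  obtain l where l: "(\<lambda>n. mass K (Suc n) / mass K n) \<longlonglongrightarrow> l" "\<And>n. mass K (Suc n) / mass K n \<le> l"
    using mass_ratio_converges[OF K K0 mp] by metis
  have "l ^ sum_mset \<Theta> \<le> \<rho> ^ sum_mset \<Theta>"
    using theta_integral_ge_limit[OF K K0 mp l(1) \<Theta>] eq by (simp add: \<rho>_def)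
  moreover have "sum_mset \<Theta> > 0" using ab by (simp add: \<Theta>')
  ultimately have "l \<le> \<rho>"
    using m(2) by (metis power_less_imp_less_base less_imp_le linorder_not_less power_strict_mono)
  then have "\<rho> * l \<le> \<rho> * \<rho>" using m(2) by (intro mult_left_mono) auto
  moreover have "mass K (Suc (Suc 0)) \<le> \<rho> * l"
    using l(2)[of "Suc 0"] m by (simp add: field_simps)
  ultimately have "mass K (Suc (Suc 0)) \<le> \<rho> * \<rho>" by linarith
  \<comment> \<open>the row integrals have mean \<open>\<rho>\<close> and second moment at most \<open>\<rho>\<^sup>2\<close>, so they are constant\<close>
  define d where "d = apply_kernel K (\<lambda>_. 1)"
  have d: "bm d" unfolding d_def by (intro bm_intros b)
  have "(\<integral>x. (d x - \<rho>)\<^sup>2 \<partial>M) = (\<integral>x. d x * d x - 2 * \<rho> * d x + \<rho> * \<rho> \<partial>M)"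
    by (simp add: power2_eq_square algebra_simps)
  also have "\<dots> = ip d d - 2 * \<rho> * integral\<^sup>L M d + \<rho> * \<rho>"
    using d by (simp add: ip_def bm_integrable bm_intros)
  also have "ip d d = mass K (Suc (Suc 0))"
    using ip_funpow[OF psd_sym[OF K] one one, of 1 1] by (simp add: d_def walk_moment_def)
  also have "integral\<^sup>L M d = \<rho>" using m(1) by (simp add: d_def walk_moment_def ip_def)
  finally have "(\<integral>x. (d x - \<rho>)\<^sup>2 \<partial>M) \<le> 0" using \<open>mass K (Suc (Suc 0)) \<le> \<rho> * \<rho>\<close> by simp
  then have "(\<integral>x. (d x - \<rho>)\<^sup>2 \<partial>M) = 0"
    by (intro antisym Bochner_Integration.integral_nonneg) auto
  then have "AE x in M. (d x - \<rho>)\<^sup>2 = 0"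
    by (subst (asm) integral_nonneg_eq_0_iff_AE) (auto intro!: bm_integrable bm_intros d)
  then have row: "AE x in M. apply_kernel K (\<lambda>_. 1) x = \<rho>" by (simp add: d_def)
  define I where "I = (\<integral>q. (kernel_power K a q - \<rho> ^ a) * (kernel_power K k q - \<rho> ^ k) \<partial>M2)"
  have "\<rho> ^ sum_mset \<Theta>' * (\<rho> ^ (a + k) + I) \<le> \<rho> ^ sum_mset \<Theta>"
    using theta_integral_two_branches_le[OF K m(2) row ab] eq unfolding \<Theta>' I_def \<rho>_def by simp
  also have "\<dots> = \<rho> ^ sum_mset \<Theta>' * \<rho> ^ (a + k)" by (simp add: \<Theta>' power_add ac_simps)
  finally have "I \<le> 0"
    using zero_less_power[OF m(2), of "sum_mset \<Theta>'"] by (auto simp: distrib_left mult_le_0_iff)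
  then show ?thesis using regular_rigidity[OF K m(2) row ab(1,2)] by (simp add: I_def \<rho>_def)
qed

end

section \<open>Integrating out the branches\<close>

text \<open>The edge, the length, and a number telling apart the branches of that length on that edge.\<close>

type_synonym branch = "nat set \<times> nat \<times> nat"

fun branch_internal :: "branch \<Rightarrow> vertex set" where
  "branch_internal (e, r, k) = Internal e r k ` {1..r - 1}"

fun branch_product :: "(('a \<times> 'a) \<Rightarrow> real) \<Rightarrow> branch \<Rightarrow> (vertex \<Rightarrow> 'a) \<Rightarrow> real" where
  "branch_product K (e, r, k) x =
     (\<Prod>p<r. K (x (branch_vertex e r k p), x (branch_vertex e r k (p + 1))))"

lemma finite_branch_internal: "finite (branch_internal b)"
  by (cases b) simp

definition branches :: "nat set set \<Rightarrow> (nat set \<Rightarrow> nat multiset) \<Rightarrow> branch set" where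
  "branches E P = (SIGMA e:E. SIGMA r:set_mset (P e). {..<count (P e) r})"

lemma finite_branches: "finite E \<Longrightarrow> finite (branches E P)"
  by (auto simp: branches_def)

lemma vertices_replace_edges:
  "vertices (replace_edges h E P) = Root ` {1..h} \<union> (\<Union>b\<in>branches E P. branch_internal b)"
proof -
  have "{Internal e r k p |e r k p. e \<in> E \<and> k < count (P e) r \<and> 0 < p \<and> p < r} =
      (\<Union>b\<in>branches E P. branch_internal b)" (is "?A = ?B")
  proof (intro equalityI subsetI)
    fix v assume "v \<in> ?A"
    then obtain e r k p where v: "v = Internal e r k p" "e \<in> E" "k < count (P e) r" "0 < p" "p < r" by blast
    have "r \<in># P e" using v(3) by (metis not_less_zero not_in_iff)
    then have "(e, r, k) \<in> branches E P" using v by (auto simp: branches_def)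
    moreover have "v \<in> branch_internal (e, r, k)" using v by auto
    ultimately show "v \<in> ?B" by blast
  qed (auto simp: branches_def)
  then show ?thesis by (simp add: replace_edges_def)
qed

lemma edges_replace_edges:
  "edges (replace_edges h E P) = (\<lambda>((e, r, k), p). (e, r, k, p)) ` (SIGMA b:branches E P. {..<fst (snd b)})"
proof (intro equalityI subsetI)
  fix d assume "d \<in> edges (replace_edges h E P)"
  then obtain e r k p where d: "d = (e, r, k, p)" "e \<in> E" "k < count (P e) r" "p < r"
    by (auto simp: replace_edges_def)
  have "r \<in># P e" using d(3) by (metis not_less_zero not_in_iff)
  then have "((e, r, k), p) \<in> (SIGMA b:branches E P. {..<fst (snd b)})"
    using d by (auto simp: branches_def)
  then show "d \<in> (\<lambda>((e, r, k), p). (e, r, k, p)) ` (SIGMA b:branches E P. {..<fst (snd b)})"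
    using d(1) by (force intro: rev_image_eqI)
qed (auto simp: replace_edges_def branches_def)

lemma prod_edges_replace_edges:
  assumes "finite E"
  shows "(\<Prod>d\<in>edges (replace_edges h E P). K (x (fst (ends (replace_edges h E P) d)),
      x (snd (ends (replace_edges h E P) d)))) = (\<Prod>b\<in>branches E P. branch_product K b x)"
proof -
  let ?S = "SIGMA b:branches E P. {..<fst (snd b)}"
  have inj: "inj_on (\<lambda>((e, r, k), p). (e, r, k, p)) ?S" by (auto simp: inj_on_def)
  have "(\<Prod>b\<in>branches E P. branch_product K b x) =
      (\<Prod>b\<in>branches E P. \<Prod>p\<in>{..<fst (snd b)}. (case (b, p) of ((e, r, k), p) \<Rightarrow>
        K (x (branch_vertex e r k p), x (branch_vertex e r k (p + 1)))))"
    by (intro prod.cong) (auto split: prod.splits)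
  also have "\<dots> = (\<Prod>(b, p)\<in>?S. (case (b, p) of ((e, r, k), p) \<Rightarrow>
        K (x (branch_vertex e r k p), x (branch_vertex e r k (p + 1)))))"
    by (rule prod.Sigma) (auto simp: finite_branches assms)
  also have "\<dots> = (\<Prod>d\<in>edges (replace_edges h E P). K (x (fst (ends (replace_edges h E P) d)),
      x (snd (ends (replace_edges h E P) d))))"
    unfolding edges_replace_edges prod.reindex[OF inj]
    by (intro prod.cong) (auto simp: replace_edges_def)
  finally show ?thesis by simp
qed

lemma sum_mset_eq_sum_count:
  fixes A :: "nat multiset"
  assumes "finite S" "set_mset A \<subseteq> S"
  shows "sum_mset A = (\<Sum>r\<in>S. count A r * r)"
  using assms(2)
proof (induction A)
  case (add a A)
  have "(\<Sum>r\<in>S. count (add_mset a A) r * r) = (\<Sum>r\<in>S. count A r * r + (if r = a then r else 0))"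
    by (intro sum.cong) auto
  then show ?case using add assms(1) by (simp add: sum.distrib)
qed simp

lemma num_edges_replace_edges:
  assumes "finite E"
  shows "num_edges (replace_edges h E P) = (\<Sum>e\<in>E. sum_mset (P e))"
proof -
  let ?S = "SIGMA b:branches E P. {..<fst (snd b)}"
  have inj: "inj_on (\<lambda>((e, r, k), p). (e, r, k, p)) ?S" by (auto simp: inj_on_def)
  have "num_edges (replace_edges h E P) = card ?S"
    unfolding num_edges_def edges_replace_edges by (rule card_image[OF inj])
  also have "\<dots> = (\<Sum>b\<in>branches E P. fst (snd b))"
    by (subst card_SigmaI) (auto simp: finite_branches assms)
  also have "\<dots> = (\<Sum>e\<in>E. \<Sum>q\<in>(SIGMA r:set_mset (P e). {..<count (P e) r}). fst q)"
    unfolding branches_def using assms by (subst sum.Sigma) (auto simp: case_prod_beta')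
  also have "\<dots> = (\<Sum>e\<in>E. \<Sum>r\<in>set_mset (P e). \<Sum>k<count (P e) r. r)"
    by (intro sum.cong refl, subst sum.Sigma) (auto simp: case_prod_beta')
  also have "\<dots> = (\<Sum>e\<in>E. sum_mset (P e))"
    by (simp add: sum_mset_eq_sum_count[OF finite_set_mset subset_refl])
  finally show ?thesis .
qed

context full_prob_space
begin

lemma kernel_power_Suc_apply:
  "kernel_power K (Suc n) (u, v) = (apply_kernel K ^^ n) (\<lambda>z. K (z, v)) u"
proof -
  have "(comp_kernel K ^^ n) K (u, v) = (apply_kernel K ^^ n) (\<lambda>z. K (z, v)) u" for u
    by (induction n arbitrary: u) (simp_all add: comp_kernel_apply)
  then show ?thesis by (simp add: kernel_power_def)
qed

text \<open>Integrating over the inner vertices of a path, starting from the far end, iterates the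
  operator of \<open>K\<close>.\<close>

lemma path_integral:
  fixes q :: "nat \<Rightarrow> 'v" and u :: 'a
  assumes K: "bounded_measurable M2 K" and q: "inj q" and \<phi>: "bm \<phi>"
  defines "z \<equiv> \<lambda>y p. if p = 0 then u else y (q p)"
  shows "(\<integral>y. (\<Prod>p<n. K (z y p, z y (p + 1))) * \<phi> (z y n) \<partial>cube (q ` {1..n})) =
    (apply_kernel K ^^ n) \<phi> u"
  using \<phi>
proof (induction n arbitrary: \<phi>)
  case 0
  interpret P: prob_space "cube (q ` {1..0::nat})" by (rule prob_space_cube)
  show ?case using P.prob_space by (simp add: z_def)
next
  case (Suc n)
  let ?J = "q ` {1..n}"
  have "{1..Suc n} = insert (Suc n) {1..n}" by auto
  then have ins: "q ` {1..Suc n} = insert (q (Suc n)) ?J" by (simp only: image_insert)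
  have fresh: "q (Suc n) \<notin> ?J" using q by (auto dest: injD)
  let ?f = "\<lambda>y. (\<Prod>p<Suc n. K (z y p, z y (p + 1))) * \<phi> (z y (Suc n))"
  have zm: "(\<lambda>y. z y p) \<in> cube (q ` {1..Suc n}) \<rightarrow>\<^sub>M M" if "p \<le> Suc n" for p
  proof (cases "p = 0")
    case False
    then have "q p \<in> q ` {1..Suc n}" using that by auto
    then show ?thesis using False by (simp add: z_def)
  qed (simp add: z_def)
  have f: "bounded_measurable (cube (q ` {1..Suc n})) ?f"
    by (intro bounded_measurable_mult bounded_measurable_prod bounded_measurable_compose[OF K]
        bounded_measurable_compose[OF Suc.prems] measurable_Pair zm) auto
  have "integral\<^sup>L (cube (q ` {1..Suc n})) ?f =
      (\<integral>y. \<integral>w. ?f (y(q (Suc n) := w)) \<partial>M \<partial>cube ?J)"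
    unfolding ins by (rule integral_cube_insert(1)) (use f fresh ins in auto)
  also have "\<dots> = (\<integral>y. (\<Prod>p<n. K (z y p, z y (p + 1))) * apply_kernel K \<phi> (z y n) \<partial>cube ?J)"
  proof (intro Bochner_Integration.integral_cong refl)
    fix y
    have z': "z (y(q (Suc n) := w)) p = z y p" if "p \<le> n" for w p
      using that q by (auto simp: z_def dest: injD)
    have "?f (y(q (Suc n) := w)) = (\<Prod>p<n. K (z y p, z y (p + 1))) * (K (z y n, w) * \<phi> w)" for w
    proof -
      have "(\<Prod>p<n. K (z (y(q (Suc n) := w)) p, z (y(q (Suc n) := w)) (p + 1))) =
          (\<Prod>p<n. K (z y p, z y (p + 1)))"
        by (intro prod.cong) (auto simp: z')
      moreover have "z (y(q (Suc n) := w)) (Suc n) = w" by (simp add: z_def)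
      ultimately show ?thesis using z'[of n w] by simp
    qed
    then show "(\<integral>w. ?f (y(q (Suc n) := w)) \<partial>M) =
        (\<Prod>p<n. K (z y p, z y (p + 1))) * apply_kernel K \<phi> (z y n)"
      by (simp only: apply_kernel_def integral_mult_right_zero)
  qed
  also have "\<dots> = (apply_kernel K ^^ Suc n) \<phi> u"
    unfolding Suc.IH[OF bm_apply[OF K Suc.prems]] funpow_Suc_right comp_def ..
  finally show ?case .
qed

fun branch_kernel :: "('a \<times> 'a \<Rightarrow> real) \<Rightarrow> branch \<Rightarrow> (vertex \<Rightarrow> 'a) \<Rightarrow> real" where
  "branch_kernel K (e, r, k) x = kernel_power K r (x (Root (Min e)), x (Root (Max e)))"

text \<open>The last edge of the branch supplies the function \<open>K(\<cdot>, v)\<close> to which the iterated operator is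
  applied.\<close>

lemma branch_integral:
  assumes K: "bounded_measurable M2 K" and r: "r \<ge> 1"
    and V: "branch_internal (e, r, k) \<inter> V = {}" "Root (Min e) \<in> V" "Root (Max e) \<in> V"
  shows "(\<integral>y. branch_product K (e, r, k) (merge V (branch_internal (e, r, k)) (x, y))
    \<partial>cube (branch_internal (e, r, k))) = branch_kernel K (e, r, k) x"
proof -
  obtain n where n: "r = Suc n" using r by (cases r) auto
  let ?q = "Internal e r k" and ?u = "x (Root (Min e))" and ?v = "x (Root (Max e))"
  let ?J = "branch_internal (e, r, k)"
  have J: "?J = ?q ` {1..n}" by (simp add: n)
  let ?z = "\<lambda>y p. if p = 0 then ?u else y (?q p)"
  have at: "merge V ?J (x, y) (branch_vertex e r k p) = (if p = r then ?v else ?z y p)"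
    if "p \<le> r" for y p
  proof (cases "p = 0 \<or> p = r")
    case True
    then show ?thesis using V r by (auto simp: branch_vertex_def merge_def)
  next
    case False
    then have "?q p \<in> ?J" using that by auto
    moreover from this have "?q p \<notin> V" using V by blast
    ultimately show ?thesis using False by (simp add: branch_vertex_def merge_def del: branch_internal.simps)
  qed
  have "branch_product K (e, r, k) (merge V ?J (x, y)) =
      (\<Prod>p<n. K (?z y p, ?z y (p + 1))) * K (?z y n, ?v)" for y
  proof -
    have "branch_product K (e, r, k) (merge V ?J (x, y)) =
        (\<Prod>p<Suc n. K (if p = r then ?v else ?z y p, if p + 1 = r then ?v else ?z y (p + 1)))"
      unfolding branch_product.simps n
      by (intro prod.cong refl) (use at[of _ y] in \<open>simp add: n del: branch_internal.simps\<close>)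
    also have "\<dots> = (\<Prod>p<n. K (?z y p, ?z y (p + 1))) * K (?z y n, ?v)"
      unfolding prod.lessThan_Suc by (intro arg_cong2[where f="(*)"] prod.cong) (auto simp: n)
    finally show ?thesis .
  qed
  then have "(\<integral>y. branch_product K (e, r, k) (merge V ?J (x, y)) \<partial>cube ?J) =
      (\<integral>y. (\<Prod>p<n. K (?z y p, ?z y (p + 1))) * K (?z y n, ?v) \<partial>cube ?J)"
    by (simp only:)
  also have "\<dots> = (apply_kernel K ^^ n) (\<lambda>z. K (z, ?v)) ?u"
    unfolding J by (rule path_integral[OF K _ bm_section(2)[OF K]]) (simp add: inj_on_def)
  also have "\<dots> = branch_kernel K (e, r, k) x" by (simp add: n kernel_power_Suc_apply)
  finally show ?thesis .
qed

lemma integral_cube_union: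
  assumes "finite I" "finite J" "I \<inter> J = {}" "bounded_measurable (cube (I \<union> J)) f"
  shows "integral\<^sup>L (cube (I \<union> J)) f = (\<integral>x. \<integral>y. f (merge I J (x, y)) \<partial>cube J \<partial>cube I)"
  using assms by (intro PM.product_integral_fold integrable_cube)

text \<open>The factor \<open>G\<close>, which depends on the roots only, collects the kernels of the branches that have been
  integrated out.\<close>

lemma branches_integral:
  fixes R :: "vertex set"
  assumes K: "bounded_measurable M2 K" and R: "R = Root ` I" "finite I"
    and S: "finite S" "\<And>e r k. (e, r, k) \<in> S \<Longrightarrow> r \<ge> 1 \<and> Min e \<in> I \<and> Max e \<in> I"
    and G: "\<And>x y. (\<And>i. i \<in> R \<Longrightarrow> x i = y i) \<Longrightarrow> G x = G y"
      "\<And>V. R \<subseteq> V \<Longrightarrow> bounded_measurable (cube V) G"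
  shows "(\<integral>x. (\<Prod>b\<in>S. branch_product K b x) * G x \<partial>cube (R \<union> (\<Union>b\<in>S. branch_internal b))) =
    (\<integral>x. (\<Prod>b\<in>S. branch_kernel K b x) * G x \<partial>cube R)"
  using S G
proof (induction S arbitrary: G rule: finite_induct)
  case empty
  show ?case by simp
next
  case (insert b S)
  obtain e r k where b: "b = (e, r, k)" by (cases b)
  let ?V = "R \<union> (\<Union>b\<in>S. branch_internal b)"
  let ?J = "branch_internal b"
  have rI: "r \<ge> 1" "Min e \<in> I" "Max e \<in> I" using insert.prems(1)[of e r k] b by auto
  have fin: "finite ?V" "finite ?J" using R insert.hyps by (simp_all add: finite_branch_internal)
  have disj: "?J \<inter> ?V = {}"
  proof -
    have "branch_internal b \<inter> branch_internal b' = {}" if "b' \<in> S" for b'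
      using that insert.hyps(2) by (cases b') (auto simp: b)
    moreover have "branch_internal b \<inter> R = {}" by (auto simp: b R)
    ultimately show ?thesis by blast
  qed
  have V: "R \<union> (\<Union>b\<in>insert b S. branch_internal b) = ?V \<union> ?J" by auto
  have in_V: "branch_vertex e' r' k' p \<in> W"
    if "(e', r', k') \<in> insert b S" "p \<le> r'" "R \<union> branch_internal (e', r', k') \<subseteq> W" for e' r' k' p W
    using that insert.prems(1)[OF that(1)] R by (auto simp: branch_vertex_def)
  have bp: "bounded_measurable (cube W) (branch_product K b')"
    if "b' \<in> insert b S" "R \<union> branch_internal b' \<subseteq> W" for b' W
  proof -
    obtain e' r' k' where b': "b' = (e', r', k')" by (cases b')
    have "branch_vertex e' r' k' p \<in> W" if "p \<le> r'" for p
      using \<open>b' \<in> insert b S\<close> \<open>R \<union> branch_internal b' \<subseteq> W\<close> that unfolding b' by (intro in_V)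
    then show ?thesis unfolding b' branch_product.simps
      by (intro bounded_measurable_prod bm_coord_pair[OF K]) simp_all
  qed
  let ?f = "\<lambda>x. (\<Prod>b\<in>insert b S. branch_product K b x) * G x"
  have f: "bounded_measurable (cube (?V \<union> ?J)) ?f"
    by (intro bounded_measurable_mult bounded_measurable_prod bp insert.prems(3)) auto
  have "integral\<^sup>L (cube (R \<union> (\<Union>b\<in>insert b S. branch_internal b))) ?f =
      (\<integral>x. \<integral>y. ?f (merge ?V ?J (x, y)) \<partial>cube ?J \<partial>cube ?V)"
    unfolding V by (rule integral_cube_union[OF fin _ f]) (use disj in blast)
  also have "\<dots> = (\<integral>x. (\<Prod>b\<in>S. branch_product K b x) * (branch_kernel K b x * G x) \<partial>cube ?V)"
  proof (intro Bochner_Integration.integral_cong refl)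
    fix x
    have "?f (merge ?V ?J (x, y)) = ((\<Prod>b\<in>S. branch_product K b x) * G x) * branch_product K b (merge ?V ?J (x, y))" for y
    proof -
      have at: "merge ?V ?J (x, y) i = x i" if "i \<in> ?V" for i
        using that by (simp add: merge_def)
      have "branch_product K b' (merge ?V ?J (x, y)) = branch_product K b' x" if b'S: "b' \<in> S" for b'
      proof -
        obtain e' r' k' where b': "b' = (e', r', k')" by (cases b')
        have "branch_vertex e' r' k' p \<in> ?V" if "p \<le> r'" for p
        proof (rule in_V[OF _ that])
          show "(e', r', k') \<in> insert b S" using b'S by (simp add: b')
          show "R \<union> branch_internal (e', r', k') \<subseteq> ?V" using b'S unfolding b' by blast
        qed
        then show ?thesis unfolding b' branch_product.simps by (intro prod.cong refl) (simp add: at)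
      qed
      moreover have "G (merge ?V ?J (x, y)) = G x" by (rule insert.prems(2)) (simp add: at)
      ultimately show ?thesis by (simp add: prod.insert[OF insert.hyps] ac_simps cong: prod.cong del: Un_iff UN_iff)
    qed
    moreover have "(\<integral>y. branch_product K b (merge ?V ?J (x, y)) \<partial>cube ?J) = branch_kernel K b x"
      unfolding b by (rule branch_integral[OF K rI(1)]) (use disj rI R b in auto)
    ultimately show "(\<integral>y. ?f (merge ?V ?J (x, y)) \<partial>cube ?J) =
        (\<Prod>b\<in>S. branch_product K b x) * (branch_kernel K b x * G x)"
      by (simp only: integral_mult_right_zero) (simp only: ac_simps)
  qed
  also have "\<dots> = (\<integral>x. (\<Prod>b\<in>S. branch_kernel K b x) * (branch_kernel K b x * G x) \<partial>cube R)"
  proof (rule insert.IH)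
    show "r \<ge> 1 \<and> Min e \<in> I \<and> Max e \<in> I" if "(e, r, k) \<in> S" for e r k
      using insert.prems(1) that by blast
    show "branch_kernel K b x * G x = branch_kernel K b y * G y" if "\<And>i. i \<in> R \<Longrightarrow> x i = y i" for x y
      using insert.prems(2)[OF that] that[of "Root (Min e)"] that[of "Root (Max e)"] rI
      by (simp add: b R)
    show "bounded_measurable (cube V) (\<lambda>x. branch_kernel K b x * G x)" if "R \<subseteq> V" for V
      unfolding b branch_kernel.simps using that rI R
      by (intro bounded_measurable_mult insert.prems(3) bm_coord_pair bm_kernel_power K) auto
  qed
  also have "\<dots> = (\<integral>x. (\<Prod>b\<in>insert b S. branch_kernel K b x) * G x \<partial>cube R)"
    by (simp only: prod.insert[OF insert.hyps] ac_simps)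
  finally show ?case .
qed

lemma integral_cube_reindex:
  assumes f: "inj_on f I" "f ` I \<subseteq> J" and g: "bounded_measurable (cube I) g"
  shows "(\<integral>x. g (\<lambda>i\<in>I. x (f i)) \<partial>cube J) = integral\<^sup>L (cube I) g"
proof -
  have d: "distr (cube J) (cube I) (\<lambda>x. \<lambda>i\<in>I. x (f i)) = cube I"
    using f by (intro distr_PiM_reindex) (auto intro: prob_space_axioms)
  have "(\<lambda>x. \<lambda>i\<in>I. x (f i)) \<in> cube J \<rightarrow>\<^sub>M cube I"
    using f by (intro measurable_restrict) auto
  from integral_distr[OF this, of g] show ?thesis
    using g d by (simp add: bounded_measurable_def)
qed

end

section \<open>Symmetrisation over relabellings\<close>

lemma card_nsets_2: "card (nsets {1..h::nat} 2) = h choose 2"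
proof -
  have "nsets {1..h} 2 = {B. B \<subseteq> {1..h} \<and> card B = 2}"
    using finite_subset[of _ "{1..h}"] by (auto simp: nsets_def)
  then show ?thesis using n_subsets[of "{1..h}" 2] by simp
qed

lemma permutes_image_nsets:
  assumes "\<sigma> permutes {1..h::nat}"
  shows "bij_betw ((`) \<sigma>) (nsets {1..h} 2) (nsets {1..h} 2)"
proof -
  have inj: "inj \<sigma>" by (rule permutes_inj[OF assms])
  have "\<sigma> ` e \<in> nsets {1..h} 2" if "e \<in> nsets {1..h} 2" for e
  proof -
    have "\<sigma> ` e \<subseteq> {1..h}" using that permutes_image[OF assms] by (auto simp: nsets_def)
    then show ?thesis using that inj by (auto simp: nsets_def card_image inj_on_subset)
  qed
  then have "(`) \<sigma> ` nsets {1..h} 2 \<subseteq> nsets {1..h} 2" by blast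
  moreover have "inj_on ((`) \<sigma>) (nsets {1..h} 2)"
    by (auto simp: inj_on_def inj_image_eq_iff[OF inj])
  ultimately show ?thesis
    using endo_inj_surj[OF finite_nsets_2] by (auto simp: bij_betw_def)
qed

lemma permutation_between_pairs:
  assumes "e \<in> nsets {1..h::nat} 2" "e' \<in> nsets {1..h} 2"
  obtains \<tau> where "\<tau> permutes {1..h}" "\<tau> ` e = e'"
proof -
  obtain a b where e: "e = {a, b}" "a \<noteq> b" using assms(1) by (auto simp: nsets_def card_2_iff)
  obtain c d where e': "e' = {c, d}" "c \<noteq> d" using assms(2) by (auto simp: nsets_def card_2_iff)
  have mem: "a \<in> {1..h}" "b \<in> {1..h}" "c \<in> {1..h}" "d \<in> {1..h}"
    using assms e e' by (auto simp: nsets_def)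
  define b' where "b' = Transposition.transpose a c b"
  have b': "b' \<in> {1..h}" "b' \<noteq> c"
    using mem e(2) by (auto simp: b'_def Transposition.transpose_def)
  define \<tau> where "\<tau> = Transposition.transpose b' d \<circ> Transposition.transpose a c"
  have "\<tau> permutes {1..h}"
    unfolding \<tau>_def by (intro permutes_compose permutes_swap_id mem b')
  moreover have "\<tau> a = c" "\<tau> b = d"
    using b'(2) e'(2) by (auto simp: \<tau>_def Transposition.transpose_def b'_def[symmetric])
      (auto simp: b'_def Transposition.transpose_def split: if_splits)
  then have "\<tau> ` e = e'" by (simp add: e e')
  ultimately show ?thesis by (rule that)
qed

definition orbit_pattern :: "nat \<Rightarrow> (nat set \<Rightarrow> nat multiset) \<Rightarrow> nat set \<Rightarrow> nat multiset" where
  "orbit_pattern h A e = (\<Sum>\<sigma> | \<sigma> permutes {1..h}. A (\<sigma> ` e))"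

text \<open>Permutations act transitively on pairs, so the collected pattern is the same at every pair, and
  summing it over all pairs determines it.\<close>

lemma count_orbit_pattern:
  assumes e: "e \<in> nsets {1..h} 2"
  shows "(h choose 2) * count (orbit_pattern h A e) r =
    fact h * count (\<Sum>e\<in>nsets {1..h} 2. A e) r"
proof -
  let ?N = "nsets {1..h} 2"
  have same: "orbit_pattern h A e' = orbit_pattern h A e" if "e' \<in> ?N" for e'
  proof -
    obtain \<tau> where \<tau>: "\<tau> permutes {1..h}" "\<tau> ` e = e'" using permutation_between_pairs[OF e \<open>e' \<in> ?N\<close>] .
    have "orbit_pattern h A e = (\<Sum>\<sigma> | \<sigma> permutes {1..h}. A ((\<sigma> \<circ> \<tau>) ` e))"
      unfolding orbit_pattern_def by (rule sum_permutations_compose_right[OF \<tau>(1)])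
    then show ?thesis by (simp only: orbit_pattern_def image_comp[symmetric] \<tau>(2))
  qed
  have "(\<Sum>e\<in>?N. orbit_pattern h A e) = (\<Sum>\<sigma> | \<sigma> permutes {1..h}. \<Sum>e\<in>?N. A (\<sigma> ` e))"
    unfolding orbit_pattern_def by (rule sum.swap)
  also have "\<dots> = (\<Sum>\<sigma> | \<sigma> permutes {1..h}. \<Sum>e\<in>?N. A e)"
    by (intro sum.cong refl sum.reindex_bij_betw permutes_image_nsets) auto
  finally have "count (\<Sum>e\<in>?N. orbit_pattern h A e) r = fact h * count (\<Sum>e\<in>?N. A e) r"
    by (simp add: count_sum card_permutations)
  moreover have "(\<Sum>e\<in>?N. orbit_pattern h A e) = (\<Sum>e'\<in>?N. orbit_pattern h A e)"
    by (intro sum.cong refl same)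
  then have "count (\<Sum>e\<in>?N. orbit_pattern h A e) r = card ?N * count (orbit_pattern h A e) r"
    by (simp only:) (simp add: count_sum)
  ultimately show ?thesis by (simp only: card_nsets_2)
qed

text \<open>The inequality of arithmetic and geometric means, from \<open>x \<le> exp (x - 1)\<close> at the ratios of the
  numbers to their mean.\<close>

lemma prod_le_mean_power:
  fixes a :: "'i \<Rightarrow> real"
  assumes "finite S" "S \<noteq> {}" "\<And>i. i \<in> S \<Longrightarrow> a i \<ge> 0"
  shows "(\<Prod>i\<in>S. a i) \<le> ((\<Sum>i\<in>S. a i) / card S) ^ card S"
proof -
  define m where "m = (\<Sum>i\<in>S. a i) / card S"
  have n: "card S > 0" using assms by (simp add: card_gt_0_iff)
  have m0: "m \<ge> 0" using assms by (auto simp: m_def intro!: divide_nonneg_nonneg sum_nonneg)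
  show ?thesis
  proof (cases "m = 0")
    case True
    then have "(\<Sum>i\<in>S. a i) = 0" using n by (simp add: m_def)
    then have "\<forall>i\<in>S. a i = 0" using assms by (subst (asm) sum_nonneg_eq_0_iff) auto
    then show ?thesis using assms n m0 by (simp add: m_def[symmetric] True power_0_left)
  next
    case False
    then have m: "m > 0" using m0 by simp
    have "(\<Prod>i\<in>S. a i / m) \<le> (\<Prod>i\<in>S. exp (a i / m - 1))"
    proof (rule prod_mono)
      fix i assume "i \<in> S"
      then show "0 \<le> a i / m \<and> a i / m \<le> exp (a i / m - 1)"
        using assms(3) m exp_ge_add_one_self[of "a i / m - 1"] by auto
    qed
    also have "\<dots> = exp ((\<Sum>i\<in>S. a i) / m - card S)"
      using assms(1) by (simp add: sum_subtractf sum_divide_distrib flip: exp_sum)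
    also have "(\<Sum>i\<in>S. a i) / m - card S = 0"
    proof -
      have "(\<Sum>i\<in>S. a i) = m * card S" using n by (simp add: m_def)
      then show ?thesis using m by simp
    qed
    finally have "(\<Prod>i\<in>S. a i) / m ^ card S \<le> 1" by (simp add: prod_dividef)
    then show ?thesis using m by (simp add: m_def[symmetric] divide_le_eq)
  qed
qed

context full_prob_space
begin

lemma theta_kernel_union: "theta_kernel K (A + B) p = theta_kernel K A p * theta_kernel K B p"
  by (simp add: theta_kernel_def)

lemma theta_kernel_sum:
  "theta_kernel K (\<Sum>i\<in>I. A i) p = (\<Prod>i\<in>I. theta_kernel K (A i) p)"
  by (induction I rule: infinite_finite_induct) (simp_all add: theta_kernel_union)

lemma theta_kernel_repeat: "theta_kernel K (repeat_mset n A) p = theta_kernel K A p ^ n"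
  by (induction n) (simp_all add: theta_kernel_union)

lemma theta_kernel_replicate: "theta_kernel K (replicate_mset n r) p = kernel_power K r p ^ n"
  by (simp add: theta_kernel_def)

lemma theta_kernel_count:
  "theta_kernel K \<Theta> p = (\<Prod>r\<in>set_mset \<Theta>. kernel_power K r p ^ count \<Theta> r)"
  by (simp add: theta_kernel_def image_prod_mset_multiplicity)

lemma sym_kernel_theta:
  assumes "sym_kernel K" shows "sym_kernel (theta_kernel K \<Theta>)"
  by (induction \<Theta>) (auto intro: sym_kernel_mult sym_kernel_power assms simp: sym_kernel_const)

definition pattern_product :: "('a \<times> 'a \<Rightarrow> real) \<Rightarrow> nat \<Rightarrow> (nat set \<Rightarrow> nat multiset) \<Rightarrow> (nat \<Rightarrow> 'a) \<Rightarrow> real" where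
  "pattern_product K h A x = (\<Prod>e\<in>nsets {1..h} 2. theta_kernel K (A e) (x (Min e), x (Max e)))"

definition pattern_density :: "('a \<times> 'a \<Rightarrow> real) \<Rightarrow> nat \<Rightarrow> (nat set \<Rightarrow> nat multiset) \<Rightarrow> real" where
  "pattern_density K h A = integral\<^sup>L (cube {1..h}) (pattern_product K h A)"

lemma bm_pattern_product:
  assumes "sym_kernel K" shows "bounded_measurable (cube {1..h}) (pattern_product K h A)"
  unfolding pattern_product_def[abs_def]
  using nsets_2_Min_Max by (intro bounded_measurable_prod bm_coord_pair sym_kernel_bm sym_kernel_theta assms) auto

lemma pattern_product_nonneg:
  assumes "\<And>p. K p \<ge> 0" shows "pattern_product K h A x \<ge> 0"
  unfolding pattern_product_def by (intro prod_nonneg theta_kernel_nonneg assms)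

text \<open>Each branch integrates to a power of \<open>K\<close> at its roots, and the powers along one edge multiply
  to the kernel of its theta pattern.\<close>

lemma replace_edges_density:
  assumes K: "sym_kernel K" and E: "E \<subseteq> nsets {1..h} 2" and P: "\<forall>e\<in>E. theta_pattern (P e)"
  shows "(\<integral>x. (\<Prod>d\<in>edges (replace_edges h E P). K (x (fst (ends (replace_edges h E P) d)),
      x (snd (ends (replace_edges h E P) d)))) \<partial>cube (vertices (replace_edges h E P))) =
    pattern_density K h (\<lambda>e. if e \<in> E then P e else {#})"
proof -
  let ?A = "\<lambda>e. if e \<in> E then P e else {#}"
  let ?R = "Root ` {1..h}"
  note b = sym_kernel_bm[OF K]
  have fin: "finite E" using E finite_nsets_2 finite_subset by blast
  have valid: "r \<ge> 1 \<and> Min e \<in> {1..h} \<and> Max e \<in> {1..h}" if "(e, r, k) \<in> branches E P" for e r k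
    using that P E nsets_2_Min_Max[of e h] by (auto simp: branches_def theta_pattern_def)
  have prod: "(\<Prod>b\<in>branches E P. branch_kernel K b x) =
      pattern_product K h ?A (\<lambda>i\<in>{1..h}. x (Root i))" for x
  proof -
    have "(\<Prod>b\<in>branches E P. branch_kernel K b x) =
        (\<Prod>e\<in>E. \<Prod>q\<in>(SIGMA r:set_mset (P e). {..<count (P e) r}). branch_kernel K (e, q) x)"
      unfolding branches_def using fin by (subst prod.Sigma) (auto simp: case_prod_beta')
    also have "\<dots> = (\<Prod>e\<in>E. theta_kernel K (P e) (x (Root (Min e)), x (Root (Max e))))"
    proof (intro prod.cong refl)
      fix e
      have "(\<Prod>q\<in>(SIGMA r:set_mset (P e). {..<count (P e) r}). branch_kernel K (e, q) x) =
          (\<Prod>r\<in>set_mset (P e). \<Prod>k<count (P e) r. branch_kernel K (e, r, k) x)"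
        by (subst prod.Sigma) (auto simp: case_prod_beta' simp del: branch_kernel.simps)
      then show "(\<Prod>q\<in>(SIGMA r:set_mset (P e). {..<count (P e) r}). branch_kernel K (e, q) x) =
          theta_kernel K (P e) (x (Root (Min e)), x (Root (Max e)))"
        by (simp add: theta_kernel_count)
    qed
    also have "\<dots> = (\<Prod>e\<in>nsets {1..h} 2. theta_kernel K (?A e) (x (Root (Min e)), x (Root (Max e))))"
      using E finite_nsets_2 by (intro prod.mono_neutral_cong_left) auto
    also have "\<dots> = pattern_product K h ?A (\<lambda>i\<in>{1..h}. x (Root i))"
      unfolding pattern_product_def using nsets_2_Min_Max by (intro prod.cong refl) simp
    finally show ?thesis .
  qed
  have "(\<integral>x. (\<Prod>d\<in>edges (replace_edges h E P). K (x (fst (ends (replace_edges h E P) d)),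
      x (snd (ends (replace_edges h E P) d)))) \<partial>cube (vertices (replace_edges h E P))) =
      (\<integral>x. (\<Prod>b\<in>branches E P. branch_product K b x) * 1
        \<partial>cube (?R \<union> (\<Union>b\<in>branches E P. branch_internal b)))"
    unfolding prod_edges_replace_edges[OF fin] vertices_replace_edges by simp
  also have "\<dots> = (\<integral>x. (\<Prod>b\<in>branches E P. branch_kernel K b x) * 1 \<partial>cube ?R)"
    by (rule branches_integral[OF b refl _ finite_branches[OF fin] valid])
      (auto intro: bounded_measurable_const)
  also have "\<dots> = (\<integral>x. pattern_product K h ?A (\<lambda>i\<in>{1..h}. x (Root i)) \<partial>cube ?R)"
    by (simp add: prod)
  also have "\<dots> = pattern_density K h ?A"
    unfolding pattern_density_def
    by (rule integral_cube_reindex[OF _ _ bm_pattern_product[OF K]]) (auto simp: inj_on_def)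
  finally show ?thesis .
qed

lemma sym_kernel_pair_image:
  assumes S: "sym_kernel S" and f: "inj f" and e: "e \<in> nsets {1..h::nat} 2"
  shows "S (x (f (Min e)), x (f (Max e))) = S (x (Min (f ` e)), x (Max (f ` e)))"
proof -
  obtain a b where "e = {a, b}" "a < b"
    using e by (auto simp: nsets_def card_2_iff) (metis insert_commute linorder_neqE_nat)
  then show ?thesis
    using sym_kernel_sym[OF S] by (cases "f a \<le> f b") (auto simp: min_def max_def)
qed

lemma pattern_density_permute:
  assumes K: "sym_kernel K" and \<sigma>: "\<sigma> permutes {1..h}"
  shows "pattern_density K h (\<lambda>e. A (\<sigma> ` e)) = pattern_density K h A"
proof -
  let ?f = "inv \<sigma>"
  have f: "?f permutes {1..h}" by (rule permutes_inv[OF \<sigma>])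
  have "pattern_product K h A (\<lambda>i\<in>{1..h}. x (?f i)) = pattern_product K h (\<lambda>e. A (\<sigma> ` e)) x" for x
  proof -
    have "pattern_product K h A (\<lambda>i\<in>{1..h}. x (?f i)) =
        (\<Prod>e\<in>nsets {1..h} 2. theta_kernel K (A e) (x (?f (Min e)), x (?f (Max e))))"
      unfolding pattern_product_def using nsets_2_Min_Max by (intro prod.cong refl) simp
    also have "\<dots> = (\<Prod>e\<in>nsets {1..h} 2. theta_kernel K (A e) (x (Min (?f ` e)), x (Max (?f ` e))))"
      by (intro prod.cong refl sym_kernel_pair_image[OF sym_kernel_theta[OF K] permutes_inj[OF f]])
    also have "\<dots> = (\<Prod>e\<in>nsets {1..h} 2. theta_kernel K (A (\<sigma> ` e))
        (x (Min (?f ` \<sigma> ` e)), x (Max (?f ` \<sigma> ` e))))"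
      by (rule prod.reindex_bij_betw[OF permutes_image_nsets[OF \<sigma>], symmetric])
    also have "\<dots> = pattern_product K h (\<lambda>e. A (\<sigma> ` e)) x"
      using permutes_inverses(2)[OF \<sigma>] by (simp add: pattern_product_def image_image)
    finally show ?thesis .
  qed
  moreover have "(\<integral>x. pattern_product K h A (\<lambda>i\<in>{1..h}. x (?f i)) \<partial>cube {1..h}) =
      integral\<^sup>L (cube {1..h}) (pattern_product K h A)"
    using permutes_inj_on[OF f] permutes_image[OF f]
    by (intro integral_cube_reindex bm_pattern_product[OF K]) auto
  ultimately show ?thesis by (simp add: pattern_density_def)
qed

text \<open>All relabellings have the same density, so \<open>v\<close> is their mean; the product of the integrands of
  all relabellings is the integrand of the collected pattern.\<close>

lemma pattern_density_mean:
  assumes K: "sym_kernel K" and K0: "\<And>p. K p \<ge> 0"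
  obtains v where "bounded_measurable (cube {1..h}) v" "\<And>x. v x \<ge> 0"
    "integral\<^sup>L (cube {1..h}) v = pattern_density K h A"
    "\<And>x. pattern_product K h (orbit_pattern h A) x \<le> v x ^ fact h"
proof -
  let ?P = "{\<sigma>. \<sigma> permutes {1..h}}"
  have fin: "finite ?P" by (simp add: finite_permutations)
  have card: "card ?P = fact h" by (rule card_permutations) auto
  have ne: "?P \<noteq> {}" using permutes_id by blast
  define v where "v x = (\<Sum>\<sigma>\<in>?P. pattern_product K h (\<lambda>e. A (\<sigma> ` e)) x) / real (card ?P)" for x
  have bm: "bounded_measurable (cube {1..h}) (pattern_product K h (\<lambda>e. A (\<sigma> ` e)))" for \<sigma>
    by (rule bm_pattern_product[OF K])
  have "bounded_measurable (cube {1..h}) v" unfolding v_def[abs_def] by (intro bm_intros bm)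
  moreover have "v x \<ge> 0" for x
    unfolding v_def by (intro divide_nonneg_nonneg sum_nonneg pattern_product_nonneg K0) auto
  moreover have "integral\<^sup>L (cube {1..h}) v = pattern_density K h A"
  proof -
    have "integral\<^sup>L (cube {1..h}) v =
        (\<Sum>\<sigma>\<in>?P. pattern_density K h (\<lambda>e. A (\<sigma> ` e))) / real (card ?P)"
      unfolding v_def[abs_def] pattern_density_def 
      by (simp only: integral_divide_zero Bochner_Integration.integral_sum[OF integrable_cube[OF bm]])
    also have "\<dots> = pattern_density K h A"
      using fin ne by (simp add: pattern_density_permute[OF K] card_gt_0_iff)
    finally show ?thesis .
  qed
  moreover have "pattern_product K h (orbit_pattern h A) x \<le> v x ^ fact h" for x
  proof -
    have "pattern_product K h (orbit_pattern h A) x = (\<Prod>\<sigma>\<in>?P. pattern_product K h (\<lambda>e. A (\<sigma> ` e)) x)"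
      unfolding pattern_product_def orbit_pattern_def theta_kernel_sum by (rule prod.swap)
    also have "\<dots> \<le> v x ^ card ?P"
      unfolding v_def by (intro prod_le_mean_power fin ne pattern_product_nonneg K0)
    finally show ?thesis by (simp only: card)
  qed
  ultimately show ?thesis by (rule that)
qed

lemma uniform_pattern_density_ge:
  assumes K: "psd K" and K0: "\<And>p. K p \<ge> 0" and \<Theta>: "\<forall>r\<in>#\<Theta>. r \<ge> 1"
  shows "(\<integral>p. theta_kernel K \<Theta> p \<partial>M2) ^ (h choose 2) \<le> pattern_density K h (\<lambda>_. \<Theta>)"
  unfolding pattern_density_def pattern_product_def[abs_def]
  by (intro clique_density_ge psd_theta_kernel theta_kernel_nonneg K K0 \<Theta>)

theorem pattern_density_ge_average:
  assumes K: "sym_kernel K" and K0: "\<And>p. K p \<ge> 0" and h: "h \<ge> 2"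
    and A: "(\<Sum>e\<in>nsets {1..h} 2. A e) = repeat_mset (h choose 2) \<Theta>"
  shows "pattern_density K h (\<lambda>_. \<Theta>) \<le> pattern_density K h A"
proof -
  obtain v where v: "bounded_measurable (cube {1..h}) v" "\<And>x. v x \<ge> 0"
    "integral\<^sup>L (cube {1..h}) v = pattern_density K h A"
    "\<And>x. pattern_product K h (orbit_pattern h A) x \<le> v x ^ fact h"
    using pattern_density_mean[OF K K0] by metis
  have C: "h choose 2 > 0" using h by simp
  have "orbit_pattern h A e = repeat_mset (fact h) \<Theta>" if e: "e \<in> nsets {1..h} 2" for e
  proof (rule multiset_eqI)
    fix r
    have "(h choose 2) * count (orbit_pattern h A e) r = (h choose 2) * (fact h * count \<Theta> r)"
      by (simp only: count_orbit_pattern[OF e] A count_repeat_mset mult.left_commute[of "fact h"])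
    then show "count (orbit_pattern h A e) r = count (repeat_mset (fact h) \<Theta>) r" using C by simp
  qed
  then have "pattern_product K h (orbit_pattern h A) x = pattern_product K h (\<lambda>_. \<Theta>) x ^ fact h" for x
    by (simp add: pattern_product_def theta_kernel_repeat prod_power_distrib)
  then have "pattern_product K h (\<lambda>_. \<Theta>) x ^ fact h \<le> v x ^ fact h" for x using v(4)[of x] by simp
  then have "pattern_product K h (\<lambda>_. \<Theta>) x \<le> v x" for x
    by (rule iffD1[OF power_mono_iff[OF pattern_product_nonneg[OF K0] v(2) fact_gt_zero]])
  then show ?thesis
    unfolding v(3)[symmetric] pattern_density_def[of K h "\<lambda>_. \<Theta>"]
    by (intro integral_mono integrable_cube v(1) bm_pattern_product K)
qed

text \<open>Jensen's inequality for the exponent \<open>N / (h choose 2) \<ge> 1\<close>, stated with integer powers of both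
  sides.\<close>

theorem pattern_density_ge_one_length:
  assumes K: "sym_kernel K" and K0: "\<And>p. K p \<ge> 0" and h: "h \<ge> 2"
    and A: "(\<Sum>e\<in>nsets {1..h} 2. A e) = replicate_mset N r" and N: "N \<ge> h choose 2"
  shows "pattern_density K h (\<lambda>_. {#r#}) ^ N \<le> pattern_density K h A ^ (h choose 2)"
proof -
  let ?C = "h choose 2" and ?Y = "pattern_product K h (\<lambda>_. {#r#})"
  obtain v where v: "bounded_measurable (cube {1..h}) v" "\<And>x. v x \<ge> 0"
    "integral\<^sup>L (cube {1..h}) v = pattern_density K h A"
    "\<And>x. pattern_product K h (orbit_pattern h A) x \<le> v x ^ fact h"
    using pattern_density_mean[OF K K0] by metis
  have C: "?C > 0" using h by simp
  obtain e0 where e0: "e0 \<in> nsets {1..h} 2"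
    using C card_nsets_2[of h] by (metis card.empty ex_in_conv less_irrefl)
  define s where "s = count (orbit_pattern h A e0) r"
  have s: "?C * s = fact h * N" using count_orbit_pattern[OF e0, of A r] unfolding A by (simp add: s_def)
  have orbit: "orbit_pattern h A e = replicate_mset s r" if e: "e \<in> nsets {1..h} 2" for e
  proof (rule multiset_eqI)
    fix q
    have "?C * count (orbit_pattern h A e) q = ?C * count (replicate_mset s r) q"
      using count_orbit_pattern[OF e, of A q] s unfolding A by simp
    then show "count (orbit_pattern h A e) q = count (replicate_mset s r) q" using C by simp
  qed
  have n: "(fact h :: nat) > 0" by (rule fact_gt_zero)
  have "?C * fact h \<le> ?C * s" using N s by (simp add: mult.commute)
  then have sn: "s \<ge> fact h" using C by simp
  have Y: "?Y x ^ s \<le> v x ^ fact h" for x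
    using v(4)[of x] orbit by (simp add: pattern_product_def theta_kernel_replicate prod_power_distrib)
  have Y0: "?Y x \<ge> 0" for x by (rule pattern_product_nonneg[OF K0])
  define a where "a = pattern_density K h (\<lambda>_. {#r#})"
  define t where "t = pattern_density K h A"
  have a0: "a \<ge> 0" unfolding a_def pattern_density_def by (simp add: Y0)
  have t0: "t \<ge> 0" unfolding t_def v(3)[symmetric] by (simp add: v(2))
  show ?thesis
  proof (cases "a = 0")
    case True
    have "N > 0" using N C by linarith
    then show ?thesis using True t0 by (simp add: a_def[symmetric] t_def[symmetric] power_0_left)
  next
    case False
    then have a: "a > 0" using a0 by simp
    define \<theta> where "\<theta> = real (fact h) / real s"
    have s0: "s > 0" using sn n by linarith
    have "(fact h :: real) \<le> real s" using of_nat_mono[OF sn, where 'a = real] by simp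
    then have \<theta>: "0 < \<theta>" "\<theta> \<le> 1" using s0 by (auto simp: \<theta>_def)
    define c where "c = a powr (1 / \<theta>)"
    have c: "c > 0" using a by (simp add: c_def)
    \<comment> \<open>\<open>v \<ge> Y powr (1 / \<theta>)\<close>, and \<open>c\<close> is the value of the right-hand side at \<open>Y = a\<close>: the concave
       function \<open>v powr \<theta>\<close> lies below its tangent at \<open>c\<close>.\<close>
    have tangent: "?Y x * c powr (1 - \<theta>) \<le> \<theta> * v x + (1 - \<theta>) * c" for x
    proof (cases "v x = 0")
      case True
      have "?Y x ^ s \<le> 0" using Y[of x] n by (simp add: True power_0_left)
      then have "?Y x ^ s = 0" using Y0[of x] by (intro antisym zero_le_power) auto
      then have "?Y x = 0" by simp
      then show ?thesis using True \<theta> c by simp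
    next
      case False
      then have vx: "v x > 0" using v(2)[of x] by simp
      have "?Y x \<le> v x powr \<theta>"
      proof (rule power_le_imp_le_base)
        have "(v x powr \<theta>) ^ Suc (s - 1) = v x powr (real s * \<theta>)"
          using vx s0 by (simp add: powr_powr powr_realpow[symmetric] mult.commute)
        also have "real s * \<theta> = real (fact h)" using s0 by (simp add: \<theta>_def)
        also have "v x powr real (fact h) = v x ^ fact h" using vx by (rule powr_realpow)
        finally show "?Y x ^ Suc (s - 1) \<le> (v x powr \<theta>) ^ Suc (s - 1)"
          using Y[of x] s0 by simp
      qed simp
      then have "?Y x * c powr (1 - \<theta>) \<le> v x powr \<theta> * c powr (1 - \<theta>)"
        by (intro mult_right_mono) auto
      also have "\<dots> \<le> \<theta> * v x + (1 - \<theta>) * c"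
        using \<theta> vx c by (intro Youngs_inequality_0) auto
      finally show ?thesis .
    qed
    have Yb: "bounded_measurable (cube {1..h}) ?Y" by (rule bm_pattern_product[OF K])
    interpret cube: prob_space "cube {1..h}" by (rule prob_space_cube)
    have "(\<integral>x. ?Y x * c powr (1 - \<theta>) \<partial>cube {1..h}) \<le> (\<integral>x. \<theta> * v x + (1 - \<theta>) * c \<partial>cube {1..h})"
      by (intro integral_mono integrable_cube bm_intros Yb v(1) tangent)
    then have "a * c powr (1 - \<theta>) \<le> \<theta> * t + (1 - \<theta>) * c"
      using v(1,3) cube.prob_space
      by (simp add: a_def t_def pattern_density_def integrable_cube bm_intros)
    moreover have "a * c powr (1 - \<theta>) = c"
    proof -
      have "a = c powr \<theta>" using a \<theta> by (simp add: c_def powr_powr)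
      then show ?thesis using c by (simp flip: powr_add)
    qed
    ultimately have "\<theta> * c \<le> \<theta> * t" by (simp add: algebra_simps)
    then have "c \<le> t" using \<theta> by simp
    then have "c ^ ?C \<le> t ^ ?C" using c by (intro power_mono) auto
    moreover have "c ^ ?C = a ^ N"
    proof -
      have "c ^ ?C = a powr (real ?C / \<theta>)" using a by (simp add: c_def powr_powr flip: powr_realpow)
      also have "real ?C / \<theta> = real N"
      proof -
        have "real ?C * real s = real (fact h) * real N" using s by (metis of_nat_mult)
        then show ?thesis using n by (simp add: \<theta>_def field_simps)
      qed
      finally show ?thesis using a by (simp add: powr_realpow)
    qed
    ultimately show ?thesis by (simp add: a_def t_def)
  qed
qed

end

section \<open>From Lebesgue measurable kernels to Borel kernels\<close>

text \<open>Lebesgue measure on the unit interval as a Borel measure on the whole line.\<close>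

definition unit_measure :: "real measure" where
  "unit_measure = distr (lebesgue_on {0..1}) borel (\<lambda>x. x)"

lemma measurable_id_lebesgue_on [measurable]: "(\<lambda>x. x) \<in> lebesgue_on S \<rightarrow>\<^sub>M borel"
  by (intro measurable_restrict_space1 measurable_completion) simp

lemma prob_space_lebesgue_on_unit: "prob_space (lebesgue_on {0..1::real})"
  by (rule prob_spaceI) (simp add: emeasure_restrict_space)

lemma sets_unit_measure [simp]: "sets unit_measure = sets borel"
  by (simp add: unit_measure_def)

lemma emeasure_unit_measure:
  assumes "A \<in> sets borel" shows "emeasure unit_measure A = emeasure lborel (A \<inter> {0..1})"
  using assms by (simp add: unit_measure_def emeasure_distr emeasure_restrict_space space_restrict_space)

global_interpretation unit: full_prob_space unit_measure
proof -
  interpret prob_space unit_measure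
    unfolding unit_measure_def by (rule prob_space.prob_space_distr[OF prob_space_lebesgue_on_unit]) simp
  show "full_prob_space unit_measure"
    by unfold_locales (simp add: unit_measure_def)
qed

abbreviation "unit_pair \<equiv> unit_measure \<Otimes>\<^sub>M unit_measure"

lemma sets_unit_pair: "sets unit_pair = sets borel"
  by (simp only: sets_pair_measure_cong[OF sets_unit_measure sets_unit_measure] borel_prod)

lemma unit_pair_eq_distr: "unit_pair = distr unit_square borel (\<lambda>p. p)"
proof (rule pair_measure_eqI)
  show "sigma_finite_measure unit_measure" "sigma_finite_measure unit_measure"
    by (rule unit.sigma_finite_measure)+
  show "sets unit_pair = sets (distr unit_square borel (\<lambda>p. p))" by (simp only: sets_unit_pair sets_distr)
  fix A B :: "real set" assume "A \<in> sets unit_measure" "B \<in> sets unit_measure"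
  then have A: "A \<in> sets borel" and B: "B \<in> sets borel" by auto
  have AB: "A \<times> B \<in> sets borel" using A B by (rule borel_Times)
  have lborel: "emeasure lebesgue X = emeasure lborel X" if "X \<in> sets borel" for X :: "(real \<times> real) set"
    using that by simp
  have "(A \<times> B) \<inter> ({0..1} \<times> {0..1}) \<in> sets borel" by (intro sets.Int[OF AB] borel_Times) auto
  note lborel[OF this]
  moreover have "emeasure (distr unit_square borel (\<lambda>p. p)) (A \<times> B) =
      emeasure lebesgue ((A \<times> B) \<inter> ({0..1} \<times> {0..1}))"
    using AB by (simp add: emeasure_distr emeasure_restrict_space space_restrict_space borel_Times)
  ultimately have "emeasure (distr unit_square borel (\<lambda>p. p)) (A \<times> B) =
      emeasure lborel ((A \<times> B) \<inter> ({0..1} \<times> {0..1}))"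
    by (simp only:)
  also have "(A \<times> B) \<inter> ({0..1} \<times> {0..1}) = (A \<inter> {0..1}) \<times> (B \<inter> {0..1})" by auto
  also have "emeasure lborel \<dots> = emeasure (lborel \<Otimes>\<^sub>M lborel) \<dots>" by (simp add: lborel_prod)
  also have "\<dots> = emeasure lborel (A \<inter> {0..1}) * emeasure lborel (B \<inter> {0..1})"
    using A B by (intro lborel.emeasure_pair_measure_Times) auto
  finally show "emeasure unit_measure A * emeasure unit_measure B =
      emeasure (distr unit_square borel (\<lambda>p. p)) (A \<times> B)"
    by (simp add: emeasure_unit_measure A B)
qed

lemma integral_unit_square:
  fixes f :: "real \<times> real \<Rightarrow> real"
  assumes "f \<in> borel_measurable borel"
  shows "integral\<^sup>L unit_square f = integral\<^sup>L unit_pair f"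
  unfolding unit_pair_eq_distr using assms by (simp add: integral_distr)

lemma AE_unit_squareD: "AE p in unit_pair. P p \<Longrightarrow> AE p in unit_square. P p"
  unfolding unit_pair_eq_distr by (drule AE_distrD[rotated]) simp_all

lemma AE_unit_squareE:
  assumes "AE p in unit_square. P p"
  obtains N where "N \<in> sets borel" "emeasure unit_pair N = 0"
    "\<And>x y. x \<in> {0..1} \<Longrightarrow> y \<in> {0..1} \<Longrightarrow> (x, y) \<notin> N \<Longrightarrow> P (x, y)"
proof -
  let ?S = "{0..1} \<times> {0..1} :: (real \<times> real) set"
  have S: "?S \<in> sets lebesgue" by (intro sets_completionI_sets) (simp add: borel_Times)
  have "AE p in lebesgue. p \<in> ?S \<longrightarrow> P p" using assms S by (simp add: AE_restrict_space_iff)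
  then have "AE p in lborel. p \<in> ?S \<longrightarrow> P p" by (simp only: AE_completion_iff)
  then obtain N where N: "N \<in> null_sets lborel" "{p \<in> space lborel. \<not> (p \<in> ?S \<longrightarrow> P p)} \<subseteq> N"
    by (auto simp: eventually_ae_filter)
  have Nb: "N \<in> sets borel" using N(1) by (simp add: null_sets_def)
  have "emeasure unit_pair N = emeasure lebesgue (N \<inter> ?S)"
    unfolding unit_pair_eq_distr using Nb S
    by (simp add: emeasure_distr emeasure_restrict_space space_restrict_space)
  also have "\<dots> \<le> emeasure lebesgue N" using Nb by (intro emeasure_mono) auto
  also have "\<dots> = 0" using N(1) by (simp add: null_sets_def)
  finally have "emeasure unit_pair N = 0" by simp
  moreover have "P (x, y)" if "x \<in> {0..1}" "y \<in> {0..1}" "(x, y) \<notin> N" for x y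
  proof (rule ccontr)
    assume "\<not> P (x, y)"
    then have "(x, y) \<in> {p \<in> space lborel. \<not> (p \<in> ?S \<longrightarrow> P p)}" using that(1,2) by simp
    then show False using N(2) that(3) by blast
  qed
  ultimately show ?thesis by (rule that[OF Nb])
qed

context full_prob_space
begin

lemma integral_two_coordinates:
  assumes F: "bounded_measurable M2 F" and ab: "a \<in> V" "b \<in> V" "a \<noteq> b"
  shows "(\<integral>x. F (x a, x b) \<partial>cube V) = (\<integral>p. F p \<partial>M2)"
proof -
  have b1: "bounded_measurable (cube {a, b}) (\<lambda>x. F (x a, x b))" by (intro bm_coord_pair F) auto
  have "(\<integral>x. F (x a, x b) \<partial>cube V) =
      (\<integral>x. (\<lambda>x. F (x a, x b)) (\<lambda>i\<in>{a, b}. x ((\<lambda>i. i) i)) \<partial>cube V)" by simp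
  also have "\<dots> = (\<integral>x. F (x a, x b) \<partial>cube {a, b})"
    by (rule integral_cube_reindex[OF _ _ b1]) (use ab in auto)
  also have "\<dots> = (\<integral>x. \<integral>y. F ((x(a := y)) a, (x(a := y)) b) \<partial>M \<partial>cube {b})"
    by (rule integral_cube_insert(1)) (use ab b1 in auto)
  also have "\<dots> = (\<integral>x. \<integral>y. F (y, x b) \<partial>M \<partial>cube {b})" using ab(3) by simp
  also have "\<dots> = (\<integral>z. \<integral>y. F (y, z) \<partial>M \<partial>M)"
  proof -
    have "bounded_measurable M2 (\<lambda>p. F (snd p, fst p))"
      by (intro bounded_measurable_compose[OF F]) simp
    from bm_integral_kernel[OF this] have "(\<lambda>z. \<integral>y. F (y, z) \<partial>M) \<in> borel_measurable M"
      by (simp add: bounded_measurable_def)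
    from PM.product_integral_singleton[OF this] show ?thesis .
  qed
  also have "\<dots> = (\<integral>p. F p \<partial>M2)"
    by (simp add: integral_swap[OF F] integral_square[OF F])
  finally show ?thesis .
qed

text \<open>Two distinct coordinates are distributed according to the product measure.\<close>

lemma AE_two_coordinates:
  assumes N: "N \<in> sets M2" "emeasure M2 N = 0" and ab: "a \<in> V" "b \<in> V" "a \<noteq> b"
  shows "AE x in cube V. (x a, x b) \<notin> N"
proof -
  have i: "bounded_measurable M2 (indicator N)" by (rule bounded_measurable_indicator[OF N(1)])
  have c: "bounded_measurable (cube V) (\<lambda>x. indicator N (x a, x b))" by (rule bm_coord_pair[OF i ab(1,2)])
  have "(\<integral>x. indicator N (x a, x b) \<partial>cube V) = measure M2 N"
    using integral_two_coordinates[OF i ab] N(1) by simp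
  also have "\<dots> = 0" using N(2) by (simp add: measure_def)
  finally have "(\<integral>x. (indicator N (x a, x b) :: real) \<partial>cube V) = 0" .
  then have "AE x in cube V. (indicator N (x a, x b) :: real) = 0"
    by (subst (asm) integral_nonneg_eq_0_iff_AE) (auto intro: integrable_cube c)
  then show ?thesis by (simp add: indicator_eq_0_iff)
qed

end

lemma measurable_completion_AE_cong:
  fixes f g :: "'a \<Rightarrow> real"
  assumes g: "g \<in> borel_measurable N" and eq: "AE x in N. f x = g x"
  shows "f \<in> borel_measurable (completion N)"
proof (rule measurableI)
  obtain Z where Z: "Z \<in> null_sets N" "{x \<in> space N. f x \<noteq> g x} \<subseteq> Z"
    using eq by (auto simp: eventually_ae_filter)
  fix A :: "real set" assume A: "A \<in> sets borel"
  have "f -` A \<inter> space (completion N) = (g -` A \<inter> space N - Z) \<union> (f -` A \<inter> space N \<inter> Z)"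
    using Z(2) by auto
  moreover have "g -` A \<inter> space N - Z \<in> sets (completion N)"
    using measurable_sets[OF g A] Z(1) by (intro sets_completionI_sets) auto
  moreover have "f -` A \<inter> space N \<inter> Z \<in> null_sets (completion N)"
    by (rule null_sets_completion_subset[of _ Z]) (use Z(1) in \<open>auto intro: null_sets_completionI\<close>)
  ultimately show "f -` A \<inter> space (completion N) \<in> sets (completion N)"
    by (metis null_setsD2 sets.Un)
qed simp

text \<open>The ends of an edge are distinct, so almost every point of the cube avoids, at every edge, the null
  set on which \<open>K\<close> and \<open>L\<close> differ. The product over the edges for \<open>K\<close> is then measurable for the completion
  and has the same integral as the one for \<open>L\<close>.\<close>

lemma hom_density_eq_cube:
  assumes G: "multigraph G" and L: "bounded_measurable unit_pair L"
    and eq: "AE p in unit_square. K p = L p"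
  shows "hom_density G K = (\<integral>x. (\<Prod>e\<in>edges G. L (x (fst (ends G e)), x (snd (ends G e))))
    \<partial>unit.cube (vertices G))"
proof -
  let ?V = "vertices G"
  let ?Q = "\<Pi>\<^sub>M v\<in>?V. lebesgue_on {0..1::real}"
  let ?c = "compose ?V (\<lambda>x::real. x)"
  define f where "f x = (\<Prod>e\<in>edges G. K (x (fst (ends G e)), x (snd (ends G e))))" for x :: "'a \<Rightarrow> real"
  define g where "g x = (\<Prod>e\<in>edges G. L (x (fst (ends G e)), x (snd (ends G e))))" for x :: "'a \<Rightarrow> real"
  have ends: "fst (ends G e) \<in> ?V" "snd (ends G e) \<in> ?V" "fst (ends G e) \<noteq> snd (ends G e)"
    if "e \<in> edges G" for e
    using G that by (auto simp: multigraph_def)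
  have fin: "finite ?V" "finite (edges G)" using G by (auto simp: multigraph_def)
  have idm: "(\<lambda>x. x) \<in> lebesgue_on {0..1} \<rightarrow>\<^sub>M unit_measure"
    by (simp add: unit_measure_def measurable_distr_eq2)
  have distr: "distr ?Q (unit.cube ?V) ?c = unit.cube ?V"
  proof -
    have "distr (lebesgue_on {0..1}) unit_measure (\<lambda>x. x) = unit_measure"
      unfolding unit_measure_def by (intro measure_eqI) (auto simp: emeasure_distr)
    then show ?thesis
      using distr_PiM_finite_prob_space'[OF fin(1), of "\<lambda>_. lebesgue_on {0..1}" "\<lambda>_. unit_measure" "\<lambda>x. x"]
        prob_space_lebesgue_on_unit unit.prob_space_axioms idm by simp
  qed
  have cm: "?c \<in> ?Q \<rightarrow>\<^sub>M unit.cube ?V"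
    unfolding compose_def using idm
    by (intro measurable_restrict) (auto intro: measurable_compose[OF measurable_component_singleton])
  have g: "bounded_measurable (unit.cube ?V) g"
    unfolding g_def[abs_def] by (intro bounded_measurable_prod unit.bm_coord_pair L ends)
  have gc: "g (?c x) = g x" for x unfolding g_def using ends by (intro prod.cong refl) (simp add: compose_def)
  have gQ: "g \<in> borel_measurable ?Q"
    using measurable_compose[OF cm bounded_measurable_measurable[OF g]] by (simp add: gc)
  obtain N where N: "N \<in> sets borel" "emeasure unit_pair N = 0"
    "\<And>x y. x \<in> {0..1} \<Longrightarrow> y \<in> {0..1} \<Longrightarrow> (x, y) \<notin> N \<Longrightarrow> K (x, y) = L (x, y)"
    using AE_unit_squareE[OF eq] by metis
  have "AE x in ?Q. (x (fst (ends G e)), x (snd (ends G e))) \<notin> N" if e: "e \<in> edges G" for e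
  proof -
    have "AE x in distr ?Q (unit.cube ?V) ?c. (x (fst (ends G e)), x (snd (ends G e))) \<notin> N"
      unfolding distr
      by (rule unit.AE_two_coordinates[OF _ N(2) ends[OF e]]) (simp only: sets_unit_pair N(1))
    from AE_distrD[OF cm this] show ?thesis using ends[OF e] by (simp add: compose_def)
  qed
  then have "AE x in ?Q. \<forall>e\<in>edges G. (x (fst (ends G e)), x (snd (ends G e))) \<notin> N"
    using fin by (simp add: AE_finite_all)
  then have fg: "AE x in ?Q. f x = g x"
  proof (rule AE_mp, intro AE_I2 impI)
    fix x assume x: "x \<in> space ?Q" and nN: "\<forall>e\<in>edges G. (x (fst (ends G e)), x (snd (ends G e))) \<notin> N"
    have "x v \<in> {0..1}" if "v \<in> ?V" for v using x that by (auto simp: space_PiM space_restrict_space)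
    then show "f x = g x" unfolding f_def g_def using nN ends by (intro prod.cong refl N(3)) auto
  qed
  have "hom_density G K = integral\<^sup>L (completion ?Q) f" by (simp add: hom_density_def f_def[abs_def])
  also have "\<dots> = integral\<^sup>L (completion ?Q) g"
    by (intro integral_cong_AE measurable_completion_AE_cong[OF gQ fg] measurable_completion gQ AE_completion fg)
  also have "\<dots> = integral\<^sup>L ?Q g" by (rule integral_completion[OF gQ])
  also have "\<dots> = integral\<^sup>L (distr ?Q (unit.cube ?V) ?c) g"
    using bounded_measurable_measurable[OF g] by (simp add: integral_distr[OF cm] gc)
  finally show ?thesis by (simp add: distr g_def[abs_def])
qed

text \<open>Symmetrising and truncating a Borel version of \<open>K\<close> changes it on a null set only, because the
  reflection of a null set in the diagonal is a null set.\<close>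

lemma doubly_nonnegative_Borel_version:
  assumes "doubly_nonnegative K"
  obtains L where "unit.psd L" "\<And>p. L p \<ge> 0" "AE p in unit_square. K p = L p"
    "integral\<^sup>L unit_pair L = kernel_norm1 K"
proof -
  let ?S = "{0..1} \<times> {0..1} :: (real \<times> real) set"
  have Km: "K \<in> borel_measurable unit_square" and K0: "AE p in unit_square. 0 \<le> K p"
    and Ks: "\<And>x y. x \<in> {0..1} \<Longrightarrow> y \<in> {0..1} \<Longrightarrow> K (x, y) = K (y, x)"
    and form: "\<And>f. f \<in> borel_measurable (lebesgue_on {0..1}) \<Longrightarrow> \<exists>B. \<forall>x\<in>{0..1}. \<bar>f x\<bar> \<le> B \<Longrightarrow>
      0 \<le> (LINT p|unit_square. f (fst p) * K p * f (snd p))"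
    using assms by (auto simp: doubly_nonnegative_def kernel_def)
  have "\<exists>B. \<forall>x\<in>{0..1}. \<forall>y\<in>{0..1}. \<bar>K (x, y)\<bar> \<le> B"
    using assms unfolding doubly_nonnegative_def kernel_def by blast
  then obtain B where B: "\<And>x y. x \<in> {0..1} \<Longrightarrow> y \<in> {0..1} \<Longrightarrow> \<bar>K (x, y)\<bar> \<le> B" by blast
  have S: "?S \<in> sets lebesgue" by (intro sets_completionI_sets) (simp add: borel_Times)
  have "(\<lambda>p. indicator ?S p *\<^sub>R K p) \<in> borel_measurable lebesgue"
    using Km S by (subst (asm) borel_measurable_restrict_space_iff) auto
  from completion_ex_borel_measurable_real[OF this[unfolded real_scaleR_def]]
  obtain g where g: "g \<in> borel_measurable borel" "AE p in lborel. indicator ?S p * K p = g p"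
    by auto
  have "AE p in lebesgue. p \<in> ?S \<longrightarrow> K p = g p"
    by (rule AE_mp[OF AE_completion[OF g(2)]]) (auto intro!: AE_I2 split: split_indicator_asm)
  then have "AE p in unit_square. K p = g p" using S by (simp add: AE_restrict_space_iff)
  with K0 have "AE p in unit_square. 0 \<le> K p \<and> K p = g p" by eventually_elim auto
  from AE_unit_squareE[OF this]
  obtain N where N: "N \<in> sets borel" "emeasure unit_pair N = 0"
    "\<And>x y. x \<in> {0..1} \<Longrightarrow> y \<in> {0..1} \<Longrightarrow> (x, y) \<notin> N \<Longrightarrow> 0 \<le> K (x, y) \<and> K (x, y) = g (x, y)"
    by metis
  define L where "L p = max 0 (min B ((g p + g (snd p, fst p)) / 2))" for p
  have swap: "(\<lambda>p. (snd p, fst p)) \<in> (borel :: (real \<times> real) measure) \<rightarrow>\<^sub>M borel"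
    by (intro borel_measurable_continuous_onI continuous_intros)
  have g2[measurable]: "(\<lambda>p. g (snd p, fst p)) \<in> borel_measurable borel"
    using measurable_compose[OF swap g(1)] .
  have Lm: "L \<in> borel_measurable borel" unfolding L_def[abs_def] using g(1) by measurable
  have Lb: "bounded_measurable unit_pair L"
  proof (rule bounded_measurableI[where B="\<bar>B\<bar>"])
    show "L \<in> borel_measurable unit_pair" 
      using Lm measurable_cong_sets[OF sets_unit_pair refl] by blast
  qed (auto simp: L_def)
  have L0: "L p \<ge> 0" for p by (simp add: L_def)
  have Ls: "L (x, y) = L (y, x)" for x y by (simp add: L_def add.commute)
  have notN: "AE p in unit_pair. p \<notin> N"
    by (rule AE_not_in[OF null_setsI[OF N(2)]]) (simp only: sets_unit_pair N(1))
  have "AE p in unit_pair. (snd p, fst p) \<notin> N"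
  proof -
    have "AE p in distr unit_pair unit_pair (\<lambda>(x, y). (y, x)). p \<notin> N"
      unfolding unit.square.distr_pair_swap[symmetric] by (rule notN)
    from AE_distrD[OF _ this] show ?thesis by (simp add: case_prod_beta')
  qed
  with notN have "AE p in unit_pair. p \<notin> N \<and> (snd p, fst p) \<notin> N" by eventually_elim auto
  from AE_unit_squareD[OF this]
  have KL: "AE p in unit_square. K p = L p"
  proof (rule AE_mp, intro AE_I2 impI)
    fix p assume p: "p \<in> space unit_square" "p \<notin> N \<and> (snd p, fst p) \<notin> N"
    obtain x y where xy: "p = (x, y)" "x \<in> {0..1}" "y \<in> {0..1}"
      using p(1) by (cases p) (auto simp: space_restrict_space)
    have "g (x, y) = K (x, y)" "g (y, x) = K (x, y)" "0 \<le> K (x, y)" "K (x, y) \<le> B"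
      using N(3)[of x y] N(3)[of y x] p(2) xy Ks[of x y] B[of x y] by auto
    then show "K p = L p" by (simp add: L_def xy)
  qed
  have Lsq: "L \<in> borel_measurable unit_square"
    using measurable_compose[OF measurable_id_lebesgue_on Lm] by simp
  have "integral\<^sup>L unit_pair L = integral\<^sup>L unit_square L" by (rule integral_unit_square[OF Lm, symmetric])
  also have "\<dots> = kernel_norm1 K"
    unfolding kernel_norm1_def by (intro integral_cong_AE Km Lsq) (use KL in eventually_elim, simp)
  finally have norm: "integral\<^sup>L unit_pair L = kernel_norm1 K" .
  have sym: "unit.sym_kernel L" using Lb Ls by (auto simp: unit.sym_kernel_def)
  have "0 \<le> unit.ip f (unit.apply_kernel L f)" if f: "unit.bm f" for f
  proof -
    have fb: "f \<in> borel_measurable borel"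
      using f by (simp add: bounded_measurable_def cong: measurable_cong_sets)
    have fm: "f \<in> borel_measurable (lebesgue_on {0..1})"
      using measurable_compose[OF measurable_id_lebesgue_on fb] by simp
    have f12: "(\<lambda>p. f (fst p)) \<in> borel_measurable borel" "(\<lambda>p. f (snd p)) \<in> borel_measurable borel"
      by (rule measurable_compose[OF _ fb], rule borel_measurable_continuous_onI, intro continuous_intros)+
    note f12' = measurable_compose[OF measurable_id_lebesgue_on f12(1)]
      measurable_compose[OF measurable_id_lebesgue_on f12(2)]
    have "\<exists>B. \<forall>x\<in>{0..1}. \<bar>f x\<bar> \<le> B" using f by (auto simp: bounded_measurable_def)
    from form[OF fm this] have "0 \<le> (LINT p|unit_square. f (fst p) * K p * f (snd p))" .
    also have "\<dots> = (LINT p|unit_square. f (fst p) * L p * f (snd p))"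
      by (intro integral_cong_AE borel_measurable_times f12' Km Lsq) (use KL in eventually_elim, simp)
    also have "\<dots> = (\<integral>p. f (fst p) * L p * f (snd p) \<partial>unit_pair)"
      by (intro integral_unit_square borel_measurable_times f12 Lm)
    also have "\<dots> = unit.ip f (unit.apply_kernel L f)" by (rule unit.form_integral[OF Lb f f, symmetric])
    finally show ?thesis .
  qed
  then have "unit.psd L" using sym by (simp add: unit.psd_def)
  then show ?thesis using L0 KL norm by (rule that)
qed

section \<open>Sidorenko-goodness of the replacement graphs\<close>

context full_prob_space
begin

context
  fixes K :: "'a \<times> 'a \<Rightarrow> real" and h :: nat and A :: "nat set \<Rightarrow> nat multiset"
  assumes K: "psd K" and K0: "\<And>p. K p \<ge> 0" and pos: "(\<integral>p. K p \<partial>M2) > 0" and h: "h \<ge> 2"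
begin

text \<open>Symmetrisation, the inequality for complete graphs and the one for the averaged theta pattern are
  chained; equality at the ends forces equality in the last one.\<close>

lemma pattern_density_divisible:
  assumes A: "(\<Sum>e\<in>nsets {1..h} 2. A e) = repeat_mset (h choose 2) \<Theta>"
    and \<Theta>: "\<forall>r\<in>#\<Theta>. r \<ge> 1" "\<Theta> \<noteq> {#}"
  shows "(\<integral>p. K p \<partial>M2) ^ ((h choose 2) * sum_mset \<Theta>) \<le> pattern_density K h A"
    and "size \<Theta> \<ge> 2 \<Longrightarrow> pattern_density K h A \<le> (\<integral>p. K p \<partial>M2) ^ ((h choose 2) * sum_mset \<Theta>) \<Longrightarrow>
      AE q in M2. K q = (\<integral>p. K p \<partial>M2)"
proof -
  define \<rho> where "\<rho> = (\<integral>p. K p \<partial>M2)"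
  define w where "w = (\<integral>p. theta_kernel K \<Theta> p \<partial>M2)"
  have \<rho>: "\<rho> > 0" using pos by (simp add: \<rho>_def)
  have w0: "w \<ge> 0" unfolding w_def by (intro Bochner_Integration.integral_nonneg theta_kernel_nonneg K0)
  have C: "h choose 2 > 0" using h by simp
  have "\<rho> ^ sum_mset \<Theta> \<le> w"
    using theta_integral_ge_power[OF K K0 pos \<Theta>] by (simp add: \<rho>_def w_def)
  then have "(\<rho> ^ sum_mset \<Theta>) ^ (h choose 2) \<le> w ^ (h choose 2)"
    using \<rho> by (intro power_mono) auto
  moreover have ww: "w ^ (h choose 2) \<le> pattern_density K h A"
    unfolding w_def using uniform_pattern_density_ge[OF K K0 \<Theta>(1), of h]
      pattern_density_ge_average[OF psd_sym[OF K] K0 h A] by linarith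
  ultimately show "\<rho> ^ ((h choose 2) * sum_mset \<Theta>) \<le> pattern_density K h A"
    by (simp add: mult.commute power_mult)
  assume s: "size \<Theta> \<ge> 2" and le: "pattern_density K h A \<le> \<rho> ^ ((h choose 2) * sum_mset \<Theta>)"
  have "w ^ (h choose 2) \<le> (\<rho> ^ sum_mset \<Theta>) ^ (h choose 2)"
    using ww le by (simp add: mult.commute power_mult)
  then have "w \<le> \<rho> ^ sum_mset \<Theta>"
    using power_mono_iff[OF w0 _ C, of "\<rho> ^ sum_mset \<Theta>"] \<rho> by simp
  then show "AE q in M2. K q = \<rho>"
    using theta_integral_rigidity[OF K K0 pos \<Theta>(1) s] by (simp add: \<rho>_def w_def)
qed

text \<open>The density for the uniform subdivision lies between the two ends of the chain, so equality at the
  ends determines it.\<close>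

lemma pattern_density_one_length:
  assumes A: "(\<Sum>e\<in>nsets {1..h} 2. A e) = replicate_mset N r" and N: "N \<ge> h choose 2" and r: "r \<ge> 1"
  shows "(\<integral>p. K p \<partial>M2) ^ (N * r) \<le> pattern_density K h A"
    and "pattern_density K h A \<le> (\<integral>p. K p \<partial>M2) ^ (N * r) \<Longrightarrow>
      pattern_density K h (\<lambda>_. {#r#}) = (\<integral>p. K p \<partial>M2) ^ ((h choose 2) * r)"
proof -
  define \<rho> where "\<rho> = (\<integral>p. K p \<partial>M2)"
  define a where "a = pattern_density K h (\<lambda>_. {#r#})"
  define t where "t = pattern_density K h A"
  let ?C = "h choose 2"
  have \<rho>: "\<rho> > 0" using pos by (simp add: \<rho>_def)
  have C: "?C > 0" using h by simp
  then have N0: "N > 0" using N by linarith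
  have t0: "t \<ge> 0" unfolding t_def pattern_density_def
    by (intro Bochner_Integration.integral_nonneg pattern_product_nonneg K0)
  have one: "\<forall>q\<in>#{#r#}. q \<ge> 1" "{#r#} \<noteq> {#}" using r by auto
  have "(\<Sum>e\<in>nsets {1..h} 2. {#r#}) = repeat_mset ?C {#r#}"
    by (rule multiset_eqI) (simp add: count_sum card_nsets_2 del: One_nat_def)
  have a_ge: "\<rho> ^ (?C * r) \<le> a"
  proof -
    have "\<rho> ^ r \<le> (\<integral>p. theta_kernel K {#r#} p \<partial>M2)"
      using theta_integral_ge_power[OF K K0 pos one] by (simp add: \<rho>_def)
    then have "(\<rho> ^ r) ^ ?C \<le> (\<integral>p. theta_kernel K {#r#} p \<partial>M2) ^ ?C"
      using \<rho> by (intro power_mono) auto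
    also have "\<dots> \<le> a" unfolding a_def by (rule uniform_pattern_density_ge[OF K K0 one(1)])
    finally show ?thesis by (simp add: mult.commute power_mult)
  qed
  have at: "a ^ N \<le> t ^ ?C"
    unfolding a_def t_def by (rule pattern_density_ge_one_length[OF psd_sym[OF K] K0 h A N])
  have exps: "(\<rho> ^ (?C * r)) ^ N = (\<rho> ^ (N * r)) ^ ?C"
    by (simp only: power_mult[symmetric]) (simp only: ac_simps)
  have "(\<rho> ^ (?C * r)) ^ N \<le> a ^ N" using a_ge \<rho> by (intro power_mono) auto
  then have "(\<rho> ^ (N * r)) ^ ?C \<le> t ^ ?C" using at exps by simp
  then show "\<rho> ^ (N * r) \<le> t" using power_mono_iff[OF _ t0 C, of "\<rho> ^ (N * r)"] \<rho> by simp
  assume "t \<le> \<rho> ^ (N * r)"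
  then have "t ^ ?C \<le> (\<rho> ^ (N * r)) ^ ?C" using t0 by (intro power_mono) auto
  then have "a ^ N \<le> (\<rho> ^ (?C * r)) ^ N" using at exps by simp
  moreover have "a \<ge> 0" using a_ge \<rho> by (meson less_imp_le order_trans zero_less_power)
  ultimately have "a \<le> \<rho> ^ (?C * r)" using power_mono_iff[OF _ _ N0, of a "\<rho> ^ (?C * r)"] \<rho> by simp
  then show "a = \<rho> ^ (?C * r)" using a_ge by simp
qed

end

end

lemma sum_mset_sum: "sum_mset (\<Sum>i\<in>I. A i) = (\<Sum>i\<in>I. sum_mset (A i :: nat multiset))"
  by (induction I rule: infinite_finite_induct) auto

lemma sum_mset_repeat_mset: "sum_mset (repeat_mset n A) = n * sum_mset (A :: nat multiset)"
  by (induction n) auto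

lemma count_total_pattern:
  "count (\<Sum>e\<in>nsets {1..h} 2. if e \<in> E then P e else {#}) r = total_branches h E P r"
  unfolding total_branches_def branch_count_def count_sum by (intro sum.cong) auto

lemma num_edges_total_pattern:
  assumes "E \<subseteq> nsets {1..h} 2"
  shows "num_edges (replace_edges h E P) = sum_mset (\<Sum>e\<in>nsets {1..h} 2. if e \<in> E then P e else {#})"
proof -
  have "finite E" using assms finite_nsets_2 finite_subset by blast
  then have "num_edges (replace_edges h E P) = (\<Sum>e\<in>E. sum_mset (P e))" by (rule num_edges_replace_edges)
  also have "\<dots> = (\<Sum>e\<in>nsets {1..h} 2. sum_mset (if e \<in> E then P e else {#}))"
    using assms finite_nsets_2 by (intro sum.mono_neutral_cong_left) auto
  finally show ?thesis by (simp only: sum_mset_sum)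
qed

lemma hom_density_replace_edges:
  assumes E: "E \<subseteq> nsets {1..h} 2" and P: "\<forall>e\<in>E. theta_pattern (P e)"
    and L: "unit.sym_kernel L" and eq: "AE p in unit_square. K p = L p"
  shows "hom_density (replace_edges h E P) K =
    unit.pattern_density L h (\<lambda>e. if e \<in> E then P e else {#})"
  unfolding hom_density_eq_cube[OF multigraph_replace_edges[OF E] unit.sym_kernel_bm[OF L] eq]
  by (rule unit.replace_edges_density[OF L E P])

lemma hom_density_uniform_subdivision:
  assumes "r \<ge> 1" "unit.sym_kernel L" "AE p in unit_square. K p = L p"
  shows "hom_density (uniform_subdivision h r) K = unit.pattern_density L h (\<lambda>_. {#r#})"
proof -
  have "unit.pattern_density L h (\<lambda>e. if e \<in> nsets {1..h} 2 then {#r#} else {#}) =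
      unit.pattern_density L h (\<lambda>_. {#r#})"
    unfolding unit.pattern_density_def unit.pattern_product_def[abs_def]
    by (intro Bochner_Integration.integral_cong prod.cong) auto
  then show ?thesis
    unfolding uniform_subdivision_def using assms
    by (subst hom_density_replace_edges) (auto simp: theta_pattern_def)
qed

lemma num_edges_uniform_subdivision: "num_edges (uniform_subdivision h r) = (h choose 2) * r"
  unfolding uniform_subdivision_def num_edges_replace_edges[OF finite_nsets_2]
  using card_nsets_2[of h] by simp

lemma hom_density_const:
  assumes G: "multigraph G" and eq: "AE p in unit_square. K p = c"
  shows "hom_density G K = c ^ num_edges G"
proof -
  interpret C: prob_space "unit.cube (vertices G)" by (rule unit.prob_space_cube)
  show ?thesis
    using hom_density_eq_cube[OF G bounded_measurable_const eq] C.prob_space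
    by (simp add: num_edges_def)
qed

theorem theorem1p6:
  fixes h :: nat
    and E :: "nat set set"
    and P :: "nat set \<Rightarrow> nat multiset"
    and F :: "(vertex, nat set \<times> nat \<times> nat \<times> nat) mgraph"
    and C :: nat and N :: "nat \<Rightarrow> nat"
  assumes "h \<ge> 2"
    and "E \<subseteq> nsets {1..h} 2"
    and "\<forall>e\<in>E. theta_pattern (P e)"
    and "F = replace_edges h E P"
    and "C = h choose 2"
    and "N = total_branches h E P"
    and "num_edges F > 0"
    and "(\<forall>r\<ge>1. C dvd N r) \<or> (\<exists>r\<ge>1. (\<forall>r'\<ge>1. r' \<noteq> r \<longrightarrow> N r' = 0) \<and> N r \<ge> C)"
  shows "Sidorenko_good F \<and>
    ((\<forall>r\<ge>1. C dvd N r) \<longrightarrow> size (average_pattern h E P) \<ge> 2 \<longrightarrow>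
       (\<forall>K. doubly_nonnegative K \<and> kernel_norm1 K > 0 \<longrightarrow>
          (hom_density F K = kernel_norm1 K ^ num_edges F \<longleftrightarrow>
           (AE p in unit_square. K p = kernel_norm1 K)))) \<and>
    (\<forall>r\<ge>1. (\<forall>r'\<ge>1. r' \<noteq> r \<longrightarrow> N r' = 0) \<and> N r \<ge> C \<longrightarrow>
       Sidorenko_good_forcing (uniform_subdivision h r) \<longrightarrow>
       (\<forall>K. doubly_nonnegative K \<and> kernel_norm1 K > 0 \<longrightarrow>
          (hom_density F K = kernel_norm1 K ^ num_edges F \<longleftrightarrow>
           (AE p in unit_square. K p = kernel_norm1 K))))"
proof -
  note h = assms(1) and E = assms(2) and P = assms(3)
  define A where "A e = (if e \<in> E then P e else {#})" for e
  define S where "S = (\<Sum>e\<in>nsets {1..h} 2. A e)"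
  define \<Theta> where "\<Theta> = average_pattern h E P"
  have C0: "C > 0" using h by (simp add: assms(5))
  have S_count: "count S r = N r" for r
    unfolding S_def A_def assms(6) by (rule count_total_pattern)
  have edges: "num_edges F = sum_mset S"
    unfolding S_def A_def assms(4) by (rule num_edges_total_pattern[OF E])
  have A_pos: "r \<ge> 1" if "r \<in># S" for r
  proof -
    have "(\<Sum>e\<in>nsets {1..h} 2. count (A e) r) \<noteq> 0"
      using that unfolding S_def by (simp flip: count_sum)
    then obtain e where "count (A e) r \<noteq> 0" by (rule sum.not_neutral_contains_not_neutral)
    then have "e \<in> E" "r \<in># P e" by (auto simp: A_def not_in_iff split: if_splits)
    then show ?thesis using P by (auto simp: theta_pattern_def)
  qed
  have "0 \<notin># S" using A_pos[of 0] by auto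
  then have N0: "N 0 = 0" using S_count[of 0] by (simp add: not_in_iff)
  have divisible: "S = repeat_mset C \<Theta>" "\<forall>r\<in>#\<Theta>. r \<ge> 1" "\<Theta> \<noteq> {#}" if "\<forall>r\<ge>1. C dvd N r"
  proof -
    have prem: "\<forall>r\<ge>1. (h choose 2) dvd total_branches h E P r"
      using that by (simp only: assms(5,6))
    have cnt: "N r = C * count \<Theta> r" for r
    proof -
      have "real (count \<Theta> r) = real (N r) / real C"
        using count_average_pattern[OF h E P prem, of r]
        by (simp only: \<Theta>_def average_branches_def assms(5,6))
      then have "real (N r) = real (C * count \<Theta> r)" using C0 by simp
      then show ?thesis by (simp only: of_nat_eq_iff)
    qed
    show S: "S = repeat_mset C \<Theta>" by (rule multiset_eqI) (simp add: S_count cnt)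
    show "\<forall>r\<in>#\<Theta>. r \<ge> 1"
    proof
      fix r assume "r \<in># \<Theta>"
      then have "count S r > 0" using C0 cnt[of r] by (simp add: S_count)
      then show "r \<ge> 1" using A_pos[of r] by simp
    qed
    show "\<Theta> \<noteq> {#}" using assms(7) edges S by auto
  qed
  have single: "S = replicate_mset (N r) r" if "r \<ge> 1" "\<forall>r'\<ge>1. r' \<noteq> r \<longrightarrow> N r' = 0" for r
  proof (rule multiset_eqI)
    fix q
    show "count S q = count (replicate_mset (N r) r) q"
      using that N0 by (cases "q = 0") (auto simp: S_count)
  qed
  have main: "kernel_norm1 K ^ num_edges F \<le> hom_density F K \<and>
      ((\<forall>r\<ge>1. C dvd N r) \<longrightarrow> size \<Theta> \<ge> 2 \<longrightarrow> hom_density F K = kernel_norm1 K ^ num_edges F \<longrightarrow>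
        (AE p in unit_square. K p = kernel_norm1 K)) \<and>
      (\<forall>r\<ge>1. (\<forall>r'\<ge>1. r' \<noteq> r \<longrightarrow> N r' = 0) \<and> N r \<ge> C \<longrightarrow>
        hom_density F K = kernel_norm1 K ^ num_edges F \<longrightarrow>
        hom_density (uniform_subdivision h r) K = kernel_norm1 K ^ num_edges (uniform_subdivision h r))"
    if dnn: "doubly_nonnegative K" and pos: "kernel_norm1 K > 0" for K
  proof -
    obtain L where L: "unit.psd L" "\<And>p. L p \<ge> 0" "AE p in unit_square. K p = L p"
      "integral\<^sup>L unit_pair L = kernel_norm1 K"
      using doubly_nonnegative_Borel_version[OF dnn] by metis
    note Ls = unit.psd_sym[OF L(1)]
    have Lpos: "integral\<^sup>L unit_pair L > 0" using pos L(4) by simp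
    have dens: "hom_density F K = unit.pattern_density L h A"
      unfolding assms(4) A_def[abs_def] by (rule hom_density_replace_edges[OF E P Ls L(3)])
    note D = unit.pattern_density_divisible[OF L(1,2) Lpos h, of A, folded S_def assms(5)]
    note O = unit.pattern_density_one_length[OF L(1,2) Lpos h, of A, folded S_def assms(5)]
    have ineq: "kernel_norm1 K ^ num_edges F \<le> hom_density F K"
      using assms(8)
    proof
      assume d: "\<forall>r\<ge>1. C dvd N r"
      then show ?thesis
        using D(1)[OF divisible[OF d]] unfolding edges dens L(4) by (simp add: divisible(1)[OF d] sum_mset_repeat_mset)
    next
      assume "\<exists>r\<ge>1. (\<forall>r'\<ge>1. r' \<noteq> r \<longrightarrow> N r' = 0) \<and> N r \<ge> C"
      then obtain r where r: "r \<ge> 1" "\<forall>r'\<ge>1. r' \<noteq> r \<longrightarrow> N r' = 0" "N r \<ge> C" by blast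
      show ?thesis
        using O(1)[OF single[OF r(1,2)] r(3,1)] unfolding edges dens L(4) single[OF r(1,2)] by simp
    qed
    moreover have "AE p in unit_square. K p = kernel_norm1 K"
      if d: "\<forall>r\<ge>1. C dvd N r" and s: "size \<Theta> \<ge> 2" and eq: "hom_density F K = kernel_norm1 K ^ num_edges F"
    proof -
      have "num_edges F = C * sum_mset \<Theta>" by (simp add: edges divisible(1)[OF d] sum_mset_repeat_mset)
      then have "AE p in unit_pair. L p = kernel_norm1 K"
        using D(2)[OF divisible[OF d] s] eq unfolding dens L(4) by simp
      from AE_unit_squareD[OF this] L(3) show ?thesis by eventually_elim simp
    qed
    moreover have "hom_density (uniform_subdivision h r) K = kernel_norm1 K ^ num_edges (uniform_subdivision h r)"
      if r: "r \<ge> 1" "\<forall>r'\<ge>1. r' \<noteq> r \<longrightarrow> N r' = 0" "N r \<ge> C"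
        and eq: "hom_density F K = kernel_norm1 K ^ num_edges F" for r
    proof -
      have "num_edges F = N r * r" by (simp add: edges single[OF r(1,2)])
      then show ?thesis
        using O(2)[OF single[OF r(1,2)] r(3,1)] eq
        unfolding hom_density_uniform_subdivision[OF r(1) Ls L(3)] num_edges_uniform_subdivision
          dens L(4) assms(5) by simp
    qed
    ultimately show ?thesis by blast
  qed
  have "Sidorenko_good F"
    unfolding Sidorenko_good_def
  proof (intro allI impI)
    fix K assume dnn: "doubly_nonnegative K"
    show "hom_density F K \<ge> kernel_norm1 K ^ num_edges F"
    proof (cases "kernel_norm1 K > 0")
      case True
      then show ?thesis using main[OF dnn] by blast
    next
      case False
      obtain L where L: "unit.psd L" "\<And>p. L p \<ge> 0" "AE p in unit_square. K p = L p"
        "integral\<^sup>L unit_pair L = kernel_norm1 K"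
        using doubly_nonnegative_Borel_version[OF dnn] by metis
      have "kernel_norm1 K \<ge> 0"
        unfolding L(4)[symmetric] by (intro Bochner_Integration.integral_nonneg L(2))
      then have "kernel_norm1 K = 0" using False by simp
      moreover have "hom_density F K \<ge> 0"
        unfolding assms(4) hom_density_replace_edges[OF E P unit.psd_sym[OF L(1)] L(3)] unit.pattern_density_def
        by (intro Bochner_Integration.integral_nonneg unit.pattern_product_nonneg L(2))
      ultimately show ?thesis using assms(7) by (simp add: power_0_left)
    qed
  qed
  have const: "hom_density F K = kernel_norm1 K ^ num_edges F"
    if "AE p in unit_square. K p = kernel_norm1 K" for K
    using hom_density_const[OF multigraph_replace_edges[OF E] that] by (simp add: assms(4))
  show ?thesis
  proof (intro conjI allI impI)
    show "Sidorenko_good F" by fact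
  next
    fix K
    assume d: "\<forall>r\<ge>1. C dvd N r" and s: "size (average_pattern h E P) \<ge> 2"
      and K: "doubly_nonnegative K \<and> kernel_norm1 K > 0"
    show "hom_density F K = kernel_norm1 K ^ num_edges F \<longleftrightarrow>
        (AE p in unit_square. K p = kernel_norm1 K)"
    proof
      assume "hom_density F K = kernel_norm1 K ^ num_edges F"
      then show "AE p in unit_square. K p = kernel_norm1 K"
        using main[of K] K d s unfolding \<Theta>_def by blast
    qed (rule const)
  next
    fix r K
    assume r: "r \<ge> 1" "(\<forall>r'\<ge>1. r' \<noteq> r \<longrightarrow> N r' = 0) \<and> N r \<ge> C"
      and forcing: "Sidorenko_good_forcing (uniform_subdivision h r)"
      and K: "doubly_nonnegative K \<and> kernel_norm1 K > 0"
    show "hom_density F K = kernel_norm1 K ^ num_edges F \<longleftrightarrow>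
        (AE p in unit_square. K p = kernel_norm1 K)"
    proof
      assume "hom_density F K = kernel_norm1 K ^ num_edges F"
      then have "hom_density (uniform_subdivision h r) K =
          kernel_norm1 K ^ num_edges (uniform_subdivision h r)"
        using main[of K] K r by blast
      then show "AE p in unit_square. K p = kernel_norm1 K"
        using forcing K unfolding Sidorenko_good_forcing_def by blast
    qed (rule const)
  qed
qed

end
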